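(* Let $0<\varepsilon<1$ and let $k\le d$ be positive integers. There is a distribution over $s$-sparse matrices in $\mathbb{R}^{m\times d}$ with $m=O(\varepsilon^{-2}k)$ and \[ s=O\left(\frac{1}{\varepsilon}\left(\frac{k}{\lg(1/\varepsilon)}+k^{2/3}\lg^{1/3}k\right)\right), \] such that for any $k$-dimensional subspace $V\subseteq\mathbb{R}^d$, with probability at least $1-2^{-k^{2/3}}$ a matrix $A$ sampled from this distribution is an $\varepsilon$-JL matrix for $V$, i.e. $\|Ax\|_2^2\in[(1-\varepsilon)\|x\|_2^2,(1+\varepsilon)\|x\|_2^2]$ for all $x\in V$.
   Context: A matrix is $s$-sparse if each of its columns has at most $s$ non-zero entries. $\lg$ denotes the base-2 logarithm. *)

theory Defs
  imports "HOL-Probability.Probability" "Jordan_Normal_Form.VS_Connect"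
begin

text \<open>
  Both \<open>m\<close> and \<open>d\<close> are quantified inside the scope of the absolute constants hidden in the
  \<open>O\<close>-notation, so matrices and vectors carry their dimensions as values, not as types.
\<close>

definition sparse_mat :: "nat \<Rightarrow> real mat \<Rightarrow> bool" where
  "sparse_mat s A \<longleftrightarrow>
     (\<forall>j < dim_col A. card {i. i < dim_row A \<and> A $$ (i, j) \<noteq> 0} \<le> s)"

text \<open>The Borel sigma-algebra of \<open>\<real>\<^bsup>m\<times>d\<^esup>\<close>, transported along the entries
  (the index set is finite, so the product sigma-algebra is the Borel one).\<close>

definition borel_mat :: "nat \<Rightarrow> nat \<Rightarrow> real mat measure" where
  "borel_mat m d = vimage_algebra (carrier_mat m d)
     (\<lambda>A. \<lambda>ij \<in> {..<m} \<times> {..<d}. A $$ ij)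
     (Pi\<^sub>M ({..<m} \<times> {..<d}) (\<lambda>_. borel))"

definition sparse_mat_distribution :: "nat \<Rightarrow> nat \<Rightarrow> nat \<Rightarrow> real mat measure \<Rightarrow> bool" where
  "sparse_mat_distribution m d s M \<longleftrightarrow>
     prob_space M \<and>
     sets M = sets (restrict_space (borel_mat m d) {A \<in> carrier_mat m d. sparse_mat s A})"

definition l2_norm :: "real Matrix.vec \<Rightarrow> real" where
  "l2_norm x = L2_set (vec_index x) {..<dim_vec x}"

definition is_subspace_of_dim :: "nat \<Rightarrow> nat \<Rightarrow> real Matrix.vec set \<Rightarrow> bool" where
  "is_subspace_of_dim d k V \<longleftrightarrow>
     VectorSpace.subspace class_ring V (module_vec TYPE(real) d) \<and>
     vectorspace.dim class_ring (module_vec TYPE(real) d\<lparr>carrier := V\<rparr>) = k"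

definition JL_matrix :: "real \<Rightarrow> real Matrix.vec set \<Rightarrow> real mat \<Rightarrow> bool" where
  "JL_matrix \<epsilon> V A \<longleftrightarrow>
     (\<forall>x \<in> V. (l2_norm (A *\<^sub>v x))\<^sup>2 \<in>
        {(1 - \<epsilon>) * (l2_norm x)\<^sup>2 .. (1 + \<epsilon>) * (l2_norm x)\<^sup>2})"

end

theory Submission
  imports Defs "Jordan_Normal_Form.Gram_Schmidt"
begin

text \<open>
  The random matrix \<open>A\<close> stacks \<open>s\<close> independent count sketches with \<open>B\<close> buckets each, scaled by
  \<open>1 / sqrt s\<close>; its columns are unit vectors, so \<open>\<parallel>Ax\<parallel>\<^sup>2 - \<parallel>x\<parallel>\<^sup>2\<close> is an off-diagonal quadratic form.
  With \<open>q = 1 / B\<close>, the form is decoupled into bilinear forms of vectors with disjoint supports,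
  whose exponential moments are dominated by those of independent rows. One row contributes
  \<open>E exp (\<mu> X Y) \<le> 1 + O(\<mu>\<^sup>2 q\<^sup>2)\<close> as soon as \<open>\<mu> \<le> ln (1 / q) / 8\<close> and one of the two vectors has entries
  of size at most \<open>1 / \<mu>\<close>. Hence flat vectors may be tested with a \<open>\<mu>\<close> that is larger by the factor
  \<open>D = min (ln (1 / \<epsilon>)) \<tau>\<close>, where \<open>\<tau> = (k / lg k) powr (1/3)\<close>, than arbitrary ones, which saves this
  factor in \<open>s\<close>.

  A vector of a net of the subspace splits into a tail with entries at most \<open>1 / \<tau>\<close> and a head
  supported on at most \<open>\<tau>\<^sup>2\<close> coordinates. Tail and cross terms fail with probability \<open>exp (- c k)\<close>,
  which beats the size of the net. Heads live on coordinates of leverage score at least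
  \<open>1 / \<tau>\<^sup>2\<close>, of which there are at most \<open>k \<tau>\<^sup>2\<close>, so only \<open>exp (O(\<tau>\<^sup>2 lg k))\<close> supports have to be
  considered, and \<open>\<tau>\<^sup>2 lg k = k / \<tau> \<le> k / D\<close>.
\<close>

section \<open>Sums of sparse random signs\<close>

text \<open>Everything is tuned through the Chernoff exponent
  \<open>s * \<mu> * (row_const * \<mu> / B - \<eta>)\<close> with \<open>\<eta>\<close> of order
  \<open>\<epsilon>\<close> and \<open>\<mu>\<close> up to order \<open>D\<close>. The variance term
  must stay below \<open>\<eta>\<close>, which asks for \<open>B\<close> of order
  \<open>D / \<epsilon>\<close>; the exponent must then reach order \<open>- k\<close>, which asks
  for \<open>s\<close> of order \<open>k / (\<epsilon> * D)\<close>. In \<open>s * B\<close> the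
  factor \<open>D\<close> cancels. The obstacle is that a vector with entries near 1 only admits
  \<open>\<mu>\<close> of order 1. Its exponent is of order \<open>- k / D\<close>, hopeless against
  a net of \<open>exp (18 * k)\<close> points but sufficient against
  \<open>exp (O(k / \<tau>))\<close> heads. A larger \<open>\<tau>\<close> would create too many
  supports, a smaller one would cap \<open>\<mu>\<close>; \<open>\<tau> ^ 3 = k / lg k\<close> is
  the balance. The margin left for the heads is exponential in
  \<open>k / \<tau> = k powr (2/3) * (lg k) powr (1/3)\<close>. This quantity is the source of both
  the second summand of \<open>s\<close> and the success probability. All randomness is uniform on a
  finite set of hash tables, so until the last section probabilities are cardinalities and
  expectations are finite sums or recursive averages.\<close>

lemma sinh_le_mult_cosh:
  fixes x :: real
  assumes "0 \<le> x"
  shows "sinh x \<le> x * cosh x"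
proof -
  have "0 * cosh 0 - sinh (0::real) \<le> x * cosh x - sinh x"
  proof (rule DERIV_nonneg_imp_nondecreasing[OF assms])
    fix y :: real assume "0 \<le> y"
    then show "\<exists>z. DERIV (\<lambda>x. x * cosh x - sinh x) y :> z \<and> 0 \<le> z"
      by (intro exI[of _ "y * sinh y"] conjI) (auto intro!: derivative_eq_intros)
  qed
  then show ?thesis by simp
qed

lemma le_sinh:
  fixes x :: real
  assumes "0 \<le> x"
  shows "x \<le> sinh x"
proof -
  have "sinh (0::real) - 0 \<le> sinh x - x"
  proof (rule DERIV_nonneg_imp_nondecreasing[OF assms])
    fix y :: real assume "0 \<le> y"
    then show "\<exists>z. DERIV (\<lambda>x. sinh x - x) y :> z \<and> 0 \<le> z"
      by (intro exI[of _ "cosh y - 1"] conjI)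
        (auto intro!: derivative_eq_intros simp: cosh_real_ge_1)
  qed
  then show ?thesis by simp
qed

text \<open>Half-argument formula; the absolute value makes the argument of \<open>sinh\<close>
  nonnegative, so that \<open>le_sinh\<close> and \<open>sinh_le_mult_cosh\<close> can be
  squared.\<close>

lemma cosh_minus_one_eq:
  fixes x :: real
  shows "cosh x - 1 = 2 * (sinh (\<bar>x\<bar> / 2))\<^sup>2"
  using cosh_double[of "\<bar>x\<bar> / 2"] by (simp add: cosh_square_eq)

lemma cosh_minus_one_ge:
  fixes x :: real
  shows "x\<^sup>2 / 2 \<le> cosh x - 1"
proof -
  have "(\<bar>x\<bar> / 2)\<^sup>2 \<le> (sinh (\<bar>x\<bar> / 2))\<^sup>2"
    by (intro power_mono le_sinh) auto
  then show ?thesis unfolding cosh_minus_one_eq by (simp add: power_divide)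
qed

lemma cosh_minus_one_le:
  fixes x :: real
  shows "cosh x - 1 \<le> x\<^sup>2 / 2 * cosh x"
proof -
  define y where "y = \<bar>x\<bar> / 2"
  have c: "(cosh y)\<^sup>2 \<le> cosh x"
    using cosh_double[of y] cosh_real_ge_1[of x] unfolding y_def
    by (simp add: sinh_square_eq)
  have "(sinh y)\<^sup>2 \<le> (y * cosh y)\<^sup>2"
    by (intro power_mono sinh_le_mult_cosh) (auto simp: y_def)
  also have "\<dots> = x\<^sup>2 / 4 * (cosh y)\<^sup>2"
    by (simp add: y_def power_mult_distrib power_divide)
  also have "\<dots> \<le> x\<^sup>2 / 4 * cosh x" using c by (intro mult_left_mono) auto
  finally show ?thesis unfolding cosh_minus_one_eq[of x] y_def by simp
qed

lemma cosh_le_exp_abs: "cosh x \<le> exp \<bar>x\<bar>" for x :: real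
  unfolding cosh_def by (cases "x \<ge> 0") auto

lemma cosh_mono_abs: "\<bar>x\<bar> \<le> y \<Longrightarrow> cosh x \<le> cosh y" for x y :: real
  using cosh_real_nonneg_le_iff[of "\<bar>x\<bar>" y] by simp

text \<open>A random sign multiplied by an independent Bernoulli(\<open>q\<close>) variable is subgaussian with
  variance proxy of order \<open>1 / ln (1 / q)\<close>.\<close>

lemma bernoulli_sign_mgf_le:
  fixes q z L :: real
  assumes "0 < q" "q < 1" and L: "L = ln (1 / q)"
  shows "1 + q * (cosh z - 1) \<le> exp (2 * z\<^sup>2 / L)"
proof -
  have L0: "0 < L" using assms by simp
  have q: "q = exp (- L)" using assms by (simp add: ln_div)
  show ?thesis
  \<comment> \<open>Below \<open>L / 2\<close> the factor \<open>exp \<bar>z\<bar>\<close> uses up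
    only half of \<open>q = exp (- L)\<close>, and the rest \<open>exp (- (L / 2))\<close> is at
    most \<open>2 / L\<close>. Above \<open>L / 2\<close> the factor \<open>q\<close> is given up,
    since there \<open>\<bar>z\<bar>\<close> is already below
    \<open>2 * z\<^sup>2 / L\<close>.\<close>
  proof (cases "\<bar>z\<bar> \<le> L / 2")
    case True
    have "L / 2 < exp (L / 2)" using exp_ge_add_one_self[of "L / 2"] by linarith
    then have "L * exp (- (L / 2)) \<le> 2" by (simp add: exp_minus field_simps)
    then have e: "exp (- (L / 2)) \<le> 2 / L" using L0 by (simp add: field_simps)
    have "q * (cosh z - 1) \<le> q * (z\<^sup>2 / 2 * exp (L / 2))"
      using cosh_minus_one_le[of z] cosh_le_exp_abs[of z] True \<open>0 < q\<close>
      by (intro mult_left_mono order_trans[OF cosh_minus_one_le]) (auto intro: order_trans)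
    also have "\<dots> = z\<^sup>2 / 2 * exp (- (L / 2))"
      unfolding q by (simp add: mult_exp_exp)
    also have "\<dots> \<le> z\<^sup>2 / 2 * (2 / L)" using e by (intro mult_left_mono) auto
    also have "\<dots> \<le> 2 * z\<^sup>2 / L" using L0 by (simp add: field_simps)
    finally show ?thesis using exp_ge_add_one_self[of "2 * z\<^sup>2 / L"] by linarith
  next
    case False
    have "1 + q * (cosh z - 1) \<le> cosh z"
      using mult_right_mono[of q 1 "cosh z - 1"] assms cosh_real_ge_1[of z] by simp
    also have "\<dots> \<le> exp \<bar>z\<bar>" by (rule cosh_le_exp_abs)
    also have "\<bar>z\<bar> \<le> 2 * z\<^sup>2 / L"
    proof -
      have "\<bar>z\<bar> * L \<le> \<bar>z\<bar> * (2 * \<bar>z\<bar>)" using False by (intro mult_left_mono) auto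
      then show ?thesis using L0 by (simp add: field_simps power2_eq_square)
    qed
    finally show ?thesis by simp
  qed
qed

text \<open>\<open>sparse_sign_mean q u n f x\<close> is the expectation of \<open>f (x + (\<Sum>j<n. \<delta>\<^sub>j * \<sigma>\<^sub>j * u j))\<close> for
  independent Bernoulli(\<open>q\<close>) variables \<open>\<delta>\<^sub>j\<close> and uniform signs \<open>\<sigma>\<^sub>j\<close>.\<close>

fun sparse_sign_mean ::
  "real \<Rightarrow> (nat \<Rightarrow> real) \<Rightarrow> nat \<Rightarrow> (real \<Rightarrow> real) \<Rightarrow> real \<Rightarrow> real" where
  "sparse_sign_mean q u 0 f x = f x"
| "sparse_sign_mean q u (Suc n) f x =
     (1 - q) * sparse_sign_mean q u n f x
     + q / 2 * (sparse_sign_mean q u n f (x + u n) + sparse_sign_mean q u n f (x - u n))"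

text \<open>Only points within \<open>\<Sum>j<n. \<bar>u j\<bar>\<close> of \<open>x\<close> are
  ever evaluated. Restricting the comparison to them lets a sum of finitely many layers serve as a
  majorant later.\<close>

lemma sparse_sign_mean_mono:
  assumes "0 \<le> q" "q \<le> 1" "\<And>z. \<bar>z - x\<bar> \<le> (\<Sum>j<n. \<bar>u j\<bar>) \<Longrightarrow> f z \<le> g z"
  shows "sparse_sign_mean q u n f x \<le> sparse_sign_mean q u n g x"
  using assms(3)
proof (induction n arbitrary: x)
  case 0
  then show ?case by simp
next
  case (Suc n)
  have "sparse_sign_mean q u n f (x + y) \<le> sparse_sign_mean q u n g (x + y)"
    if "\<bar>y\<bar> \<le> \<bar>u n\<bar>" for y
    using that by (intro Suc.IH Suc.prems) auto
  from this[of 0] this[of "u n"] this[of "- u n"] show ?case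
    using assms(1,2) by (auto intro!: add_mono mult_left_mono)
qed

lemma sparse_sign_mean_add:
  "sparse_sign_mean q u n (\<lambda>z. f z + g z) x
     = sparse_sign_mean q u n f x + sparse_sign_mean q u n g x"
  by (induction n arbitrary: x) (auto simp: algebra_simps)

lemma sparse_sign_mean_cmult:
  "sparse_sign_mean q u n (\<lambda>z. c * f z) x = c * sparse_sign_mean q u n f x"
  by (induction n arbitrary: x) (auto simp: algebra_simps)

lemma sparse_sign_mean_const: "sparse_sign_mean q u n (\<lambda>z. c) x = c"
  by (induction n arbitrary: x) (auto simp: algebra_simps)

lemma sparse_sign_mean_sum:
  "sparse_sign_mean q u n (\<lambda>z. \<Sum>i\<in>I. f i z) x = (\<Sum>i\<in>I. sparse_sign_mean q u n (f i) x)"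
  by (induction I rule: infinite_finite_induct)
    (auto simp: sparse_sign_mean_add sparse_sign_mean_const)

text \<open>In \<open>cosh (z * (x + u n)) + cosh (z * (x - u n))\<close> the \<open>sinh\<close>
  terms cancel, so \<open>cosh (z * x)\<close> is an eigenfunction of every averaging step and the
  moment factorises over the coordinates.\<close>

lemma sparse_sign_mean_cosh:
  "sparse_sign_mean q u n (\<lambda>x. cosh (z * x)) x
     = (\<Prod>j<n. 1 + q * (cosh (z * u j) - 1)) * cosh (z * x)"
proof (induction n arbitrary: x)
  case (Suc n)
  have "cosh (z * (x + u n)) + cosh (z * (x - u n)) = 2 * cosh (z * x) * cosh (z * u n)"
    by (simp add: distrib_left right_diff_distrib cosh_add cosh_diff)
  then have "q / 2 * (P * cosh (z * (x + u n)) + P * cosh (z * (x - u n)))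
      = q * P * cosh (z * x) * cosh (z * u n)" for P
    by (simp flip: distrib_left)
  then have "sparse_sign_mean q u (Suc n) (\<lambda>x. cosh (z * x)) x
      = (1 - q) * ((\<Prod>j<n. 1 + q * (cosh (z * u j) - 1)) * cosh (z * x))
        + q * (\<Prod>j<n. 1 + q * (cosh (z * u j) - 1)) * cosh (z * x) * cosh (z * u n)"
    by (simp only: sparse_sign_mean.simps Suc.IH)
  also have "\<dots> = (\<Prod>j<Suc n. 1 + q * (cosh (z * u j) - 1)) * cosh (z * x)"
    unfolding prod.lessThan_Suc by (simp add: algebra_simps)
  finally show ?case .
qed simp

lemma sparse_sign_mean_square:
  "sparse_sign_mean q u n (\<lambda>x. x\<^sup>2) x = x\<^sup>2 + q * (\<Sum>j<n. (u j)\<^sup>2)"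
  by (induction n arbitrary: x) (auto simp: algebra_simps power2_eq_square)

lemma prod_bernoulli_sign_mgf_le:
  fixes q z L :: real and u :: "nat \<Rightarrow> real"
  assumes "0 < q" "q < 1" and L: "L = ln (1 / q)" and "(\<Sum>j<n. (u j)\<^sup>2) \<le> 1"
  shows "(\<Prod>j<n. 1 + q * (cosh (z * u j) - 1)) \<le> exp (2 * z\<^sup>2 / L)"
proof -
  have L0: "0 < L" using assms by simp
  have "(\<Prod>j<n. 1 + q * (cosh (z * u j) - 1)) \<le> (\<Prod>j<n. exp (2 * (z * u j)\<^sup>2 / L))"
    using assms cosh_real_ge_1
    by (intro prod_mono conjI bernoulli_sign_mgf_le) (auto intro!: add_nonneg_nonneg)
  also have "\<dots> = exp (2 * z\<^sup>2 / L * (\<Sum>j<n. (u j)\<^sup>2))"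
    by (simp add: exp_sum sum_distrib_left sum_divide_distrib power_mult_distrib mult_ac)
  also have "2 * z\<^sup>2 / L * (\<Sum>j<n. (u j)\<^sup>2) \<le> 2 * z\<^sup>2 / L * 1"
    using assms(4) L0 by (intro mult_left_mono) auto
  finally show ?thesis by simp
qed

text \<open>While all \<open>z * u j\<close> stay bounded, the Taylor estimate keeps the true
  variance of order \<open>q\<close>, where the subgaussian bound only offers \<open>1 / L\<close>.
  The price is the factor \<open>cosh R\<close>.\<close>

lemma prod_bernoulli_sign_mgf_le_sharp:
  fixes q z R :: real and u :: "nat \<Rightarrow> real"
  assumes "0 \<le> q" "(\<Sum>j<n. (u j)\<^sup>2) \<le> 1" "\<And>j. j < n \<Longrightarrow> \<bar>z * u j\<bar> \<le> R"
  shows "(\<Prod>j<n. 1 + q * (cosh (z * u j) - 1)) \<le> exp (q * z\<^sup>2 / 2 * cosh R)"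
proof -
  have "(\<Prod>j<n. 1 + q * (cosh (z * u j) - 1)) \<le> (\<Prod>j<n. exp (q * ((z * u j)\<^sup>2 / 2 * cosh R)))"
  proof (intro prod_mono conjI)
    fix j assume j: "j \<in> {..<n}"
    show "0 \<le> 1 + q * (cosh (z * u j) - 1)"
      using assms(1) cosh_real_ge_1[of "z * u j"] by simp
    have "cosh (z * u j) - 1 \<le> (z * u j)\<^sup>2 / 2 * cosh (z * u j)"
      by (rule cosh_minus_one_le)
    also have "\<dots> \<le> (z * u j)\<^sup>2 / 2 * cosh R"
      using assms(3) j by (intro mult_left_mono cosh_mono_abs) auto
    finally have "q * (cosh (z * u j) - 1) \<le> q * ((z * u j)\<^sup>2 / 2 * cosh R)"
      using assms(1) by (rule mult_left_mono)
    then show "1 + q * (cosh (z * u j) - 1) \<le> exp (q * ((z * u j)\<^sup>2 / 2 * cosh R))"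
      by (meson add_left_mono exp_ge_add_one_self order_trans)
  qed
  also have "\<dots> = exp (q * z\<^sup>2 / 2 * cosh R * (\<Sum>j<n. (u j)\<^sup>2))"
    by (simp add: exp_sum sum_distrib_left sum_divide_distrib power_mult_distrib mult_ac)
  also have "q * z\<^sup>2 / 2 * cosh R * (\<Sum>j<n. (u j)\<^sup>2) \<le> q * z\<^sup>2 / 2 * cosh R * 1"
    using assms(1,2) by (intro mult_left_mono) auto
  finally show ?thesis by simp
qed

lemma exp_minus_one_le:
  fixes w W :: real
  assumes "0 \<le> w" "w \<le> W"
  shows "exp w \<le> 1 + w * exp W"
proof -
  have "1 - w \<le> exp (- w)" using exp_ge_add_one_self[of "- w"] by simp
  then have "(1 - w) * exp w \<le> exp (- w) * exp w" by (intro mult_right_mono) auto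
  then have "exp w \<le> 1 + w * exp w" by (simp add: algebra_simps flip: exp_add)
  also have "\<dots> \<le> 1 + w * exp W" using assms by (intro add_left_mono mult_left_mono) auto
  finally show ?thesis .
qed

section \<open>The exponential moment of one row\<close>

text \<open>The first summand is the coefficient produced by the range
  \<open>\<bar>x\<bar> \<le> 7\<close>. The second is \<open>4 * 32\<^sup>2\<close>: by
  \<open>\<mu> \<ge> 1 / 32\<close> it absorbs the layer contribution \<open>4 * q ^ 3\<close> into
  a multiple of \<open>\<mu>\<^sup>2 * q\<^sup>2\<close>.\<close>

definition row_const :: real where
  "row_const = cosh 7 / 2 * exp (49 * cosh 7 / 2) + 4096"

text \<open>7 is the least integer with \<open>n\<^sup>2 / 16 \<ge> 3\<close>, so the first layer
  already yields \<open>q ^ 3\<close>. Each later layer gains at least another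
  \<open>exp (- (7 / 8))\<close>, which is below 1/2, because \<open>L \<ge> 1\<close>.\<close>

lemma geometric_layer_sum_le:
  fixes q L :: real
  assumes q: "0 < q" "L = ln (1 / q)" "1 \<le> L"
  shows "(\<Sum>n=7..<N. 2 * exp (- (L * (real n)\<^sup>2 / 16))) \<le> 4 * q ^ 3"
proof -
  have e: "exp (- L) = q" using q by (simp add: ln_div)
  have "(\<Sum>n=7..<N. 2 * exp (- (L * (real n)\<^sup>2 / 16))) \<le> (\<Sum>n=7..<N. 2 * q ^ 3 * (1 / 2) ^ (n - 7))"
  proof (rule sum_mono)
    fix n assume "n \<in> {7..<N}"
    then obtain i where n: "n = 7 + i" by (auto simp: le_iff_add)
    have "3 + 7 * real i / 8 \<le> (real n)\<^sup>2 / 16"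
      unfolding n by (simp add: power2_eq_square algebra_simps)
    then have "L * (3 + 7 * real i / 8) \<le> L * ((real n)\<^sup>2 / 16)"
      using \<open>1 \<le> L\<close> by (intro mult_left_mono) linarith+
    moreover have "7 * real i / 8 \<le> L * (7 * real i / 8)"
      using mult_right_mono[of 1 L "7 * real i / 8"] q by simp
    ultimately have "3 * L + 7 * real i / 8 \<le> L * (real n)\<^sup>2 / 16"
      by (simp add: algebra_simps)
    then have "exp (- (L * (real n)\<^sup>2 / 16)) \<le> exp (- (3 * L) + - (7 * real i / 8))"
      by simp
    also have "\<dots> = exp (- L) ^ 3 * exp (- (7 / 8)) ^ i"
      by (subst exp_add) (simp add: exp_of_nat_mult[symmetric] mult_ac)
    also have "\<dots> \<le> q ^ 3 * (1 / 2) ^ i"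
    proof -
      have "exp (- (7 / 8 :: real)) \<le> 1 / 2"
      proof -
        have "1 + 7 / 8 + (7 / 8)\<^sup>2 / 2 \<le> exp (7 / 8 :: real)"
          by (rule exp_lower_Taylor_quadratic) simp
        then show ?thesis by (simp add: exp_minus field_simps power2_eq_square)
      qed
      then show ?thesis using q unfolding e
        by (intro mult_left_mono power_mono) auto
    qed
    finally show "2 * exp (- (L * (real n)\<^sup>2 / 16)) \<le> 2 * q ^ 3 * (1 / 2) ^ (n - 7)"
      by (simp add: n)
  qed
  also have "\<dots> = 2 * q ^ 3 * (\<Sum>n=7..<N. (1 / 2) ^ (n - 7))"
    by (simp add: sum_distrib_left)
  also have "(\<Sum>n=7..<N. (1 / 2) ^ (n - 7)) = (\<Sum>i<N - 7. (1 / 2 :: real) ^ i)"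
    by (rule sum.reindex_bij_witness[of _ "\<lambda>i. i + 7" "\<lambda>n. n - 7"]) auto
  also have "2 * q ^ 3 * (\<Sum>i<N - 7. (1 / 2 :: real) ^ i) \<le> 2 * q ^ 3 * 2"
    using q by (intro mult_left_mono) (auto simp: sum_gp_strict)
  finally show ?thesis by simp
qed

text \<open>Moderate values of the outer variable are handled by the sharp bound; the values above
  \<open>7\<close> are cut into unit layers on which the subgaussian bound for both variables gains more than
  the factor \<open>q\<^sup>3\<close>.\<close>

lemma sparse_sign_bilinear_mgf_le:
  fixes q \<mu> :: real and u y :: "nat \<Rightarrow> real"
  assumes q: "0 < q" "1 \<le> ln (1 / q)"
    and u: "(\<Sum>j<n. (u j)\<^sup>2) \<le> 1" and y: "(\<Sum>j<n. (y j)\<^sup>2) \<le> 1"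
    and \<mu>: "1 / 32 \<le> \<mu>" "\<mu> \<le> ln (1 / q) / 8" "\<mu>\<^sup>2 * q \<le> 1"
    and small: "\<And>j. j < n \<Longrightarrow> \<mu> * \<bar>y j\<bar> \<le> 1"
  shows "sparse_sign_mean q u n (\<lambda>x. \<Prod>j<n. 1 + q * (cosh (\<mu> * x * y j) - 1)) 0
           \<le> 1 + row_const * \<mu>\<^sup>2 * q\<^sup>2"
proof -
  define L where "L = ln (1 / q)"
  define \<phi> where "\<phi> = (\<lambda>x. \<Prod>j<n. 1 + q * (cosh (\<mu> * x * y j) - 1))"
  define C where "C = cosh 7 / 2 * exp (49 * cosh 7 / 2 :: real)"
  \<comment> \<open>Large enough that the layers below \<open>N\<close> cover every reachable value
    of the outer variable.\<close>
  define N where "N = nat \<lceil>\<Sum>j<n. \<bar>u j\<bar>\<rceil> + 1"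
  \<comment> \<open>On the layer \<open>m \<le> \<bar>x\<bar> \<le> m + 1\<close> the inner moment
    is at most \<open>exp (L * (m + 1)\<^sup>2 / 32)\<close>. The remaining factor
    \<open>2 * exp (- (L * m\<^sup>2 / 4)) * cosh (m * L / 4 * x)\<close> is a smooth majorant of
    the indicator of \<open>\<bar>x\<bar> \<ge> m\<close>; its parameter \<open>m * L / 4\<close> is
    the optimal Chernoff parameter for the subgaussian bound.\<close>
  define g where "g = (\<lambda>m x. 2 * exp (L * (real (m + 1))\<^sup>2 / 32 - L * (real m)\<^sup>2 / 4) * cosh (real m * L / 4 * x))"
  have L1: "1 \<le> L" using q unfolding L_def by simp
  have q1: "q < 1" using q by (metis L1 L_def divide_le_eq_1_pos ln_le_zero_iff not_le order.strict_trans1 zero_less_one zero_less_divide_1_iff)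
  have "\<phi> x \<le> 1 + (C * q * \<mu>\<^sup>2 * x\<^sup>2 + (\<Sum>m=7..<N. g m x))"
    if "\<bar>x - 0\<bar> \<le> (\<Sum>j<n. \<bar>u j\<bar>)" for x
  proof (cases "\<bar>x\<bar> \<le> 7")
    case True
    have "\<phi> x \<le> exp (q * (\<mu> * x)\<^sup>2 / 2 * cosh 7)"
      unfolding \<phi>_def
    proof (rule prod_bernoulli_sign_mgf_le_sharp)
      fix j assume "j < n"
      then have "\<bar>x\<bar> * (\<mu> * \<bar>y j\<bar>) \<le> 7 * 1"
        using True small \<mu> by (intro mult_mono) auto
      then show "\<bar>\<mu> * x * y j\<bar> \<le> 7" using \<mu> by (simp add: abs_mult mult_ac)
    qed (use q y in auto)
    \<comment> \<open>The condition \<open>\<mu>\<^sup>2 * q \<le> 1\<close> bounds the exponent, so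
      linearising \<open>exp\<close> costs a constant only. What remains is quadratic in
      \<open>x\<close>, and the mean of \<open>x\<^sup>2\<close> supplies the second factor
      \<open>q\<close>.\<close>
    also have "\<dots> \<le> 1 + q * (\<mu> * x)\<^sup>2 / 2 * cosh 7 * exp (49 * cosh 7 / 2)"
    proof (rule exp_minus_one_le)
      have "x\<^sup>2 \<le> 7\<^sup>2" using True abs_le_square_iff[of x 7] by simp
      then have "(\<mu>\<^sup>2 * q) * x\<^sup>2 \<le> 1 * 49" using \<mu> q by (intro mult_mono) auto
      then have "(\<mu>\<^sup>2 * q * x\<^sup>2) * (cosh 7 / 2) \<le> 49 * (cosh 7 / 2)"
        by (intro mult_right_mono) auto
      then show "q * (\<mu> * x)\<^sup>2 / 2 * cosh 7 \<le> 49 * cosh 7 / 2"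
        by (simp add: power_mult_distrib mult_ac)
    qed (use q in auto)
    also have "\<dots> = 1 + C * q * \<mu>\<^sup>2 * x\<^sup>2"
      by (simp add: C_def power_mult_distrib mult_ac)
    finally have "\<phi> x \<le> 1 + C * q * \<mu>\<^sup>2 * x\<^sup>2" .
    moreover have "0 \<le> (\<Sum>m=7..<N. g m x)" unfolding g_def by (intro sum_nonneg) auto
    ultimately show ?thesis by simp
  next
    case False
    define m where "m = nat \<lfloor>\<bar>x\<bar>\<rfloor>"
    have m: "real m \<le> \<bar>x\<bar>" "\<bar>x\<bar> \<le> real (m + 1)" unfolding m_def by linarith+
    have mN: "m \<in> {7..<N}" using False that unfolding m_def N_def by (auto simp: le_nat_floor) linarith
    have "\<phi> x \<le> exp (2 * (\<mu> * x)\<^sup>2 / L)"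
      unfolding \<phi>_def by (rule prod_bernoulli_sign_mgf_le) (use q q1 y L_def in auto)
    also have "2 * (\<mu> * x)\<^sup>2 / L \<le> L * (real (m + 1))\<^sup>2 / 32"
    proof -
      have "\<mu>\<^sup>2 \<le> (L / 8)\<^sup>2" using \<mu> unfolding L_def by (intro power_mono) auto
      moreover have "x\<^sup>2 \<le> (real (m + 1))\<^sup>2" using m abs_le_square_iff[of x "real (m + 1)"] by simp
      ultimately have "\<mu>\<^sup>2 * x\<^sup>2 \<le> (L / 8)\<^sup>2 * (real (m + 1))\<^sup>2" by (intro mult_mono) auto
      then have "2 * (\<mu> * x)\<^sup>2 / L \<le> 2 * ((L / 8)\<^sup>2 * (real (m + 1))\<^sup>2) / L"
        using L1 by (simp add: power_mult_distrib divide_right_mono)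
      also have "\<dots> = L * (real (m + 1))\<^sup>2 / 32"
        using L1 by (simp add: power2_eq_square)
      finally show ?thesis .
    qed
    also have "exp (L * (real (m + 1))\<^sup>2 / 32) \<le> g m x"
    proof -
      have "exp (L * (real m)\<^sup>2 / 4) \<le> exp \<bar>real m * L / 4 * x\<bar>"
        using mult_left_mono[OF m(1), of "real m * L"] L1 by (simp add: abs_mult power2_eq_square mult_ac)
      also have "\<dots> \<le> 2 * cosh (real m * L / 4 * x)"
        unfolding cosh_def by (cases "real m * L / 4 * x \<ge> 0") auto
      finally have "exp (- (L * (real m)\<^sup>2 / 4)) * exp (L * (real m)\<^sup>2 / 4)
          \<le> exp (- (L * (real m)\<^sup>2 / 4)) * (2 * cosh (real m * L / 4 * x))"
        by (intro mult_left_mono) auto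
      then have "1 \<le> exp (- (L * (real m)\<^sup>2 / 4)) * (2 * cosh (real m * L / 4 * x))"
        by (simp add: exp_add[symmetric])
      then have "exp (L * (real (m + 1))\<^sup>2 / 32) * 1
          \<le> exp (L * (real (m + 1))\<^sup>2 / 32) * (exp (- (L * (real m)\<^sup>2 / 4)) * (2 * cosh (real m * L / 4 * x)))"
        by (intro mult_left_mono) auto
      moreover have "2 * exp (A - b) * c = exp A * (exp (- b) * (2 * c))" for A b c :: real
        using exp_add[of A "- b"] by simp
      ultimately show ?thesis unfolding g_def by (simp only: mult_1_right)
    qed
    also have "g m x \<le> (\<Sum>m=7..<N. g m x)"
      using mN by (intro member_le_sum) (auto simp: g_def)
    finally have "\<phi> x \<le> (\<Sum>m=7..<N. g m x)" by simp
    moreover have "0 \<le> C * q * \<mu>\<^sup>2 * x\<^sup>2" using q by (simp add: C_def)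
    ultimately show ?thesis by simp
  qed
  then have "sparse_sign_mean q u n \<phi> 0
      \<le> sparse_sign_mean q u n (\<lambda>x. 1 + (C * q * \<mu>\<^sup>2 * x\<^sup>2 + (\<Sum>m=7..<N. g m x))) 0"
    using q q1 by (intro sparse_sign_mean_mono) auto
  also have "\<dots> = 1 + (C * q * \<mu>\<^sup>2 * (q * (\<Sum>j<n. (u j)\<^sup>2))
      + (\<Sum>m=7..<N. sparse_sign_mean q u n (g m) 0))"
    by (simp add: sparse_sign_mean_add sparse_sign_mean_const sparse_sign_mean_cmult
        sparse_sign_mean_sum sparse_sign_mean_square)
  also have "(\<Sum>m=7..<N. sparse_sign_mean q u n (g m) 0) \<le> (\<Sum>m=7..<N. 2 * exp (- (L * (real m)\<^sup>2 / 16)))"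
  proof (rule sum_mono)
    fix m assume m: "m \<in> {7..<N}"
    define w where "w = L * (real (m + 1))\<^sup>2 / 32 - L * (real m)\<^sup>2 / 4"
    have "sparse_sign_mean q u n (g m) 0 = 2 * exp w * (\<Prod>j<n. 1 + q * (cosh (real m * L / 4 * u j) - 1))"
      unfolding g_def w_def sparse_sign_mean_cmult sparse_sign_mean_cosh by simp
    also have "\<dots> \<le> 2 * exp w * exp (2 * (real m * L / 4)\<^sup>2 / L)"
      by (intro mult_left_mono prod_bernoulli_sign_mgf_le) (use q q1 u L_def in auto)
    also have "\<dots> = 2 * exp (w + L * (real m)\<^sup>2 / 8)"
      using L1 by (simp add: exp_add power2_eq_square)
    \<comment> \<open>From 7 on, \<open>(m + 1)\<^sup>2 \<le> 2 * m\<^sup>2\<close>, so the inner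
      variable spends at most \<open>L * m\<^sup>2 / 16\<close>, half of the
      \<open>L * m\<^sup>2 / 8\<close> gained from the tail of the outer one.\<close>
    also have "w + L * (real m)\<^sup>2 / 8 \<le> - (L * (real m)\<^sup>2 / 16)"
    proof -
      obtain i where i: "m = 7 + i" using m by (auto simp: le_iff_add)
      have "(real (m + 1))\<^sup>2 \<le> 2 * (real m)\<^sup>2"
        unfolding i by (simp add: power2_eq_square algebra_simps)
      then have "L * (real (m + 1))\<^sup>2 \<le> L * (2 * (real m)\<^sup>2)"
        using L1 by (intro mult_left_mono) auto
      then show ?thesis unfolding w_def by simp
    qed
    finally show "sparse_sign_mean q u n (g m) 0 \<le> 2 * exp (- (L * (real m)\<^sup>2 / 16))" by simp
  qed
  also have "\<dots> \<le> 4 * q ^ 3"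
    by (rule geometric_layer_sum_le) (use q L_def in auto)
  also have "4 * q ^ 3 \<le> 4096 * \<mu>\<^sup>2 * q\<^sup>2"
  proof -
    have "(1 / 32)\<^sup>2 \<le> \<mu>\<^sup>2" using \<mu> by (intro power_mono) auto
    then have "4 * q \<le> 4096 * \<mu>\<^sup>2" using q1 by (simp add: power2_eq_square)
    then have "4 * q * q\<^sup>2 \<le> 4096 * \<mu>\<^sup>2 * q\<^sup>2" by (intro mult_right_mono) auto
    then show ?thesis by (simp add: power3_eq_cube power2_eq_square)
  qed
  also have "C * q * \<mu>\<^sup>2 * (q * (\<Sum>j<n. (u j)\<^sup>2)) \<le> C * q * \<mu>\<^sup>2 * (q * 1)"
    using u q by (intro mult_left_mono) (auto simp: C_def)
  finally show ?thesis
    by (simp add: \<phi>_def row_const_def C_def algebra_simps power2_eq_square)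
qed

section \<open>Exponential moments of a stack of count sketches\<close>

text \<open>The sample space of one count sketch: column \<open>j\<close> has its only nonzero entry
  in row \<open>fst (\<theta> j)\<close>, with sign \<open>snd (\<theta> j)\<close>. Uniform choice
  corresponds to counting elements of this set.\<close>

definition hashes :: "nat \<Rightarrow> nat \<Rightarrow> (nat \<Rightarrow> nat \<times> real) set" where
  "hashes B n = PiE {..<n} (\<lambda>_. {..<B} \<times> {1, -1})"

definition bucket :: "(nat \<Rightarrow> nat \<times> real) \<Rightarrow> (nat \<Rightarrow> real) \<Rightarrow> nat \<Rightarrow> nat \<Rightarrow> real" where
  "bucket \<theta> w n r = (\<Sum>j<n. if fst (\<theta> j) = r then snd (\<theta> j) * w j else 0)"

text \<open>The expectation of \<open>exp (\<mu> * (x + X) * (z + Z))\<close> for one row with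
  independent columns, where \<open>X\<close> and \<open>Z\<close> are the sparse sign sums of
  \<open>u\<close> and \<open>y\<close> built from the same Bernoulli variables and the same signs.
  Arbitrary starting points \<open>x\<close> and \<open>z\<close> are carried along for the
  induction over columns.\<close>

fun bilinear_kernel ::
  "real \<Rightarrow> real \<Rightarrow> (nat \<Rightarrow> real) \<Rightarrow> (nat \<Rightarrow> real) \<Rightarrow> nat \<Rightarrow> real \<Rightarrow> real \<Rightarrow> real" where
  "bilinear_kernel q \<mu> u y 0 x z = exp (\<mu> * x * z)"
| "bilinear_kernel q \<mu> u y (Suc n) x z =
     (1 - q) * bilinear_kernel q \<mu> u y n x z
     + q / 2 * (bilinear_kernel q \<mu> u y n (x + u n) (z + y n)
              + bilinear_kernel q \<mu> u y n (x - u n) (z - y n))"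

lemma one_plus_sum_le_prod:
  fixes f :: "'a \<Rightarrow> real"
  assumes "\<And>x. x \<in> A \<Longrightarrow> 0 \<le> f x"
  shows "1 + (\<Sum>x\<in>A. f x) \<le> (\<Prod>x\<in>A. 1 + f x)"
  using assms
proof (induction A rule: infinite_finite_induct)
  case (insert a A)
  have "1 * f a \<le> (\<Prod>x\<in>A. 1 + f x) * f a"
    using insert.prems by (intro mult_right_mono prod_ge_1) auto
  then show ?case using insert by (simp add: algebra_simps)
qed auto

lemma bilinear_kernel_pos:
  assumes "0 \<le> q" "q \<le> 1"
  shows "0 < bilinear_kernel q \<mu> u y n x z"
proof (induction n arbitrary: x z)
  case (Suc n)
  show ?case
  proof (cases "q = 1")
    case True
    then show ?thesis using Suc by (simp add: add_pos_pos)
  next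
    case False
    then show ?thesis using Suc assms
      by (auto intro!: add_pos_nonneg mult_nonneg_nonneg simp: less_imp_le add_nonneg_nonneg)
  qed
qed simp

lemma exp_midpoint: "2 * exp a \<le> exp (a + b) + exp (a - b)" for a b :: real
proof -
  have "exp a * 1 \<le> exp a * cosh b" by (intro mult_left_mono) (auto simp: cosh_real_ge_1)
  then show ?thesis by (simp add: cosh_def exp_add exp_diff exp_minus field_simps)
qed

text \<open>The function \<open>exp (\<mu> * x * z)\<close> is convex in each variable but not
  jointly. Hence only one variable may move at a time, which disjoint supports of \<open>u\<close>
  and \<open>y\<close> guarantee when \<open>h\<close> and \<open>g\<close> are the entries of one
  column.\<close>

lemma bilinear_kernel_midpoint:
  assumes q: "0 \<le> q" "q \<le> 1" and "h = 0 \<or> g = 0"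
  shows "2 * bilinear_kernel q \<mu> u y n x z
           \<le> bilinear_kernel q \<mu> u y n (x + h) (z + g) + bilinear_kernel q \<mu> u y n (x - h) (z - g)"
proof (induction n arbitrary: x z)
  case 0
  show ?case using exp_midpoint[of "\<mu> * x * z" "\<mu> * h * z"] exp_midpoint[of "\<mu> * x * z" "\<mu> * x * g"]
      assms(3) by (auto simp: algebra_simps)
next
  case (Suc n)
  let ?k = "bilinear_kernel q \<mu> u y n"
  have "(1 - q) * (2 * ?k x z) \<le> (1 - q) * (?k (x + h) (z + g) + ?k (x - h) (z - g))"
    using q by (intro mult_left_mono Suc.IH) auto
  moreover have "q / 2 * (2 * ?k (x + u n) (z + y n))
      \<le> q / 2 * (?k (x + h + u n) (z + g + y n) + ?k (x - h + u n) (z - g + y n))"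
    using q Suc.IH[of "x + u n" "z + y n"]
    by (intro mult_left_mono) (auto simp: algebra_simps)
  moreover have "q / 2 * (2 * ?k (x - u n) (z - y n))
      \<le> q / 2 * (?k (x + h - u n) (z + g - y n) + ?k (x - h - u n) (z - g - y n))"
    using q Suc.IH[of "x - u n" "z - y n"]
    by (intro mult_left_mono) (auto simp: algebra_simps)
  ultimately show ?case by (simp add: distrib_left)
qed

lemma sum_hashes_Suc:
  "(\<Sum>\<theta>\<in>hashes B (Suc n). F \<theta>)
     = (\<Sum>r<B. (\<Sum>\<theta>\<in>hashes B n. F (\<theta>(n := (r, 1)))) + (\<Sum>\<theta>\<in>hashes B n. F (\<theta>(n := (r, - 1)))))"
proof -
  have "(\<Sum>\<theta>\<in>hashes B (Suc n). F \<theta>)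
      = (\<Sum>\<theta>\<in>(\<lambda>(p, \<theta>). \<theta>(n := p)) ` (({..<B} \<times> {1, -1}) \<times> hashes B n). F \<theta>)"
    unfolding hashes_def lessThan_Suc PiE_insert_eq ..
  also have "\<dots> = (\<Sum>(p, \<theta>)\<in>({..<B} \<times> {1, -1}) \<times> hashes B n. F (\<theta>(n := p)))"
    unfolding hashes_def
    by (subst sum.reindex[OF inj_combinator]) (auto simp: case_prod_unfold)
  also have "\<dots> = (\<Sum>p\<in>{..<B} \<times> {1, -1}. \<Sum>\<theta>\<in>hashes B n. F (\<theta>(n := p)))"
    by (simp add: sum.cartesian_product)
  also have "\<dots> = (\<Sum>r<B. \<Sum>\<sigma>\<in>{1, -1}. \<Sum>\<theta>\<in>hashes B n. F (\<theta>(n := (r, \<sigma>))))"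
    by (subst sum.cartesian_product) (simp add: case_prod_unfold)
  finally show ?thesis by simp
qed

lemma finite_hashes: "finite (hashes B n)"
  unfolding hashes_def by (intro finite_PiE) auto

lemma card_hashes: "card (hashes B n) = (2 * B) ^ n"
proof -
  have "card ({..<B} \<times> {1, -1 :: real}) = 2 * B" by (simp add: card_cartesian_product)
  then show ?thesis unfolding hashes_def by (simp only: card_PiE finite_lessThan prod_constant card_lessThan)
qed

lemma bucket_update:
  "bucket (\<theta>(n := (r0, \<sigma>))) w (Suc n) r = bucket \<theta> w n r + (if r0 = r then \<sigma> * w n else 0)"
  unfolding bucket_def by (auto intro!: sum.cong)

text \<open>The buckets of one block are dependent, but they are dominated by independent ones: a new
  column multiplies the product of the kernels by \<open>1 + q * (\<Sum>r. \<rho> r)\<close> with all \<open>\<rho> r \<ge> 0\<close> by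
  convexity, and independent buckets would give \<open>\<Prod>r. 1 + q * \<rho> r\<close>.\<close>

lemma sum_hashes_le_prod_kernel:
  fixes x z :: "nat \<Rightarrow> real"
  assumes B: "0 < B" and q: "q = 1 / real B" and disj: "\<And>j. j < n \<Longrightarrow> u j * y j = 0"
  shows "(\<Sum>\<theta>\<in>hashes B n. \<Prod>r<B. exp (\<mu> * (x r + bucket \<theta> u n r) * (z r + bucket \<theta> y n r)))
           \<le> (2 * real B) ^ n * (\<Prod>r<B. bilinear_kernel q \<mu> u y n (x r) (z r))"
  using disj
proof (induction n arbitrary: x z)
  case 0
  then show ?case by (simp add: hashes_def bucket_def)
next
  case (Suc n)
  have q01: "0 \<le> q" "q \<le> 1" using B by (auto simp: q)
  define p where "p r = bilinear_kernel q \<mu> u y n (x r) (z r)" for r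
  define p' where "p' \<sigma> r = bilinear_kernel q \<mu> u y n (x r + \<sigma> * u n) (z r + \<sigma> * y n)" for \<sigma> r
  define \<rho> where "\<rho> r = (p' 1 r + p' (- 1) r) / (2 * p r) - 1" for r
  have p: "0 < p r" for r unfolding p_def using q01 by (rule bilinear_kernel_pos)
  have "u n = 0 \<or> y n = 0" using Suc.prems[of n] by auto
  from bilinear_kernel_midpoint[OF q01 this] have "2 * p r \<le> p' 1 r + p' (- 1) r" for r
    unfolding p_def p'_def by simp
  then have \<rho>: "0 \<le> \<rho> r" for r unfolding \<rho>_def using p[of r] by (simp add: field_simps)
  have step: "p r * (1 + q * \<rho> r) = bilinear_kernel q \<mu> u y (Suc n) (x r) (z r)" for r
    using p[of r] unfolding \<rho>_def by (simp add: p_def[symmetric] p'_def field_simps)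
  \<comment> \<open>Fixing the bucket \<open>r0\<close> and the sign of the new column merely shifts
    the starting point of that one bucket, so the induction hypothesis applies to the shifted
    start.\<close>
  have inner: "(\<Sum>\<theta>\<in>hashes B n. \<Prod>r<B. exp (\<mu> * (x r + bucket (\<theta>(n := (r0, \<sigma>))) u (Suc n) r)
        * (z r + bucket (\<theta>(n := (r0, \<sigma>))) y (Suc n) r)))
      \<le> (2 * real B) ^ n * (\<Prod>r<B. p r) * (p' \<sigma> r0 / p r0)"
    if r0: "r0 < B" for r0 \<sigma>
  proof -
    let ?x = "\<lambda>r. x r + (if r0 = r then \<sigma> * u n else 0)"
    let ?z = "\<lambda>r. z r + (if r0 = r then \<sigma> * y n else 0)"
    have "(\<Sum>\<theta>\<in>hashes B n. \<Prod>r<B. exp (\<mu> * (?x r + bucket \<theta> u n r) * (?z r + bucket \<theta> y n r)))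
        \<le> (2 * real B) ^ n * (\<Prod>r<B. bilinear_kernel q \<mu> u y n (?x r) (?z r))"
      by (rule Suc.IH) (use Suc.prems in auto)
    also have "(\<Prod>r<B. bilinear_kernel q \<mu> u y n (?x r) (?z r))
        = p' \<sigma> r0 * (\<Prod>r\<in>{..<B} - {r0}. p r)"
      using r0 by (subst prod.remove[of _ r0]) (auto simp: p_def p'_def intro!: prod.cong)
    also have "\<dots> = (\<Prod>r<B. p r) * (p' \<sigma> r0 / p r0)"
      using r0 p[of r0] by (subst prod.remove[of _ r0]) auto
    finally show ?thesis by (simp only: bucket_update add_ac mult_ac)
  qed
  have "(\<Sum>\<theta>\<in>hashes B (Suc n). \<Prod>r<B. exp (\<mu> * (x r + bucket \<theta> u (Suc n) r) * (z r + bucket \<theta> y (Suc n) r)))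
      \<le> (\<Sum>r0<B. (2 * real B) ^ n * (\<Prod>r<B. p r) * (p' 1 r0 / p r0)
          + (2 * real B) ^ n * (\<Prod>r<B. p r) * (p' (- 1) r0 / p r0))"
    unfolding sum_hashes_Suc by (intro sum_mono add_mono inner) auto
  also have "\<dots> = (2 * real B) ^ n * (\<Prod>r<B. p r) * (\<Sum>r0<B. 2 * (1 + \<rho> r0))"
    using p by (simp add: sum_distrib_left \<rho>_def add_divide_distrib distrib_left less_imp_neq[symmetric])
  \<comment> \<open>The average over the \<open>2 * B\<close> choices for the new column turns
    \<open>\<rho>\<close> into \<open>q * \<rho>\<close>, since each bucket is hit with probability
    \<open>q = 1 / B\<close>.\<close>
  also have "(\<Sum>r0<B. 2 * (1 + \<rho> r0)) = 2 * real B * (1 + (\<Sum>r<B. q * \<rho> r))"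
    using B by (simp add: q sum_distrib_left[symmetric] sum_divide_distrib[symmetric] sum.distrib distrib_left)
  also have "(2 * real B) ^ n * (\<Prod>r<B. p r) * (2 * real B * (1 + (\<Sum>r<B. q * \<rho> r)))
      \<le> (2 * real B) ^ n * (\<Prod>r<B. p r) * (2 * real B * (\<Prod>r<B. 1 + q * \<rho> r))"
    using p \<rho> q01
    by (intro mult_left_mono one_plus_sum_le_prod mult_nonneg_nonneg prod_nonneg) (auto simp: less_imp_le)
  also have "\<dots> = (2 * real B) ^ Suc n * (\<Prod>r<B. p r * (1 + q * \<rho> r))"
    by (simp add: prod.distrib)
  finally show ?case unfolding step .
qed

text \<open>Every column feeds only one of the two sums, so the columns of \<open>y\<close> can be
  averaged first with the value \<open>X\<close> of the other sum fixed; each yields a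
  \<open>cosh\<close> factor. Columns with \<open>y j = 0\<close> give the factor 1, and columns
  with \<open>u j = 0\<close> leave \<open>sparse_sign_mean\<close> unchanged.\<close>

lemma bilinear_kernel_eq_mean:
  assumes "\<And>j. j < n \<Longrightarrow> u j * y j = 0"
  shows "bilinear_kernel q \<mu> u y n x z
     = sparse_sign_mean q u n (\<lambda>X. (\<Prod>j<n. 1 + q * (cosh (\<mu> * X * y j) - 1)) * exp (\<mu> * X * z)) x"
  using assms
proof (induction n arbitrary: x z)
  case (Suc n)
  define P where "P = (\<lambda>X. \<Prod>j<n. 1 + q * (cosh (\<mu> * X * y j) - 1))"
  have IH: "bilinear_kernel q \<mu> u y n x z = sparse_sign_mean q u n (\<lambda>X. P X * exp (\<mu> * X * z)) x" for x z
    unfolding P_def by (rule Suc.IH) (use Suc.prems in auto)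
  consider "y n = 0" | "u n = 0" using Suc.prems[of n] by auto
  then show ?case
  proof cases
    case 1
    then show ?thesis by (simp add: IH P_def)
  next
    case 2
    have "P X * (1 + q * (cosh (\<mu> * X * y n) - 1)) * exp (\<mu> * X * z)
        = (1 - q) * (P X * exp (\<mu> * X * z))
          + q / 2 * (P X * exp (\<mu> * X * (z + y n)) + P X * exp (\<mu> * X * (z - y n)))" for X
      by (simp add: cosh_def exp_add exp_diff exp_minus distrib_left right_diff_distrib field_simps)
    then have "(\<lambda>X. (\<Prod>j<Suc n. 1 + q * (cosh (\<mu> * X * y j) - 1)) * exp (\<mu> * X * z))
        = (\<lambda>X. (1 - q) * (P X * exp (\<mu> * X * z))
          + q / 2 * (P X * exp (\<mu> * X * (z + y n)) + P X * exp (\<mu> * X * (z - y n))))"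
      by (simp add: P_def)
    then have "sparse_sign_mean q u n (\<lambda>X. (\<Prod>j<Suc n. 1 + q * (cosh (\<mu> * X * y j) - 1)) * exp (\<mu> * X * z)) x
        = bilinear_kernel q \<mu> u y (Suc n) x z"
      using 2 by (simp only: sparse_sign_mean_add sparse_sign_mean_cmult IH bilinear_kernel.simps) simp
    then show ?thesis using 2 by (simp del: prod.lessThan_Suc bilinear_kernel.simps) (simp add: field_simps)
  qed
qed simp

section \<open>From hash tables to the bilinear form of the stack\<close>

text \<open>The inner product of columns \<open>j\<close> and \<open>l\<close> of one unscaled count
  sketch.\<close>

definition collide :: "(nat \<Rightarrow> nat \<times> real) \<Rightarrow> nat \<Rightarrow> nat \<Rightarrow> real" where
  "collide \<theta> j l = (if fst (\<theta> j) = fst (\<theta> l) then snd (\<theta> j) * snd (\<theta> l) else 0)"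

lemma hashes_bucket_less: "\<theta> \<in> hashes B n \<Longrightarrow> j < n \<Longrightarrow> fst (\<theta> j) < B"
  and hashes_sign: "\<theta> \<in> hashes B n \<Longrightarrow> j < n \<Longrightarrow> snd (\<theta> j) = 1 \<or> snd (\<theta> j) = - 1"
  unfolding hashes_def by (force simp: PiE_iff mem_Times_iff)+

lemma sum_bucket_mult:
  assumes "\<theta> \<in> hashes B n"
  shows "(\<Sum>r<B. bucket \<theta> u n r * bucket \<theta> y n r) = (\<Sum>j<n. \<Sum>l<n. collide \<theta> j l * u j * y l)"
proof -
  have "(\<Sum>r<B. bucket \<theta> u n r * bucket \<theta> y n r)
      = (\<Sum>r<B. \<Sum>j<n. \<Sum>l<n. if fst (\<theta> j) = r then (collide \<theta> j l * u j * y l) else 0)"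
    unfolding bucket_def sum_product
    by (intro sum.cong refl) (auto simp: collide_def)
  also have "\<dots> = (\<Sum>j<n. \<Sum>r<B. \<Sum>l<n. if fst (\<theta> j) = r then (collide \<theta> j l * u j * y l) else 0)"
    by (rule sum.swap)
  also have "\<dots> = (\<Sum>j<n. \<Sum>l<n. \<Sum>r<B. if fst (\<theta> j) = r then (collide \<theta> j l * u j * y l) else 0)"
    by (intro sum.cong refl sum.swap)
  also have "\<dots> = (\<Sum>j<n. \<Sum>l<n. collide \<theta> j l * u j * y l)"
    using hashes_bucket_less[OF assms] by (intro sum.cong refl) simp
  finally show ?thesis .
qed

definition sketches :: "nat \<Rightarrow> nat \<Rightarrow> nat \<Rightarrow> (nat \<Rightarrow> nat \<Rightarrow> nat \<times> real) set" where
  "sketches s B d = PiE {..<s} (\<lambda>_. hashes B d)"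

text \<open>The bilinear form of \<open>A\<^sup>TA - I\<close>.\<close>

definition off_form ::
  "nat \<Rightarrow> nat \<Rightarrow> (nat \<Rightarrow> nat \<Rightarrow> nat \<times> real) \<Rightarrow> (nat \<Rightarrow> real) \<Rightarrow> (nat \<Rightarrow> real) \<Rightarrow> real" where
  "off_form s d \<omega> x y =
     (\<Sum>a<s. \<Sum>j<d. \<Sum>l<d. if j = l then 0 else collide (\<omega> a) j l * x j * y l) / real s"

lemma finite_sketches: "finite (sketches s B d)"
  unfolding sketches_def by (intro finite_PiE finite_hashes) auto

lemma card_sketches: "card (sketches s B d) = ((2 * B) ^ d) ^ s"
  unfolding sketches_def by (simp add: card_PiE card_hashes)

lemma row_const_pos: "0 < row_const"
  unfolding row_const_def by (intro add_nonneg_pos) auto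

text \<open>Each of the \<open>B\<close> dominating independent rows contributes
  \<open>1 + row_const * \<mu>\<^sup>2 * q\<^sup>2\<close>; with \<open>q = 1 / B\<close> their
  product is at most \<open>exp (row_const * \<mu>\<^sup>2 / B)\<close>.\<close>

lemma hash_block_mgf_le:
  fixes u y :: "nat \<Rightarrow> real"
  assumes B: "1 \<le> ln (real B)"
    and u: "(\<Sum>j<d. (u j)\<^sup>2) \<le> 1" and y: "(\<Sum>j<d. (y j)\<^sup>2) \<le> 1"
    and disj: "\<And>j. j < d \<Longrightarrow> u j * y j = 0"
    and \<mu>: "1 / 32 \<le> \<mu>" "\<mu> \<le> ln (real B) / 8" "\<mu>\<^sup>2 \<le> real B"
    and small: "\<And>j. j < d \<Longrightarrow> \<mu> * \<bar>y j\<bar> \<le> 1"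
  shows "(\<Sum>\<theta>\<in>hashes B d. exp (\<mu> * (\<Sum>j<d. \<Sum>l<d. collide \<theta> j l * u j * y l)))
           \<le> real (card (hashes B d)) * exp (row_const * \<mu>\<^sup>2 / real B)"
proof -
  define q where "q = 1 / real B"
  have B0: "1 < B" using B by (cases "B = 0 \<or> B = 1") auto
  have "(\<Sum>\<theta>\<in>hashes B d. exp (\<mu> * (\<Sum>j<d. \<Sum>l<d. collide \<theta> j l * u j * y l)))
      = (\<Sum>\<theta>\<in>hashes B d. \<Prod>r<B. exp (\<mu> * (0 + bucket \<theta> u d r) * (0 + bucket \<theta> y d r)))"
  proof (rule sum.cong)
    fix \<theta> assume \<theta>: "\<theta> \<in> hashes B d"
    show "exp (\<mu> * (\<Sum>j<d. \<Sum>l<d. collide \<theta> j l * u j * y l))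
        = (\<Prod>r<B. exp (\<mu> * (0 + bucket \<theta> u d r) * (0 + bucket \<theta> y d r)))"
      unfolding sum_bucket_mult[OF \<theta>, symmetric] sum_distrib_left by (simp add: exp_sum mult_ac)
  qed simp
  also have "\<dots> \<le> (2 * real B) ^ d * (\<Prod>r<B. bilinear_kernel q \<mu> u y d 0 0)"
    using B0 q_def disj by (intro sum_hashes_le_prod_kernel) auto
  also have "\<dots> \<le> (2 * real B) ^ d * (\<Prod>r<B. 1 + row_const * \<mu>\<^sup>2 * q\<^sup>2)"
  proof (intro mult_left_mono prod_mono conjI)
    show "0 \<le> bilinear_kernel q \<mu> u y d 0 0"
      using B0 by (intro less_imp_le bilinear_kernel_pos) (auto simp: q_def)
    have "bilinear_kernel q \<mu> u y d 0 0
        = sparse_sign_mean q u d (\<lambda>x. \<Prod>j<d. 1 + q * (cosh (\<mu> * x * y j) - 1)) 0"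
      using disj by (simp add: bilinear_kernel_eq_mean)
    also have "\<dots> \<le> 1 + row_const * \<mu>\<^sup>2 * q\<^sup>2"
      by (rule sparse_sign_bilinear_mgf_le) (use assms B0 in \<open>auto simp: q_def\<close>)
    finally show "bilinear_kernel q \<mu> u y d 0 0 \<le> 1 + row_const * \<mu>\<^sup>2 * q\<^sup>2" .
  qed auto
  also have "\<dots> \<le> (2 * real B) ^ d * (\<Prod>r<B. exp (row_const * \<mu>\<^sup>2 * q\<^sup>2))"
    using row_const_pos
    by (intro mult_left_mono prod_mono) (auto simp: exp_ge_add_one_self intro!: add_nonneg_nonneg)
  also have "(\<Prod>r<B. exp (row_const * \<mu>\<^sup>2 * q\<^sup>2)) = exp (row_const * \<mu>\<^sup>2 / real B)"
    using B0 by (simp add: q_def exp_of_nat_mult[symmetric] power2_eq_square)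
  finally show ?thesis by (simp add: card_hashes)
qed

lemma off_form_mgf_le:
  fixes u y :: "nat \<Rightarrow> real"
  assumes s: "0 < s" and B: "1 \<le> ln (real B)"
    and u: "(\<Sum>j<d. (u j)\<^sup>2) \<le> 1" and y: "(\<Sum>j<d. (y j)\<^sup>2) \<le> 1"
    and disj: "\<And>j. j < d \<Longrightarrow> u j * y j = 0"
    and \<mu>: "1 / 32 \<le> \<mu>" "\<mu> \<le> ln (real B) / 8" "\<mu>\<^sup>2 \<le> real B"
    and small: "\<And>j. j < d \<Longrightarrow> \<mu> * \<bar>y j\<bar> \<le> 1"
  shows "(\<Sum>\<omega>\<in>sketches s B d. exp (real s * \<mu> * off_form s d \<omega> u y))
           \<le> real (card (sketches s B d)) * exp (row_const * real s * \<mu>\<^sup>2 / real B)"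
proof -
  define W where "W = (\<lambda>\<theta>. \<Sum>j<d. \<Sum>l<d. collide \<theta> j l * u j * y l)"
  \<comment> \<open>The diagonal that \<open>off_form\<close> leaves out vanishes anyway for
    disjoint supports, so the form is an average of complete bilinear forms of independent
    blocks.\<close>
  have off: "off_form s d \<omega> u y = (\<Sum>a<s. W (\<omega> a)) / real s" for \<omega>
    unfolding off_form_def W_def using disj
    by (intro arg_cong[where f = "\<lambda>t. t / real s"] sum.cong refl) auto
  have "(\<Sum>\<omega>\<in>sketches s B d. exp (real s * \<mu> * off_form s d \<omega> u y))
      = (\<Sum>\<omega>\<in>sketches s B d. \<Prod>a<s. exp (\<mu> * W (\<omega> a)))"
    using s by (intro sum.cong refl) (simp add: off exp_sum[symmetric] sum_distrib_left[symmetric])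
  also have "\<dots> = (\<Prod>a<s. \<Sum>\<theta>\<in>hashes B d. exp (\<mu> * W \<theta>))"
    unfolding sketches_def by (rule prod_sum_PiE[symmetric]) (auto simp: finite_hashes)
  also have "\<dots> \<le> (\<Prod>a<s. real (card (hashes B d)) * exp (row_const * \<mu>\<^sup>2 / real B))"
    unfolding W_def using assms by (intro prod_mono conjI sum_nonneg hash_block_mgf_le) auto
  also have "\<dots> = real (card (sketches s B d)) * exp (row_const * real s * \<mu>\<^sup>2 / real B)"
    by (simp add: card_hashes card_sketches power_mult_distrib exp_of_nat_mult[symmetric] mult_ac)
  finally show ?thesis .
qed

section \<open>Decoupling and tail bounds\<close>

text \<open>Jensen's inequality, from the tangent of \<open>exp\<close> at the mean.\<close>

lemma exp_average_le:
  fixes f :: "'a \<Rightarrow> real"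
  assumes "finite S" "S \<noteq> {}"
  shows "exp ((\<Sum>i\<in>S. f i) / real (card S)) \<le> (\<Sum>i\<in>S. exp (f i)) / real (card S)"
proof -
  define m where "m = (\<Sum>i\<in>S. f i) / real (card S)"
  have c: "0 < real (card S)" using assms by (simp add: card_gt_0_iff)
  have "exp m * (1 + (f i - m)) \<le> exp (f i)" for i
    using mult_left_mono[OF exp_ge_add_one_self[of "f i - m"], of "exp m"] by (simp add: exp_diff)
  then have "(\<Sum>i\<in>S. exp m * (1 + (f i - m))) \<le> (\<Sum>i\<in>S. exp (f i))"
    by (intro sum_mono)
  also have "(\<Sum>i\<in>S. exp m * (1 + (f i - m))) = exp m * real (card S)"
    using c by (simp add: sum_distrib_left[symmetric] sum.distrib sum_subtractf m_def)
  finally show ?thesis using c by (simp add: m_def[symmetric] field_simps)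
qed

text \<open>Such a set is determined by its trace on the other \<open>d - 2\<close> indices, so a
  uniformly random subset separates an ordered pair with probability 1/4.\<close>

lemma card_separating_subsets:
  fixes d :: nat
  assumes "j < d" "l < d" "j \<noteq> l"
  shows "4 * card {P \<in> Pow {..<d}. j \<in> P \<and> l \<notin> P} = 2 ^ d"
proof -
  have eq: "{P \<in> Pow {..<d}. j \<in> P \<and> l \<notin> P} = insert j ` Pow ({..<d} - {j, l})" (is "?A = ?B")
  proof
    show "?A \<subseteq> ?B"
    proof
      fix P assume "P \<in> ?A"
      then have "P = insert j (P - {j})" "P - {j} \<in> Pow ({..<d} - {j, l})" by auto
      then show "P \<in> ?B" by blast
    qed
    show "?B \<subseteq> ?A" using assms by auto
  qed
  have inj: "inj_on (insert j) (Pow ({..<d} - {j, l}))"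
    by (rule inj_onI) (auto simp: insert_eq_iff set_eq_iff)
  have "card ?A = 2 ^ card ({..<d} - {j, l})"
    unfolding eq by (simp add: card_image[OF inj] card_Pow)
  also have "card ({..<d} - {j, l}) = d - 2"
    using assms by (simp add: card_Diff_subset)
  finally have c: "card ?A = 2 ^ (d - 2)" .
  have "2 \<le> d" using assms by linarith
  then obtain e where "d = 2 + e" by (auto simp: le_iff_add)
  then show ?thesis using c by simp
qed

text \<open>Splitting the coordinates by a uniformly random \<open>P\<close> keeps each off-diagonal
  term with probability 1/4, whence the factor 4. The two vectors in each summand have disjoint
  supports.\<close>

lemma off_form_decouple:
  "off_form s d \<omega> x x = (\<Sum>P\<in>Pow {..<d}. 4 * off_form s d \<omega> (\<lambda>j. if j \<in> P then x j else 0)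
      (\<lambda>j. if j \<in> P then 0 else x j)) / 2 ^ d"
proof -
  define c where "c a j l = (if j = l then 0 else collide (\<omega> a) j l * x j * x l)" for a j l
  define h where "h P j l = (if j \<in> P \<and> l \<notin> P then 1 else 0 :: real)" for P and j l :: nat
  have "(\<Sum>P\<in>Pow {..<d}. 4 * off_form s d \<omega> (\<lambda>j. if j \<in> P then x j else 0) (\<lambda>j. if j \<in> P then 0 else x j))
      = (\<Sum>P\<in>Pow {..<d}. (\<Sum>a<s. \<Sum>j<d. \<Sum>l<d. c a j l * (4 * h P j l))) / real s"
    unfolding off_form_def sum_divide_distrib sum_distrib_left
    by (intro sum.cong refl) (auto simp: c_def h_def)
  also have "\<dots> = (\<Sum>a<s. \<Sum>j<d. \<Sum>l<d. \<Sum>P\<in>Pow {..<d}. c a j l * (4 * h P j l)) / real s"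
  proof -
    have "(\<Sum>P\<in>Pow {..<d}. \<Sum>a<s. \<Sum>j<d. \<Sum>l<d. c a j l * (4 * h P j l))
        = (\<Sum>a<s. \<Sum>P\<in>Pow {..<d}. \<Sum>j<d. \<Sum>l<d. c a j l * (4 * h P j l))"
      by (rule sum.swap)
    also have "\<dots> = (\<Sum>a<s. \<Sum>j<d. \<Sum>P\<in>Pow {..<d}. \<Sum>l<d. c a j l * (4 * h P j l))"
      by (intro sum.cong refl sum.swap)
    also have "\<dots> = (\<Sum>a<s. \<Sum>j<d. \<Sum>l<d. \<Sum>P\<in>Pow {..<d}. c a j l * (4 * h P j l))"
      by (intro sum.cong refl sum.swap)
    finally show ?thesis by simp
  qed
  also have "\<dots> = (\<Sum>a<s. \<Sum>j<d. \<Sum>l<d. c a j l * 2 ^ d) / real s"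
  proof (intro arg_cong[where f = "\<lambda>t. t / real s"] sum.cong refl)
    fix a j l assume jl: "j \<in> {..<d}" "l \<in> {..<d}"
    show "(\<Sum>P\<in>Pow {..<d}. c a j l * (4 * h P j l)) = c a j l * 2 ^ d"
    proof (cases "j = l")
      case False
      have "(\<Sum>P\<in>Pow {..<d}. h P j l) = real (card {P \<in> Pow {..<d}. j \<in> P \<and> l \<notin> P})"
        unfolding h_def by (simp add: sum.If_cases Collect_conj_eq Pow_def)
      then have "4 * (\<Sum>P\<in>Pow {..<d}. h P j l) = 2 ^ d"
        using arg_cong[OF card_separating_subsets[of j d l], of real] jl False by simp
      then show ?thesis by (simp add: sum_distrib_left[symmetric])
    qed (simp add: c_def)
  qed
  also have "\<dots> = off_form s d \<omega> x x * 2 ^ d"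
    unfolding off_form_def c_def[symmetric] sum_distrib_right times_divide_eq_left
    by (simp only: sum_distrib_right times_divide_eq_left)
  finally show ?thesis by simp
qed

lemma off_form_cmult_left: "off_form s d \<omega> (\<lambda>j. c * x j) y = c * off_form s d \<omega> x y"
  unfolding off_form_def times_divide_eq_right sum_distrib_left
  by (intro arg_cong[where f = "\<lambda>t. t / real s"] sum.cong refl) auto

text \<open>Decoupling and Jensen reduce the quadratic form to bilinear ones; the
  \<open>\<mu> / 4\<close> on the left compensates the factor 4 of the decoupling. The sign
  \<open>\<sigma>\<close> is moved into the left vector, so the bilinear bound covers both
  directions.\<close>

lemma off_form_square_mgf_le:
  fixes x :: "nat \<Rightarrow> real"
  assumes s: "0 < s" and B: "1 \<le> ln (real B)"
    and x: "(\<Sum>j<d. (x j)\<^sup>2) \<le> 1"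
    and \<mu>: "1 / 32 \<le> \<mu>" "\<mu> \<le> ln (real B) / 8" "\<mu>\<^sup>2 \<le> real B"
    and small: "\<And>j. j < d \<Longrightarrow> \<mu> * \<bar>x j\<bar> \<le> 1"
    and \<sigma>: "\<sigma> = 1 \<or> \<sigma> = - 1"
  shows "(\<Sum>\<omega>\<in>sketches s B d. exp (\<sigma> * (real s * \<mu> / 4) * off_form s d \<omega> x x))
           \<le> real (card (sketches s B d)) * exp (row_const * real s * \<mu>\<^sup>2 / real B)"
proof -
  define p where "p P = (\<lambda>j. \<sigma> * (if j \<in> P then x j else 0))" for P
  define r where "r P = (\<lambda>j. if j \<in> P then 0 else x j)" for P
  define E where "E = real (card (sketches s B d)) * exp (row_const * real s * \<mu>\<^sup>2 / real B)"
  have "exp (\<sigma> * (real s * \<mu> / 4) * off_form s d \<omega> x x)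
      \<le> (\<Sum>P\<in>Pow {..<d}. exp (real s * \<mu> * off_form s d \<omega> (p P) (r P))) / 2 ^ d" for \<omega>
  proof -
    have "\<sigma> * (real s * \<mu> / 4) * off_form s d \<omega> x x
        = (\<Sum>P\<in>Pow {..<d}. real s * \<mu> * off_form s d \<omega> (p P) (r P)) / real (card (Pow {..<d}))"
      unfolding p_def r_def off_form_cmult_left
      by (subst off_form_decouple) (simp add: card_Pow sum_distrib_left mult_ac)
    moreover have "exp ((\<Sum>P\<in>Pow {..<d}. real s * \<mu> * off_form s d \<omega> (p P) (r P)) / real (card (Pow {..<d})))
        \<le> (\<Sum>P\<in>Pow {..<d}. exp (real s * \<mu> * off_form s d \<omega> (p P) (r P))) / real (card (Pow {..<d}))"
      by (rule exp_average_le) auto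
    ultimately show ?thesis by (simp only: card_Pow finite_lessThan card_lessThan of_nat_power of_nat_numeral)
  qed
  then have "(\<Sum>\<omega>\<in>sketches s B d. exp (\<sigma> * (real s * \<mu> / 4) * off_form s d \<omega> x x))
      \<le> (\<Sum>\<omega>\<in>sketches s B d. (\<Sum>P\<in>Pow {..<d}. exp (real s * \<mu> * off_form s d \<omega> (p P) (r P))) / 2 ^ d)"
    by (intro sum_mono)
  also have "\<dots> = (\<Sum>P\<in>Pow {..<d}. \<Sum>\<omega>\<in>sketches s B d. exp (real s * \<mu> * off_form s d \<omega> (p P) (r P))) / 2 ^ d"
    by (subst sum.swap) (simp add: sum_divide_distrib)
  also have "\<dots> \<le> (\<Sum>P\<in>Pow {..<d}. E) / 2 ^ d"
  proof (intro divide_right_mono sum_mono)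
    fix P
    have "(p P j)\<^sup>2 \<le> (x j)\<^sup>2" "(r P j)\<^sup>2 \<le> (x j)\<^sup>2" for j
      using \<sigma> unfolding p_def r_def by auto
    then have "(\<Sum>j<d. (p P j)\<^sup>2) \<le> 1" "(\<Sum>j<d. (r P j)\<^sup>2) \<le> 1"
      using x by (meson order_trans sum_mono)+
    then show "(\<Sum>\<omega>\<in>sketches s B d. exp (real s * \<mu> * off_form s d \<omega> (p P) (r P))) \<le> E"
      unfolding E_def
      by (intro off_form_mgf_le) (use assms in \<open>auto simp: p_def r_def\<close>)
  qed auto
  also have "\<dots> = E" by (simp add: card_Pow)
  finally show ?thesis unfolding E_def .
qed

section \<open>Tail bounds in counting form\<close>

lemma card_abs_gt_le:
  fixes f :: "'a \<Rightarrow> real"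
  assumes "finite \<Omega>" "0 \<le> l"
    and "(\<Sum>\<omega>\<in>\<Omega>. exp (l * f \<omega>)) \<le> C" "(\<Sum>\<omega>\<in>\<Omega>. exp (- l * f \<omega>)) \<le> C"
  shows "real (card {\<omega> \<in> \<Omega>. \<eta> < \<bar>f \<omega>\<bar>}) \<le> 2 * C * exp (- (l * \<eta>))"
proof -
  have "real (card {\<omega> \<in> \<Omega>. \<eta> < \<bar>f \<omega>\<bar>}) * exp (l * \<eta>) = (\<Sum>\<omega>\<in>{\<omega> \<in> \<Omega>. \<eta> < \<bar>f \<omega>\<bar>}. exp (l * \<eta>))"
    by simp
  also have "\<dots> \<le> (\<Sum>\<omega>\<in>{\<omega> \<in> \<Omega>. \<eta> < \<bar>f \<omega>\<bar>}. exp (l * f \<omega>) + exp (- l * f \<omega>))"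
  proof (rule sum_mono)
    fix \<omega> assume "\<omega> \<in> {\<omega> \<in> \<Omega>. \<eta> < \<bar>f \<omega>\<bar>}"
    then have "l * \<eta> \<le> l * \<bar>f \<omega>\<bar>" using assms(2) by (intro mult_left_mono) auto
    then have "exp (l * \<eta>) \<le> exp (l * \<bar>f \<omega>\<bar>)" by simp
    also have "\<dots> \<le> exp (l * f \<omega>) + exp (- l * f \<omega>)" by (cases "f \<omega> \<ge> 0") auto
    finally show "exp (l * \<eta>) \<le> exp (l * f \<omega>) + exp (- l * f \<omega>)" .
  qed
  also have "\<dots> \<le> (\<Sum>\<omega>\<in>\<Omega>. exp (l * f \<omega>) + exp (- l * f \<omega>))"
    using assms(1) by (intro sum_mono2) (auto intro!: add_nonneg_nonneg)
  also have "\<dots> \<le> 2 * C" using assms(3,4) by (simp add: sum.distrib)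
  finally have "real (card {\<omega> \<in> \<Omega>. \<eta> < \<bar>f \<omega>\<bar>}) * exp (l * \<eta>) \<le> 2 * C" .
  then have "real (card {\<omega> \<in> \<Omega>. \<eta> < \<bar>f \<omega>\<bar>}) * exp (l * \<eta>) * exp (- (l * \<eta>)) \<le> 2 * C * exp (- (l * \<eta>))"
    by (intro mult_right_mono) auto
  then show ?thesis by (simp add: mult.assoc flip: exp_add)
qed

lemma off_form_tail:
  fixes u y :: "nat \<Rightarrow> real"
  assumes "0 < s" "1 \<le> ln (real B)" "(\<Sum>j<d. (u j)\<^sup>2) \<le> 1" "(\<Sum>j<d. (y j)\<^sup>2) \<le> 1"
    and "\<And>j. j < d \<Longrightarrow> u j * y j = 0"
    and \<mu>: "1 / 32 \<le> \<mu>" "\<mu> \<le> ln (real B) / 8" "\<mu>\<^sup>2 \<le> real B"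
    and "\<And>j. j < d \<Longrightarrow> \<mu> * \<bar>y j\<bar> \<le> 1"
  shows "real (card {\<omega> \<in> sketches s B d. \<eta> < \<bar>off_form s d \<omega> u y\<bar>})
     \<le> real (card (sketches s B d)) * (2 * exp (real s * \<mu> * (row_const * \<mu> / real B - \<eta>)))"
proof -
  let ?C = "real (card (sketches s B d)) * exp (row_const * real s * \<mu>\<^sup>2 / real B)"
  have 1: "(\<Sum>\<omega>\<in>sketches s B d. exp (real s * \<mu> * off_form s d \<omega> u y)) \<le> ?C"
    using assms by (intro off_form_mgf_le) auto
  have "(\<Sum>\<omega>\<in>sketches s B d. exp (real s * \<mu> * off_form s d \<omega> (\<lambda>j. - 1 * u j) y)) \<le> ?C"
    using assms by (intro off_form_mgf_le) auto
  then have 2: "(\<Sum>\<omega>\<in>sketches s B d. exp (- (real s * \<mu>) * off_form s d \<omega> u y)) \<le> ?C"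
    unfolding off_form_cmult_left by simp
  have "real (card {\<omega> \<in> sketches s B d. \<eta> < \<bar>off_form s d \<omega> u y\<bar>})
      \<le> 2 * ?C * exp (- (real s * \<mu> * \<eta>))"
    using \<mu> by (intro card_abs_gt_le[OF finite_sketches _ 1 2]) auto
  also have "\<dots> = real (card (sketches s B d)) * (2 * exp (real s * \<mu> * (row_const * \<mu> / real B - \<eta>)))"
  proof -
    have "real s * \<mu> * (row_const * \<mu> / real B - \<eta>)
        = row_const * real s * \<mu>\<^sup>2 / real B + - (real s * \<mu> * \<eta>)"
      by (simp add: right_diff_distrib power2_eq_square)
    then show ?thesis by (simp only: exp_add mult_ac)
  qed
  finally show ?thesis .
qed

text \<open>Compared with \<open>off_form_tail\<close>, decoupling costs a factor 4 in the
  parameter, visible as \<open>\<eta> / 4\<close>.\<close>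

lemma off_form_square_tail:
  fixes x :: "nat \<Rightarrow> real"
  assumes "0 < s" "1 \<le> ln (real B)" "(\<Sum>j<d. (x j)\<^sup>2) \<le> 1"
    and \<mu>: "1 / 32 \<le> \<mu>" "\<mu> \<le> ln (real B) / 8" "\<mu>\<^sup>2 \<le> real B"
    and "\<And>j. j < d \<Longrightarrow> \<mu> * \<bar>x j\<bar> \<le> 1"
  shows "real (card {\<omega> \<in> sketches s B d. \<eta> < \<bar>off_form s d \<omega> x x\<bar>})
     \<le> real (card (sketches s B d)) * (2 * exp (real s * \<mu> * (row_const * \<mu> / real B - \<eta> / 4)))"
proof -
  let ?C = "real (card (sketches s B d)) * exp (row_const * real s * \<mu>\<^sup>2 / real B)"
  have 1: "(\<Sum>\<omega>\<in>sketches s B d. exp (real s * \<mu> / 4 * off_form s d \<omega> x x)) \<le> ?C"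
    using off_form_square_mgf_le[where x = x and s = s and B = B and d = d and \<mu> = \<mu> and \<sigma> = 1] assms by simp
  have 2: "(\<Sum>\<omega>\<in>sketches s B d. exp (- (real s * \<mu> / 4) * off_form s d \<omega> x x)) \<le> ?C"
    using off_form_square_mgf_le[where x = x and s = s and B = B and d = d and \<mu> = \<mu> and \<sigma> = "- 1"] assms by simp
  have "real (card {\<omega> \<in> sketches s B d. \<eta> < \<bar>off_form s d \<omega> x x\<bar>})
      \<le> 2 * ?C * exp (- (real s * \<mu> / 4 * \<eta>))"
    using \<mu> by (intro card_abs_gt_le[OF finite_sketches _ 1 2]) auto
  also have "\<dots> = real (card (sketches s B d)) * (2 * exp (real s * \<mu> * (row_const * \<mu> / real B - \<eta> / 4)))"
  proof -
    have "real s * \<mu> * (row_const * \<mu> / real B - \<eta> / 4)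
        = row_const * real s * \<mu>\<^sup>2 / real B + - (real s * \<mu> / 4 * \<eta>)"
      by (simp add: right_diff_distrib power2_eq_square)
    then show ?thesis by (simp only: exp_add mult_ac)
  qed
  finally show ?thesis .
qed

text \<open>For a single vector and small \<open>s\<close> the Chernoff bound does not fall below
  1/2, so a second-moment bound is read off from the same moments: \<open>cosh t - 1\<close>
  dominates \<open>t\<^sup>2 / 2\<close>, and subtracting 1 leaves a quantity of order
  \<open>1 / B\<close>. The parameter is \<open>\<mu> = 1 / 8\<close>, the largest one that
  \<open>ln B \<ge> 1\<close> alone permits; it gives \<open>s / 32 = s * \<mu> / 4\<close> and
  \<open>64 = 8\<^sup>2\<close>.\<close>

lemma off_form_square_chebyshev:
  fixes x :: "nat \<Rightarrow> real"
  assumes "0 < s" "1 \<le> ln (real B)" "(\<Sum>j<d. (x j)\<^sup>2) \<le> 1" "0 < \<eta>"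
  shows "real (card {\<omega> \<in> sketches s B d. \<eta> < \<bar>off_form s d \<omega> x x\<bar>}) * ((real s / 32 * \<eta>)\<^sup>2 / 2)
     \<le> real (card (sketches s B d)) * (exp (row_const * real s / (64 * real B)) - 1)"
proof -
  let ?\<Omega> = "sketches s B d" and ?f = "\<lambda>\<omega>. off_form s d \<omega> x x" and ?l = "real s / 32"
  let ?C = "real (card ?\<Omega>) * exp (row_const * real s / (64 * real B))"
  have B1: "1 \<le> real B" using assms(2) by (cases "B = 0") auto
  have x1: "\<bar>x j\<bar> \<le> 1" if "j < d" for j
  proof -
    have "(x j)\<^sup>2 \<le> 1"
      using assms(3) member_le_sum[of j "{..<d}" "\<lambda>j. (x j)\<^sup>2"] that by auto
    then show ?thesis by (simp add: abs_square_le_1)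
  qed
  then have x8: "1 / 8 * \<bar>x j\<bar> \<le> 1" if "j < d" for j
    using that by fastforce
  have mgf: "(\<Sum>\<omega>\<in>?\<Omega>. exp (\<sigma> * (real s * (1 / 8) / 4) * ?f \<omega>)) \<le> ?C" if "\<sigma> = 1 \<or> \<sigma> = - 1" for \<sigma> :: real
  proof -
    have "(\<Sum>\<omega>\<in>?\<Omega>. exp (\<sigma> * (real s * (1 / 8) / 4) * ?f \<omega>))
        \<le> real (card ?\<Omega>) * exp (row_const * real s * (1 / 8)\<^sup>2 / real B)"
      by (rule off_form_square_mgf_le) (use assms that B1 x8 in \<open>auto simp: power2_eq_square\<close>)
    then show ?thesis by (simp add: power2_eq_square mult_ac)
  qed
  have "real (card {\<omega> \<in> ?\<Omega>. \<eta> < \<bar>?f \<omega>\<bar>}) * ((?l * \<eta>)\<^sup>2 / 2)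
      = (\<Sum>\<omega>\<in>{\<omega> \<in> ?\<Omega>. \<eta> < \<bar>?f \<omega>\<bar>}. (?l * \<eta>)\<^sup>2 / 2)" by simp
  also have "\<dots> \<le> (\<Sum>\<omega>\<in>{\<omega> \<in> ?\<Omega>. \<eta> < \<bar>?f \<omega>\<bar>}. cosh (?l * ?f \<omega>) - 1)"
  proof (rule sum_mono)
    fix \<omega> assume "\<omega> \<in> {\<omega> \<in> ?\<Omega>. \<eta> < \<bar>?f \<omega>\<bar>}"
    then have "\<bar>?l * \<eta>\<bar> \<le> \<bar>?l * ?f \<omega>\<bar>" using assms(4) by (auto simp: abs_mult intro!: mult_left_mono)
    then have "(?l * \<eta>)\<^sup>2 / 2 \<le> (?l * ?f \<omega>)\<^sup>2 / 2" by (simp only: abs_le_square_iff)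
    also have "\<dots> \<le> cosh (?l * ?f \<omega>) - 1" by (rule cosh_minus_one_ge)
    finally show "(?l * \<eta>)\<^sup>2 / 2 \<le> cosh (?l * ?f \<omega>) - 1" .
  qed
  also have "\<dots> \<le> (\<Sum>\<omega>\<in>?\<Omega>. cosh (?l * ?f \<omega>) - 1)"
    by (intro sum_mono2) (auto simp: finite_sketches cosh_real_ge_1)
  also have "\<dots> = ((\<Sum>\<omega>\<in>?\<Omega>. exp (?l * ?f \<omega>)) + (\<Sum>\<omega>\<in>?\<Omega>. exp (- (?l * ?f \<omega>)))) / 2 - real (card ?\<Omega>)"
    by (simp add: cosh_def sum_subtractf sum.distrib sum_divide_distrib add_divide_distrib)
  also have "\<dots> \<le> ?C - real (card ?\<Omega>)" using mgf[of 1] mgf[of "- 1"] by simp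
  finally show ?thesis by (simp only: right_diff_distrib mult_1_right)
qed

section \<open>Nets of Euclidean balls\<close>

text \<open>The subtracted term makes the induction close: the two new summands add at most
  \<open>2 * (1 / 2) ^ Suc R\<close>, exactly what the bound grows by.\<close>

lemma sum_exp_neg_square_le: "(\<Sum>z = - int R..int R. exp (- (real_of_int z)\<^sup>2)) \<le> 3 - 2 * (1 / 2) ^ R"
proof (induction R)
  case (Suc R)
  let ?f = "\<lambda>z. exp (- (real_of_int z)\<^sup>2)"
  have "{- int (Suc R)..int (Suc R)} = insert (int (Suc R)) (insert (- int (Suc R)) {- int R..int R})"
    by auto
  then have "(\<Sum>z = - int (Suc R)..int (Suc R). ?f z)
      = 2 * exp (- (real (Suc R))\<^sup>2) + (\<Sum>z = - int R..int R. ?f z)"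
    by (simp add: power2_eq_square algebra_simps)
  also have "exp (- (real (Suc R))\<^sup>2) \<le> (1 / 2) ^ Suc R"
  proof -
    have "exp (- (real (Suc R))\<^sup>2) \<le> exp (real (Suc R) * (- 1))"
      by (simp add: power2_eq_square algebra_simps)
    also have "\<dots> = exp (- 1) ^ Suc R" by (rule exp_of_nat_mult)
    also have "\<dots> \<le> (1 / 2) ^ Suc R"
    proof (rule power_mono)
      show "exp (- 1) \<le> (1 / 2 :: real)"
        using exp_ge_add_one_self[of 1] by (simp add: exp_minus field_simps)
    qed simp
    finally show ?thesis .
  qed
  finally show ?case using Suc.IH by simp
qed simp

text \<open>A net of radius 1/4, stated with squared distance 1/16. Vanishing outside
  \<open>I\<close> lets a net point be used directly as a vector of the whole space supported on
  \<open>I\<close>.\<close>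

definition ball_net :: "'a set \<Rightarrow> ('a \<Rightarrow> real) set \<Rightarrow> bool" where
  "ball_net I N \<longleftrightarrow> finite N \<and> real (card N) \<le> exp (18 * real (card I)) \<and>
    (\<forall>b\<in>N. (\<Sum>i\<in>I. (b i)\<^sup>2) \<le> 1 \<and> (\<forall>i. i \<notin> I \<longrightarrow> b i = 0)) \<and>
    (\<forall>a. (\<Sum>i\<in>I. (a i)\<^sup>2) \<le> 1 \<longrightarrow> (\<exists>b\<in>N. (\<Sum>i\<in>I. (a i - b i)\<^sup>2) \<le> 1 / 16))"

text \<open>The net consists of the points of the grid of width \<open>1 / K\<close> in the unit
  ball; with \<open>K\<^sup>2 = 16 * n\<close> the squared rounding error is at most
  \<open>n / K\<^sup>2 = 1 / 16\<close>. Grid points are counted with Gaussian weights: on the ball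
  \<open>1 \<le> exp (16 * n) * (\<Prod>i\<in>I. exp (- (z i)\<^sup>2))\<close>, and the product
  sums to at most \<open>3 ^ n \<le> exp (2 * n)\<close>, hence the 18.\<close>

lemma ball_net_exists:
  fixes I :: "'a set"
  assumes I: "finite I"
  shows "\<exists>N. ball_net I N"
proof -
  define n where "n = card I"
  define K where "K = 4 * sqrt (real n)"
  define U where "U = PiE I (\<lambda>_. {- int (4 * n)..int (4 * n)})"
  define Z where "Z = {z \<in> U. (\<Sum>i\<in>I. (real_of_int (z i))\<^sup>2) \<le> 16 * real n}"
  define g where "g = (\<lambda>z i. if i \<in> I then real_of_int (z i) / K else 0)"
  have K2: "K\<^sup>2 = 16 * real n" unfolding K_def by (simp add: power_mult_distrib)
  have finU: "finite U" unfolding U_def using I by (intro finite_PiE) auto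
  then have finZ: "finite Z" unfolding Z_def by auto
  have "real (card Z) = (\<Sum>z\<in>Z. 1)" by simp
  also have "\<dots> \<le> (\<Sum>z\<in>Z. exp (16 * real n) * (\<Prod>i\<in>I. exp (- (real_of_int (z i))\<^sup>2)))"
  proof (rule sum_mono)
    fix z assume "z \<in> Z"
    then have "0 \<le> 16 * real n + (\<Sum>i\<in>I. - (real_of_int (z i))\<^sup>2)"
      by (simp add: Z_def sum_negf)
    then show "1 \<le> exp (16 * real n) * (\<Prod>i\<in>I. exp (- (real_of_int (z i))\<^sup>2))"
      by (simp only: exp_sum[OF I, symmetric] exp_add[symmetric] one_le_exp_iff)
  qed
  also have "\<dots> \<le> (\<Sum>z\<in>U. exp (16 * real n) * (\<Prod>i\<in>I. exp (- (real_of_int (z i))\<^sup>2)))"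
    using finU by (intro sum_mono2) (auto simp: Z_def intro!: mult_nonneg_nonneg prod_nonneg)
  also have "\<dots> = exp (16 * real n) * (\<Prod>i\<in>I. \<Sum>z = - int (4 * n)..int (4 * n). exp (- (real_of_int z)\<^sup>2))"
    unfolding U_def sum_distrib_left[symmetric] by (subst prod_sum_PiE) (use I in auto)
  also have "\<dots> \<le> exp (16 * real n) * (\<Prod>i\<in>I. 3)"
    using sum_exp_neg_square_le[of "4 * n"]
    by (intro mult_left_mono prod_mono conjI sum_nonneg) (auto intro: order_trans)
  also have "(\<Prod>i\<in>I. 3) = (3 :: real) ^ n" by (simp add: n_def)
  also have "(3 :: real) ^ n \<le> exp 2 ^ n"
    using exp_ge_add_one_self[of "2 :: real"] by (intro power_mono) auto
  also have "exp (16 * real n) * exp 2 ^ n = exp (18 * real n)"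
    by (simp add: exp_of_nat_mult[symmetric] mult.commute flip: exp_add)
  finally have cardZ: "real (card Z) \<le> exp (18 * real n)" by simp
  show ?thesis
    unfolding ball_net_def
  proof (intro exI[of _ "g ` Z"] conjI ballI allI impI)
    show "finite (g ` Z)" using finZ by simp
    show "real (card (g ` Z)) \<le> exp (18 * real (card I))"
      using cardZ card_image_le[OF finZ, of g] unfolding n_def by linarith
  next
    fix b assume "b \<in> g ` Z"
    then obtain z where z: "z \<in> Z" "b = g z" by auto
    have "(\<Sum>i\<in>I. (b i)\<^sup>2) = (\<Sum>i\<in>I. (real_of_int (z i))\<^sup>2) / K\<^sup>2"
      unfolding z g_def sum_divide_distrib by (intro sum.cong) (auto simp: power_divide)
    also have "\<dots> \<le> 1"
      using z(1) unfolding K2 Z_def by (auto simp: divide_le_eq_1)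
    finally show "(\<Sum>i\<in>I. (b i)\<^sup>2) \<le> 1" .
    show "b i = 0" if "i \<notin> I" for i using that by (simp add: z g_def)
  next
    fix a :: "'a \<Rightarrow> real" assume a: "(\<Sum>i\<in>I. (a i)\<^sup>2) \<le> 1"
    \<comment> \<open>Rounding towards zero never increases an absolute value, so the rounded point
      stays in the ball.\<close>
    define z where "z = (\<lambda>i\<in>I. if 0 \<le> a i then \<lfloor>a i * K\<rfloor> else - \<lfloor>- (a i * K)\<rfloor>)"
    have K0: "0 \<le> K" unfolding K_def by simp
    have zle: "\<bar>real_of_int (z i)\<bar> \<le> \<bar>a i\<bar> * K" and zd: "\<bar>a i * K - real_of_int (z i)\<bar> \<le> 1"
      if "i \<in> I" for i
    proof -
      have p: "0 \<le> \<lfloor>a i * K\<rfloor>" if "0 \<le> a i" using that K0 by simp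
      have m: "0 \<le> \<lfloor>- (a i * K)\<rfloor>" if "\<not> 0 \<le> a i"
        using that K0 mult_nonneg_nonneg[of "- a i" K] by simp
      show "\<bar>real_of_int (z i)\<bar> \<le> \<bar>a i\<bar> * K"
        using that p m unfolding z_def by (cases "0 \<le> a i") (auto simp: of_int_floor_le)
      show "\<bar>a i * K - real_of_int (z i)\<bar> \<le> 1"
        using that unfolding z_def by (cases "0 \<le> a i") (simp; linarith)+
    qed
    have "(\<Sum>i\<in>I. (real_of_int (z i))\<^sup>2) \<le> (\<Sum>i\<in>I. (a i)\<^sup>2 * K\<^sup>2)"
    proof (rule sum_mono)
      fix i assume "i \<in> I"
      from power_mono[OF zle[OF this], of 2] show "(real_of_int (z i))\<^sup>2 \<le> (a i)\<^sup>2 * K\<^sup>2"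
        by (simp add: power_mult_distrib)
    qed
    also have "\<dots> \<le> 1 * K\<^sup>2" unfolding sum_distrib_right[symmetric] using a by (intro mult_right_mono) auto
    finally have z2: "(\<Sum>i\<in>I. (real_of_int (z i))\<^sup>2) \<le> 16 * real n" unfolding K2 by simp
    have "z i \<in> {- int (4 * n)..int (4 * n)}" if i: "i \<in> I" for i
    proof -
      have n1: "1 \<le> n" using i I by (simp add: n_def Suc_le_eq card_gt_0_iff) blast
      have "(real_of_int (z i))\<^sup>2 \<le> 16 * real n"
        using z2 member_le_sum[of i I "\<lambda>i. (real_of_int (z i))\<^sup>2"] i I by auto
      also have "\<dots> \<le> (real (4 * n))\<^sup>2" using n1 by (simp add: power2_eq_square)
      finally have "\<bar>real_of_int (z i)\<bar> \<le> real (4 * n)" 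
        using abs_le_square_iff[of "real_of_int (z i)" "real (4 * n)"] by simp
      then show ?thesis by simp linarith
    qed
    then have "z \<in> U" unfolding U_def z_def by auto
    with z2 have "z \<in> Z" unfolding Z_def by simp
    moreover have "(\<Sum>i\<in>I. (a i - g z i)\<^sup>2) \<le> 1 / 16"
    proof (cases "n = 0")
      case True
      then show ?thesis using I by (simp add: n_def)
    next
      case False
      then have Kp: "0 < K" unfolding K_def by simp
      have "(\<Sum>i\<in>I. (a i - g z i)\<^sup>2) \<le> (\<Sum>i\<in>I. 1 / K\<^sup>2)"
      proof (rule sum_mono)
        fix i assume i: "i \<in> I"
        have "a i - g z i = (a i * K - real_of_int (z i)) / K"
          using i Kp by (simp add: g_def field_simps)
        moreover have "(a i * K - real_of_int (z i))\<^sup>2 \<le> 1"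
          using zd[OF i] by (simp add: abs_square_le_1)
        ultimately show "(a i - g z i)\<^sup>2 \<le> 1 / K\<^sup>2"
          using Kp by (simp add: power_divide divide_right_mono)
      qed
      also have "\<dots> = 1 / 16" using False unfolding K2 by (simp add: n_def)
      finally show ?thesis .
    qed
    ultimately show "\<exists>b\<in>g ` Z. (\<Sum>i\<in>I. (a i - b i)\<^sup>2) \<le> 1 / 16" by blast
  qed
qed

text \<open>Let \<open>S\<close> be the supremum on the unit ball. For a net point \<open>b\<close>
  near \<open>a\<close>, symmetry gives \<open>F a a - F b b = F (a - b) (a + b)\<close>; the
  arguments have norms at most 1/4 and 2, so this is at most \<open>S / 2\<close> by polarization.
  Thus \<open>S \<le> \<eta> + S / 2\<close>, and homogeneity extends the bound to all
  \<open>a\<close>.\<close>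

lemma quadratic_form_le_net:
  fixes M :: "'a \<Rightarrow> 'a \<Rightarrow> real"
  assumes I: "finite I" and sym: "\<And>i j. i \<in> I \<Longrightarrow> j \<in> I \<Longrightarrow> M i j = M j i"
    and N: "ball_net I N"
    and \<eta>: "\<And>b. b \<in> N \<Longrightarrow> \<bar>\<Sum>i\<in>I. \<Sum>j\<in>I. M i j * b i * b j\<bar> \<le> \<eta>"
  shows "\<bar>\<Sum>i\<in>I. \<Sum>j\<in>I. M i j * a i * a j\<bar> \<le> 2 * \<eta> * (\<Sum>i\<in>I. (a i)\<^sup>2)"
proof -
  define F where "F a b = (\<Sum>i\<in>I. \<Sum>j\<in>I. M i j * a i * b j)" for a b :: "'a \<Rightarrow> real"
  define m where "m a = (\<Sum>i\<in>I. (a i)\<^sup>2)" for a :: "'a \<Rightarrow> real"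
  define S where "S = (SUP a\<in>{a. m a \<le> 1}. \<bar>F a a\<bar>)"
  have Fsym: "F a b = F b a" for a b
    unfolding F_def by (subst sum.swap) (auto intro!: sum.cong simp: sym)
  have Fadd: "F (\<lambda>i. a i + b i) c = F a c + F b c" and Fsub: "F (\<lambda>i. a i - b i) c = F a c - F b c"
    and Fmul: "F (\<lambda>i. t * a i) c = t * F a c" for a b c t
    unfolding F_def by (simp_all add: algebra_simps sum.distrib sum_subtractf sum_distrib_left)
  have Fadd': "F c (\<lambda>i. a i + b i) = F c a + F c b" and Fsub': "F c (\<lambda>i. a i - b i) = F c a - F c b"
    and Fmul': "F c (\<lambda>i. t * a i) = t * F c a" for a b c t
    using Fadd Fsub Fmul Fsym by metis+
  have m0: "0 \<le> m a" for a unfolding m_def by (intro sum_nonneg) auto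
  have bdd: "bdd_above ((\<lambda>a. \<bar>F a a\<bar>) ` {a. m a \<le> 1})"
  proof (rule bdd_aboveI2)
    fix a assume "a \<in> {a. m a \<le> 1}"
    then have a1: "\<bar>a i\<bar> \<le> 1" if "i \<in> I" for i
      using member_le_sum[of i I "\<lambda>i. (a i)\<^sup>2"] that I by (simp add: m_def abs_square_le_1[symmetric])
    have "\<bar>F a a\<bar> \<le> (\<Sum>i\<in>I. \<Sum>j\<in>I. \<bar>M i j * a i * a j\<bar>)"
      unfolding F_def by (intro order_trans[OF sum_abs] sum_mono sum_abs)
    also have "\<dots> \<le> (\<Sum>i\<in>I. \<Sum>j\<in>I. \<bar>M i j\<bar>)"
    proof (intro sum_mono)
      fix i j assume ij: "i \<in> I" "j \<in> I"
      have "\<bar>a i\<bar> * \<bar>a j\<bar> \<le> 1 * 1" using a1 ij by (intro mult_mono) auto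
      then have "\<bar>M i j\<bar> * (\<bar>a i\<bar> * \<bar>a j\<bar>) \<le> \<bar>M i j\<bar> * 1" by (intro mult_left_mono) auto
      then show "\<bar>M i j * a i * a j\<bar> \<le> \<bar>M i j\<bar>" by (simp add: abs_mult mult.assoc)
    qed
    finally show "\<bar>F a a\<bar> \<le> (\<Sum>i\<in>I. \<Sum>j\<in>I. \<bar>M i j\<bar>)" .
  qed
  have S: "\<bar>F a a\<bar> \<le> S" if "m a \<le> 1" for a
    unfolding S_def using that by (intro cSUP_upper2[OF bdd, of a]) auto
  have S0: "0 \<le> S" using S[of "\<lambda>_. 0"] by (simp add: m_def F_def)
  have scale: "\<bar>F a a\<bar> \<le> S * m a" for a
  proof (cases "m a = 0")
    case True
    then have "a i = 0" if "i \<in> I" for i using that I by (simp add: m_def sum_nonneg_eq_0_iff)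
    then have "F a a = 0" unfolding F_def by simp
    then show ?thesis using True by simp
  next
    case False
    define t where "t = 1 / sqrt (m a)"
    have t2: "t * t = 1 / m a" unfolding t_def using m0[of a] by simp
    have "m (\<lambda>i. t * a i) = t * t * m a"
      unfolding m_def by (simp add: sum_distrib_left power2_eq_square mult_ac)
    then have "m (\<lambda>i. t * a i) \<le> 1" using False by (simp add: t2)
    from S[OF this] have "\<bar>t * t * F a a\<bar> \<le> S" by (simp only: Fmul Fmul' mult.assoc)
    then show ?thesis unfolding t2 using False m0[of a]
      by (simp add: abs_mult field_simps)
  qed
  have half: "\<bar>F c e\<bar> \<le> S / 2" if "m c \<le> 1 / 16" "m e \<le> 4" for c e
  proof -
    \<comment> \<open>The weight 8 gives \<open>8 * c\<close> and \<open>e\<close> the same bound 4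
      on their squared norms, which optimises polarization:
      \<open>32 * \<bar>F c e\<bar> \<le> 16 * S\<close>.\<close>
    let ?p = "\<lambda>i. 8 * c i + e i" and ?r = "\<lambda>i. 8 * c i - e i"
    have "32 * F c e = F ?p ?p - F ?r ?r"
      using Fsym[of e c] by (simp add: Fadd Fsub Fmul Fadd' Fsub' Fmul')
    then have "32 * \<bar>F c e\<bar> \<le> S * m ?p + S * m ?r"
      using scale[of ?p] scale[of ?r] by linarith
    also have "\<dots> = S * (m ?p + m ?r)"
      by (rule distrib_left[symmetric])
    also have "m ?p + m ?r = 128 * m c + 2 * m e"
      unfolding m_def sum.distrib[symmetric] sum_distrib_left
      by (intro sum.cong refl) (simp add: power2_eq_square algebra_simps)
    also have "S * (128 * m c + 2 * m e) \<le> S * 16" using that S0 by (intro mult_left_mono) auto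
    finally show ?thesis by simp
  qed
  have "(SUP a\<in>{a. m a \<le> 1}. \<bar>F a a\<bar>) \<le> \<eta> + S / 2"
  proof (rule cSUP_least)
    show "{a. m a \<le> 1} \<noteq> {}" by (auto intro!: exI[of _ "\<lambda>_. 0"] simp: m_def)
    fix a assume "a \<in> {a. m a \<le> 1}"
    then have a: "m a \<le> 1" by simp
    then obtain b where b: "b \<in> N" "m (\<lambda>i. a i - b i) \<le> 1 / 16" using N unfolding m_def ball_net_def by blast
    have "m (\<lambda>i. a i + b i) \<le> 2 * m a + 2 * m b"
      unfolding m_def sum_distrib_left sum.distrib[symmetric]
    proof (rule sum_mono)
      fix i
      show "(a i + b i)\<^sup>2 \<le> 2 * (a i)\<^sup>2 + 2 * (b i)\<^sup>2"
        using zero_le_power2[of "a i - b i"] by (simp add: power2_eq_square algebra_simps)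
    qed
    also have "\<dots> \<le> 4" using a N b(1) unfolding m_def ball_net_def by fastforce
    finally have "\<bar>F (\<lambda>i. a i - b i) (\<lambda>i. a i + b i)\<bar> \<le> S / 2" by (intro half b)
    moreover have "F (\<lambda>i. a i - b i) (\<lambda>i. a i + b i) = F a a - F b b"
      using Fsym[of a b] by (simp add: Fsub Fadd')
    moreover have "\<bar>F b b\<bar> \<le> \<eta>" using \<eta>[OF b(1)] unfolding F_def .
    ultimately show "\<bar>F a a\<bar> \<le> \<eta> + S / 2" by linarith
  qed
  then have "S \<le> 2 * \<eta>" unfolding S_def[symmetric] by simp
  then have "S * m a \<le> 2 * \<eta> * m a" using m0 by (rule mult_right_mono)
  with scale[of a] show ?thesis unfolding F_def m_def by linarith
qed

text \<open>Term by term comparison of the counts for each size with the binomial expansion of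
  \<open>(card H + 1) ^ n\<close>.\<close>

lemma card_bounded_subsets_le:
  assumes H: "finite H"
  shows "card {T. T \<subseteq> H \<and> card T \<le> n} \<le> (card H + 1) ^ n"
proof -
  have "{T. T \<subseteq> H \<and> card T \<le> n} = (\<Union>i\<le>n. {T. T \<subseteq> H \<and> card T = i})" by auto
  then have "card {T. T \<subseteq> H \<and> card T \<le> n} \<le> (\<Sum>i\<le>n. card {T. T \<subseteq> H \<and> card T = i})"
    by (simp add: card_UN_le)
  also have "\<dots> = (\<Sum>i\<le>n. card H choose i)" by (simp add: n_subsets[OF H])
  also have "\<dots> \<le> (\<Sum>i\<le>n. (n choose i) * card H ^ i * 1 ^ (n - i))"
  proof (rule sum_mono)
    fix i assume "i \<in> {..n}"
    then have "1 \<le> n choose i" by (simp add: Suc_le_eq)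
    moreover have "card H choose i \<le> card H ^ i"
      by (cases "i \<le> card H") (auto simp: binomial_le_pow binomial_eq_0)
    ultimately show "card H choose i \<le> (n choose i) * card H ^ i * 1 ^ (n - i)"
      by (metis mult.right_neutral mult_le_mono nat_mult_1 power_one)
  qed
  also have "\<dots> = (card H + 1) ^ n" by (simp only: binomial of_nat_id)
  finally show ?thesis .
qed

section \<open>The union bound over heads and tails\<close>

text \<open>The symmetric coefficient matrix of the form; the net argument is applied to its
  restriction to a coordinate set.\<close>

definition off_coeff :: "nat \<Rightarrow> (nat \<Rightarrow> nat \<Rightarrow> nat \<times> real) \<Rightarrow> nat \<Rightarrow> nat \<Rightarrow> real" where
  "off_coeff s \<omega> j l = (if j = l then 0 else (\<Sum>a<s. collide (\<omega> a) j l) / real s)"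

lemma off_coeff_sym: "off_coeff s \<omega> j l = off_coeff s \<omega> l j"
proof -
  have "collide \<theta> j l = collide \<theta> l j" for \<theta> unfolding collide_def by auto
  then show ?thesis by (simp add: off_coeff_def)
qed

lemma off_form_eq_coeff:
  "off_form s d \<omega> x y = (\<Sum>j<d. \<Sum>l<d. off_coeff s \<omega> j l * x j * y l)"
proof -
  let ?c = "\<lambda>a j l. if j = l then 0 else collide (\<omega> a) j l * x j * y l"
  have "(\<Sum>a<s. \<Sum>j<d. \<Sum>l<d. ?c a j l) = (\<Sum>j<d. \<Sum>a<s. \<Sum>l<d. ?c a j l)"
    by (rule sum.swap)
  also have "\<dots> = (\<Sum>j<d. \<Sum>l<d. \<Sum>a<s. ?c a j l)"
    by (intro sum.cong refl sum.swap)
  finally have "off_form s d \<omega> x y = (\<Sum>j<d. \<Sum>l<d. (\<Sum>a<s. ?c a j l) / real s)"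
    unfolding off_form_def by (simp only: sum_divide_distrib)
  also have "\<dots> = (\<Sum>j<d. \<Sum>l<d. off_coeff s \<omega> j l * x j * y l)"
    by (intro sum.cong refl) (simp add: off_coeff_def sum_distrib_right[symmetric])
  finally show ?thesis .
qed

lemma off_form_sym: "off_form s d \<omega> x y = off_form s d \<omega> y x"
  unfolding off_form_eq_coeff
proof (subst sum.swap, intro sum.cong refl)
  fix j l
  show "off_coeff s \<omega> l j * x l * y j = off_coeff s \<omega> j l * y j * x l"
    using off_coeff_sym[of s \<omega> l j] by simp
qed

lemma off_form_add_left:
  "off_form s d \<omega> (\<lambda>j. x j + y j) z = off_form s d \<omega> x z + off_form s d \<omega> y z"
  unfolding off_form_eq_coeff by (simp add: distrib_left distrib_right sum.distrib)

lemma off_form_add_square: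
  "off_form s d \<omega> (\<lambda>j. x j + y j) (\<lambda>j. x j + y j)
     = off_form s d \<omega> x x + 2 * off_form s d \<omega> x y + off_form s d \<omega> y y"
  using off_form_sym[of s d \<omega> x "\<lambda>j. x j + y j"] off_form_sym[of s d \<omega> y "\<lambda>j. x j + y j"]
    off_form_sym[of s d \<omega> y x] by (simp add: off_form_add_left)

lemma off_form_sum_left:
  "off_form s d \<omega> (\<lambda>c. \<Sum>i\<in>I. a i * v i c) y = (\<Sum>i\<in>I. a i * off_form s d \<omega> (v i) y)"
proof (induction I rule: infinite_finite_induct)
  case (insert i I)
  then show ?case by (simp add: off_form_add_left off_form_cmult_left)
qed (simp_all add: off_form_eq_coeff)

text \<open>Pulls the form back to the \<open>k\<close> coefficients, so that a net of a
  \<open>k\<close>-dimensional ball suffices whatever \<open>d\<close> is.\<close>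

lemma off_form_combination:
  "off_form s d \<omega> (\<lambda>c. \<Sum>i\<in>I. a i * v i c) (\<lambda>c. \<Sum>i\<in>I. a i * v i c)
     = (\<Sum>i\<in>I. \<Sum>j\<in>I. off_form s d \<omega> (v i) (v j) * a i * a j)"
proof -
  have "off_form s d \<omega> (v i) (\<lambda>c. \<Sum>j\<in>I. a j * v j c) = (\<Sum>j\<in>I. a j * off_form s d \<omega> (v i) (v j))" for i
    unfolding off_form_sym[of s d \<omega> "v i"] by (rule off_form_sum_left)
  then show ?thesis by (simp add: off_form_sum_left sum_distrib_left mult_ac)
qed

lemma off_form_supported:
  assumes "T \<subseteq> {..<d}" "\<And>j. j \<notin> T \<Longrightarrow> b j = 0"
  shows "off_form s d \<omega> b b = (\<Sum>j\<in>T. \<Sum>l\<in>T. off_coeff s \<omega> j l * b j * b l)"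
proof -
  have "(\<Sum>l<d. off_coeff s \<omega> j l * b j * b l) = (\<Sum>l\<in>T. off_coeff s \<omega> j l * b j * b l)" for j
    using assms by (intro sum.mono_neutral_right) auto
  then have "off_form s d \<omega> b b = (\<Sum>j<d. \<Sum>l\<in>T. off_coeff s \<omega> j l * b j * b l)"
    by (simp add: off_form_eq_coeff)
  also have "\<dots> = (\<Sum>j\<in>T. \<Sum>l\<in>T. off_coeff s \<omega> j l * b j * b l)"
    using assms by (intro sum.mono_neutral_right) auto
  finally show ?thesis .
qed

lemma card_UN_le_mult:
  assumes "finite I" "\<And>i. i \<in> I \<Longrightarrow> real (card (A i)) \<le> c"
  shows "real (card (\<Union>i\<in>I. A i)) \<le> real (card I) * c"
proof -
  have "real (card (\<Union>i\<in>I. A i)) \<le> real (\<Sum>i\<in>I. card (A i))"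
    using card_UN_le[OF assms(1), of A] by (simp only: of_nat_le_iff)
  also have "\<dots> \<le> (\<Sum>i\<in>I. c)" unfolding of_nat_sum using assms(2) by (intro sum_mono)
  finally show ?thesis by simp
qed

lemma orthonormal_combination_norm:
  fixes v :: "nat \<Rightarrow> nat \<Rightarrow> real"
  assumes "\<And>i i'. i < k \<Longrightarrow> i' < k \<Longrightarrow> (\<Sum>c<d. v i c * v i' c) = (if i = i' then 1 else 0)"
  shows "(\<Sum>c<d. (\<Sum>i<k. a i * v i c)\<^sup>2) = (\<Sum>i<k. (a i)\<^sup>2)"
proof -
  have "(\<Sum>c<d. (\<Sum>i<k. a i * v i c)\<^sup>2) = (\<Sum>c<d. \<Sum>i<k. \<Sum>i'<k. a i * a i' * (v i c * v i' c))"
    unfolding power2_eq_square sum_product by (simp add: mult_ac)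
  also have "\<dots> = (\<Sum>i<k. \<Sum>c<d. \<Sum>i'<k. a i * a i' * (v i c * v i' c))" by (rule sum.swap)
  also have "\<dots> = (\<Sum>i<k. \<Sum>i'<k. \<Sum>c<d. a i * a i' * (v i c * v i' c))"
    by (intro sum.cong refl sum.swap)
  also have "\<dots> = (\<Sum>i<k. \<Sum>i'<k. if i = i' then a i * a i' else 0)"
    unfolding sum_distrib_left[symmetric] by (intro sum.cong refl) (auto simp: assms)
  also have "\<dots> = (\<Sum>i<k. (a i)\<^sup>2)"
    by (intro sum.cong refl) (simp add: power2_eq_square)
  finally show ?thesis .
qed

text \<open>Large coordinates of a unit vector of the subspace occur only where the leverage score
  \<open>\<Sum>i<k. (v i c)\<^sup>2\<close> is large, and the leverage scores sum to \<open>k\<close>. Hence the head of a net point is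
  covered by a union bound over few coordinate sets \<open>T\<close>, independently of \<open>d\<close>, while its tail is
  treated as a fixed vector.\<close>

lemma sketch_failure_count:
  fixes v :: "nat \<Rightarrow> nat \<Rightarrow> real" and \<tau> \<eta> p1 p2 :: real
  assumes orth: "\<And>i i'. i < k \<Longrightarrow> i' < k \<Longrightarrow> (\<Sum>c<d. v i c * v i' c) = (if i = i' then 1 else 0)"
    and \<tau>: "0 < \<tau>" and p: "0 \<le> p1" "0 \<le> p2"
    and tail1: "\<And>x. (\<Sum>j<d. (x j)\<^sup>2) \<le> 1 \<Longrightarrow>
      real (card {\<omega> \<in> sketches s B d. \<eta> < \<bar>off_form s d \<omega> x x\<bar>}) \<le> real (card (sketches s B d)) * p1"
    and tail2: "\<And>x. (\<Sum>j<d. (x j)\<^sup>2) \<le> 1 \<Longrightarrow> (\<And>j. j < d \<Longrightarrow> \<bar>x j\<bar> \<le> 1 / \<tau>) \<Longrightarrow>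
      real (card {\<omega> \<in> sketches s B d. \<eta> < \<bar>off_form s d \<omega> x x\<bar>}) \<le> real (card (sketches s B d)) * p2"
    and tail3: "\<And>u y. (\<Sum>j<d. (u j)\<^sup>2) \<le> 1 \<Longrightarrow> (\<Sum>j<d. (y j)\<^sup>2) \<le> 1 \<Longrightarrow>
      (\<And>j. j < d \<Longrightarrow> u j * y j = 0) \<Longrightarrow> (\<And>j. j < d \<Longrightarrow> \<bar>y j\<bar> \<le> 1 / \<tau>) \<Longrightarrow>
      real (card {\<omega> \<in> sketches s B d. \<eta> < \<bar>off_form s d \<omega> u y\<bar>}) \<le> real (card (sketches s B d)) * p2"
  shows "real (card {\<omega> \<in> sketches s B d. \<exists>a. 10 * \<eta> * (\<Sum>i<k. (a i)\<^sup>2)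
        < \<bar>off_form s d \<omega> (\<lambda>c. \<Sum>i<k. a i * v i c) (\<lambda>c. \<Sum>i<k. a i * v i c)\<bar>})
     \<le> real (card (sketches s B d)) *
        ((real k * \<tau>\<^sup>2 + 1) ^ nat \<lfloor>\<tau>\<^sup>2\<rfloor> * exp (18 * \<tau>\<^sup>2) * p1 + 2 * exp (18 * real k) * p2)"
proof -
  define \<Omega> where "\<Omega> = sketches s B d"
  define n where "n = nat \<lfloor>\<tau>\<^sup>2\<rfloor>"
  define lev where "lev c = (\<Sum>i<k. (v i c)\<^sup>2)" for c
  define H where "H = {c. c < d \<and> 1 / \<tau>\<^sup>2 \<le> lev c}"
  define X where "X a = (\<lambda>c. \<Sum>i<k. a i * v i c)" for a
  \<comment> \<open>The conjunct \<open>j < d\<close> sends the irrelevant coordinates beyond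
    \<open>d\<close> to the tail: the head then vanishes outside the set of large coordinates below
    \<open>d\<close>, while \<open>hd x\<close> and \<open>tl x\<close> still add up to
    \<open>x\<close> everywhere.\<close>
  define hd where "hd x = (\<lambda>j. if 1 / \<tau> < \<bar>x j\<bar> \<and> j < d then x j else 0 :: real)" for x
  define tl where "tl x = (\<lambda>j. if 1 / \<tau> < \<bar>x j\<bar> \<and> j < d then 0 else x j :: real)" for x
  define \<T> where "\<T> = {T. T \<subseteq> H \<and> card T \<le> n}"
  obtain N :: "nat set \<Rightarrow> (nat \<Rightarrow> real) set" where N: "\<And>I. finite I \<Longrightarrow> ball_net I (N I)"
    using ball_net_exists by metis
  have N_fin: "finite (N I)" and N_card: "real (card (N I)) \<le> exp (18 * real (card I))"
    if "finite I" for I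
    using N[OF that] unfolding ball_net_def by auto
  have N_ball: "(\<Sum>i\<in>I. (b i)\<^sup>2) \<le> 1" and N_supp: "i \<notin> I \<Longrightarrow> b i = 0"
    if "finite I" "b \<in> N I" for I b i
    using N[OF that(1)] that(2) unfolding ball_net_def by auto
  have finH: "finite H" unfolding H_def by auto
  have fin\<T>: "finite \<T>" unfolding \<T>_def using finH by auto
  have finT: "finite T" "T \<subseteq> {..<d}" if "T \<in> \<T>" for T
    using that finite_subset[OF _ finH, of T] unfolding \<T>_def by (auto simp: H_def)
  have cardT: "real (card T) \<le> \<tau>\<^sup>2" if "T \<in> \<T>" for T
  proof -
    have "real (card T) \<le> real n" using that unfolding \<T>_def by simp
    also have "\<dots> \<le> \<tau>\<^sup>2" unfolding n_def by (simp add: of_nat_floor)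
    finally show ?thesis .
  qed
  have cardH: "real (card H) \<le> real k * \<tau>\<^sup>2"
  proof -
    have "real (card H) * (1 / \<tau>\<^sup>2) = (\<Sum>c\<in>H. 1 / \<tau>\<^sup>2)" by simp
    also have "\<dots> \<le> (\<Sum>c\<in>H. lev c)" by (intro sum_mono) (simp add: H_def)
    also have "\<dots> \<le> (\<Sum>c<d. lev c)" by (intro sum_mono2) (auto simp: H_def lev_def intro!: sum_nonneg)
    also have "\<dots> = (\<Sum>i<k. \<Sum>c<d. v i c * v i c)"
      unfolding lev_def power2_eq_square by (rule sum.swap)
    also have "\<dots> = real k" by (simp add: orth)
    finally show ?thesis using \<tau> by (simp add: field_simps)
  qed
  \<comment> \<open>The heads of the net points may number \<open>exp (18 * k)\<close>, too many for
    the weak bound \<open>p1\<close>. So the event ranges over nets of the balls on all admissible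
    supports instead, a family controlled by \<open>\<tau>\<close> and the number of
    supports.\<close>
  define E1 where "E1 = (\<Union>T\<in>\<T>. \<Union>b\<in>N T. {\<omega> \<in> \<Omega>. \<eta> < \<bar>off_form s d \<omega> b b\<bar>})"
  define E2 where "E2 = (\<Union>a\<in>N {..<k}. {\<omega> \<in> \<Omega>. \<eta> < \<bar>off_form s d \<omega> (tl (X a)) (tl (X a))\<bar>})"
  define E3 where "E3 = (\<Union>a\<in>N {..<k}. {\<omega> \<in> \<Omega>. \<eta> < \<bar>off_form s d \<omega> (hd (X a)) (tl (X a))\<bar>})"
  have X1: "(\<Sum>c<d. (X a c)\<^sup>2) \<le> 1" if "a \<in> N {..<k}" for a
    using orthonormal_combination_norm[where v = v and k = k and d = d and a = a, OF orth]
      N_ball[OF finite_lessThan that] by (simp add: X_def)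
  have hd_le: "(hd x j)\<^sup>2 \<le> (x j)\<^sup>2" and tl_le: "(tl x j)\<^sup>2 \<le> (x j)\<^sup>2" for x j
    unfolding hd_def tl_def by auto
  have hd1: "(\<Sum>c<d. (hd (X a) c)\<^sup>2) \<le> 1" if "a \<in> N {..<k}" for a
    by (rule order_trans[OF sum_mono X1[OF that]]) (rule hd_le)
  have tl1: "(\<Sum>c<d. (tl (X a) c)\<^sup>2) \<le> 1" if "a \<in> N {..<k}" for a
    by (rule order_trans[OF sum_mono X1[OF that]]) (rule tl_le)
  have tl_small: "\<bar>tl x j\<bar> \<le> 1 / \<tau>" if "j < d" for x j using that \<tau> unfolding tl_def by auto

  have "{\<omega> \<in> \<Omega>. \<exists>a. 10 * \<eta> * (\<Sum>i<k. (a i)\<^sup>2) < \<bar>off_form s d \<omega> (X a) (X a)\<bar>} \<subseteq> E1 \<union> (E2 \<union> E3)"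
  proof (rule subsetI, rule ccontr)
    fix \<omega> assume "\<omega> \<in> {\<omega> \<in> \<Omega>. \<exists>a. 10 * \<eta> * (\<Sum>i<k. (a i)\<^sup>2) < \<bar>off_form s d \<omega> (X a) (X a)\<bar>}"
    then obtain a where \<omega>: "\<omega> \<in> \<Omega>" and a: "10 * \<eta> * (\<Sum>i<k. (a i)\<^sup>2) < \<bar>off_form s d \<omega> (X a) (X a)\<bar>"
      by blast
    assume nE: "\<omega> \<notin> E1 \<union> (E2 \<union> E3)"
    have n1: "\<bar>off_form s d \<omega> b b\<bar> \<le> \<eta>" if "T \<in> \<T>" "b \<in> N T" for T b
    proof (rule leI, rule notI)
      assume "\<eta> < \<bar>off_form s d \<omega> b b\<bar>"
      with \<omega> that have "\<omega> \<in> E1" unfolding E1_def by blast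
      with nE show False by simp
    qed
    have n2: "\<bar>off_form s d \<omega> (tl (X b)) (tl (X b))\<bar> \<le> \<eta>" if "b \<in> N {..<k}" for b
    proof (rule leI, rule notI)
      assume "\<eta> < \<bar>off_form s d \<omega> (tl (X b)) (tl (X b))\<bar>"
      with \<omega> that have "\<omega> \<in> E2" unfolding E2_def by blast
      with nE show False by simp
    qed
    have n3: "\<bar>off_form s d \<omega> (hd (X b)) (tl (X b))\<bar> \<le> \<eta>" if "b \<in> N {..<k}" for b
    proof (rule leI, rule notI)
      assume "\<eta> < \<bar>off_form s d \<omega> (hd (X b)) (tl (X b))\<bar>"
      with \<omega> that have "\<omega> \<in> E3" unfolding E3_def by blast
      with nE show False by simp
    qed
    \<comment> \<open>The head counts \<open>2 * \<eta>\<close> because of its own net, the cross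
      term enters twice with \<open>\<eta>\<close>, and the tail once. Passing from the net of
      coefficients to all coefficients doubles this to \<open>10 * \<eta>\<close>.\<close>
    have "\<bar>off_form s d \<omega> (X b) (X b)\<bar> \<le> 5 * \<eta>" if b: "b \<in> N {..<k}" for b
    proof -
      define T where "T = {j. j < d \<and> 1 / \<tau> < \<bar>X b j\<bar>}"
      have big: "1 / \<tau>\<^sup>2 \<le> (X b j)\<^sup>2" if "j \<in> T" for j
      proof -
        have "(1 / \<tau>)\<^sup>2 \<le> \<bar>X b j\<bar>\<^sup>2" using that \<tau> unfolding T_def by (intro power_mono) auto
        then show ?thesis by (simp add: power_divide)
      qed
      have "T \<subseteq> H"
      proof
        fix j assume j: "j \<in> T"
        have "(X b j)\<^sup>2 \<le> (\<Sum>i<k. (b i)\<^sup>2) * lev j"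
          unfolding X_def lev_def by (rule Cauchy_Schwarz_ineq_sum)
        also have "\<dots> \<le> 1 * lev j"
          using N_ball[OF finite_lessThan b] by (intro mult_right_mono) (auto simp: lev_def intro!: sum_nonneg)
        finally show "j \<in> H" using big[OF j] j unfolding H_def T_def by simp
      qed
      moreover have "card T \<le> n"
      proof -
        have "real (card T) * (1 / \<tau>\<^sup>2) = (\<Sum>j\<in>T. 1 / \<tau>\<^sup>2)" by simp
        also have "\<dots> \<le> (\<Sum>j\<in>T. (X b j)\<^sup>2)" by (intro sum_mono big)
        also have "\<dots> \<le> (\<Sum>j<d. (X b j)\<^sup>2)" by (intro sum_mono2) (auto simp: T_def)
        finally have "real (card T) * (1 / \<tau>\<^sup>2) \<le> 1" using X1[OF b] by simp
        then have "real (card T) \<le> \<tau>\<^sup>2" using \<tau> by (simp add: field_simps)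
        then show ?thesis unfolding n_def by (simp add: le_nat_floor)
      qed
      ultimately have T: "T \<in> \<T>" unfolding \<T>_def by simp
      have hT: "hd (X b) j = 0" if "j \<notin> T" for j using that unfolding hd_def T_def by auto
      have "\<bar>\<Sum>j\<in>T. \<Sum>l\<in>T. off_coeff s \<omega> j l * hd (X b) j * hd (X b) l\<bar> \<le> 2 * \<eta> * (\<Sum>j\<in>T. (hd (X b) j)\<^sup>2)"
      proof (rule quadratic_form_le_net[where N = "N T"])
        fix c assume c: "c \<in> N T"
        have "\<And>j. j \<notin> T \<Longrightarrow> c j = 0" using N_supp[OF finT(1)[OF T] c] .
        then show "\<bar>\<Sum>j\<in>T. \<Sum>l\<in>T. off_coeff s \<omega> j l * c j * c l\<bar> \<le> \<eta>"
          using n1[OF T c] off_form_supported[OF finT(2)[OF T], of c s \<omega>] by simp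
      qed (use N finT[OF T] off_coeff_sym in auto)
      also have "\<dots> \<le> 2 * \<eta> * 1"
      proof (rule mult_left_mono)
        have "(\<Sum>j\<in>T. (hd (X b) j)\<^sup>2) \<le> (\<Sum>j<d. (hd (X b) j)\<^sup>2)"
          by (intro sum_mono2) (auto simp: T_def)
        then show "(\<Sum>j\<in>T. (hd (X b) j)\<^sup>2) \<le> 1" using hd1[OF b] by linarith
        show "0 \<le> 2 * \<eta>" using n2[OF b] by linarith
      qed
      finally have "\<bar>off_form s d \<omega> (hd (X b)) (hd (X b))\<bar> \<le> 2 * \<eta>"
        using off_form_supported[OF finT(2)[OF T], of "hd (X b)" s \<omega>] hT by simp
      moreover have "off_form s d \<omega> (X b) (X b) = off_form s d \<omega> (hd (X b)) (hd (X b))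
          + 2 * off_form s d \<omega> (hd (X b)) (tl (X b)) + off_form s d \<omega> (tl (X b)) (tl (X b))"
      proof -
        have e: "(\<lambda>j. hd (X b) j + tl (X b) j) = X b" unfolding hd_def tl_def by auto
        show ?thesis using off_form_add_square[of s d \<omega> "hd (X b)" "tl (X b)"] unfolding e .
      qed
      ultimately show ?thesis using n2[OF b] n3[OF b] by linarith
    qed
    then have "\<bar>\<Sum>i<k. \<Sum>j<k. off_form s d \<omega> (v i) (v j) * a i * a j\<bar> \<le> 2 * (5 * \<eta>) * (\<Sum>i<k. (a i)\<^sup>2)"
      unfolding X_def off_form_combination
      by (intro quadratic_form_le_net[where N = "N {..<k}"] N off_form_sym) auto
    then show False using a unfolding X_def off_form_combination by simp
  qed
  then have "card {\<omega> \<in> \<Omega>. \<exists>a. 10 * \<eta> * (\<Sum>i<k. (a i)\<^sup>2) < \<bar>off_form s d \<omega> (X a) (X a)\<bar>}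
      \<le> card (E1 \<union> (E2 \<union> E3))"
  proof (rule card_mono[rotated])
    have "E1 \<union> (E2 \<union> E3) \<subseteq> \<Omega>" unfolding E1_def E2_def E3_def by auto
    then show "finite (E1 \<union> (E2 \<union> E3))" by (rule finite_subset) (simp add: \<Omega>_def finite_sketches)
  qed
  also have "\<dots> \<le> card E1 + (card E2 + card E3)"
    by (intro order_trans[OF card_Un_le] add_left_mono card_Un_le)
  finally have main: "real (card {\<omega> \<in> \<Omega>. \<exists>a. 10 * \<eta> * (\<Sum>i<k. (a i)\<^sup>2) < \<bar>off_form s d \<omega> (X a) (X a)\<bar>})
      \<le> real (card E1) + (real (card E2) + real (card E3))"
    by (simp only: of_nat_add[symmetric] of_nat_le_iff)
  have NV: "finite (N {..<k})" "real (card (N {..<k})) \<le> exp (18 * real k)"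
    using N_fin[of "{..<k}"] N_card[of "{..<k}"] by auto
  have "real (card E2) \<le> real (card (N {..<k})) * (real (card \<Omega>) * p2)"
    unfolding E2_def \<Omega>_def using NV(1) tl1 tl_small by (intro card_UN_le_mult tail2) auto
  also have "\<dots> \<le> exp (18 * real k) * (real (card \<Omega>) * p2)"
    using NV(2) p by (intro mult_right_mono) auto
  finally have e2: "real (card E2) \<le> exp (18 * real k) * (real (card \<Omega>) * p2)" .
  have "real (card E3) \<le> real (card (N {..<k})) * (real (card \<Omega>) * p2)"
    unfolding E3_def \<Omega>_def using NV(1) hd1 tl1 tl_small
    by (intro card_UN_le_mult tail3) (auto simp: hd_def tl_def)
  also have "\<dots> \<le> exp (18 * real k) * (real (card \<Omega>) * p2)"
    using NV(2) p by (intro mult_right_mono) auto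
  finally have e3: "real (card E3) \<le> exp (18 * real k) * (real (card \<Omega>) * p2)" .
  have "real (card E1) \<le> real (card \<T>) * (exp (18 * \<tau>\<^sup>2) * (real (card \<Omega>) * p1))"
    unfolding E1_def
  proof (rule card_UN_le_mult[OF fin\<T>])
    fix T assume T: "T \<in> \<T>"
    have NT: "finite (N T)" "real (card (N T)) \<le> exp (18 * real (card T))"
      using N_fin N_card finT[OF T] by auto
    have "real (card (\<Union>b\<in>N T. {\<omega> \<in> \<Omega>. \<eta> < \<bar>off_form s d \<omega> b b\<bar>})) \<le> real (card (N T)) * (real (card \<Omega>) * p1)"
      unfolding \<Omega>_def
    proof (rule card_UN_le_mult[OF NT(1)], rule tail1)
      fix b assume b: "b \<in> N T"
      have "(\<Sum>j<d. (b j)\<^sup>2) = (\<Sum>j\<in>T. (b j)\<^sup>2)"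
        using N_supp finT[OF T] b by (intro sum.mono_neutral_right) auto
      then show "(\<Sum>j<d. (b j)\<^sup>2) \<le> 1" using N_ball[OF finT(1)[OF T] b] by simp
    qed
    also have "\<dots> \<le> exp (18 * \<tau>\<^sup>2) * (real (card \<Omega>) * p1)"
      using cardT[OF T] p by (intro mult_right_mono order_trans[OF NT(2)]) auto
    finally show "real (card (\<Union>b\<in>N T. {\<omega> \<in> \<Omega>. \<eta> < \<bar>off_form s d \<omega> b b\<bar>}))
        \<le> exp (18 * \<tau>\<^sup>2) * (real (card \<Omega>) * p1)" .
  qed
  also have "\<dots> \<le> (real k * \<tau>\<^sup>2 + 1) ^ n * (exp (18 * \<tau>\<^sup>2) * (real (card \<Omega>) * p1))"
  proof (rule mult_right_mono)
    have "real (card \<T>) \<le> real ((card H + 1) ^ n)"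
      unfolding \<T>_def of_nat_le_iff by (rule card_bounded_subsets_le[OF finH])
    also have "\<dots> \<le> (real k * \<tau>\<^sup>2 + 1) ^ n"
      using cardH by (simp add: power_mono)
    finally show "real (card \<T>) \<le> (real k * \<tau>\<^sup>2 + 1) ^ n" .
  qed (use p in auto)
  finally have "real (card E1) \<le> (real k * \<tau>\<^sup>2 + 1) ^ n * (exp (18 * \<tau>\<^sup>2) * (real (card \<Omega>) * p1))" .
  then have "real (card E1) + (real (card E2) + real (card E3)) \<le> real (card \<Omega>) *
      ((real k * \<tau>\<^sup>2 + 1) ^ n * exp (18 * \<tau>\<^sup>2) * p1 + 2 * exp (18 * real k) * p2)"
    using e2 e3 by (simp add: algebra_simps)
  with main show ?thesis unfolding \<Omega>_def X_def n_def by linarith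
qed

section \<open>Choice of the parameters\<close>

definition sketch_fails :: "nat \<Rightarrow> nat \<Rightarrow> nat \<Rightarrow> (nat \<Rightarrow> nat \<Rightarrow> real) \<Rightarrow> real \<Rightarrow>
    (nat \<Rightarrow> nat \<Rightarrow> nat \<times> real) \<Rightarrow> bool" where
  "sketch_fails s d k v \<epsilon> \<omega> \<longleftrightarrow> (\<exists>a. \<epsilon> * (\<Sum>i<k. (a i)\<^sup>2)
     < \<bar>off_form s d \<omega> (\<lambda>c. \<Sum>i<k. a i * v i c) (\<lambda>c. \<Sum>i<k. a i * v i c)\<bar>)"

lemma sketch_fails_mono:
  assumes "sketch_fails s d k v \<epsilon> \<omega>" "e \<le> \<epsilon>"
  shows "sketch_fails s d k v e \<omega>"
proof -
  from assms(1) obtain a where a: "\<epsilon> * (\<Sum>i<k. (a i)\<^sup>2)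
     < \<bar>off_form s d \<omega> (\<lambda>c. \<Sum>i<k. a i * v i c) (\<lambda>c. \<Sum>i<k. a i * v i c)\<bar>"
    unfolding sketch_fails_def by blast
  have "e * (\<Sum>i<k. (a i)\<^sup>2) \<le> \<epsilon> * (\<Sum>i<k. (a i)\<^sup>2)"
    using assms(2) by (intro mult_right_mono sum_nonneg) auto
  with a show ?thesis unfolding sketch_fails_def by (meson le_less_trans)
qed

definition orthonormal :: "nat \<Rightarrow> nat \<Rightarrow> (nat \<Rightarrow> nat \<Rightarrow> real) \<Rightarrow> bool" where
  "orthonormal d k v \<longleftrightarrow>
     (\<forall>i<k. \<forall>i'<k. (\<Sum>c<d. v i c * v i' c) = (if i = i' then 1 else 0))"

lemma nat_ceiling_le_twice:
  fixes x :: real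
  assumes "1 \<le> x"
  shows "x \<le> real (nat \<lceil>x\<rceil>)" "real (nat \<lceil>x\<rceil>) \<le> 2 * x"
  using assms by linarith+

text \<open>All three tail bounds use \<open>\<mu> = D' / 8\<close>, which requires entries of size
  at most \<open>1 / D'\<close> up to a constant and gives an exponent of at most
  \<open>- 28 * k * D' / D\<close>. Arbitrary unit vectors take \<open>D' = 1\<close>; tails and
  cross terms, with a vector of entries at most \<open>1 / \<tau> \<le> 1 / D\<close>, take
  \<open>D' = D\<close>.\<close>

lemma sketch_failure_general:
  fixes e \<tau> D :: real
  assumes v: "orthonormal d k v" and e: "0 < e" and D: "1 \<le> D" "D \<le> \<tau>" "D \<le> ln (1 / e)"
    and s: "17920 * real k / (e * D) \<le> real s" "0 < s"
    and B: "(10 * row_const + 1) * D / e \<le> real B"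
  shows "real (card {\<omega> \<in> sketches s B d. sketch_fails s d k v e \<omega>})
     \<le> real (card (sketches s B d)) * ((real k * \<tau>\<^sup>2 + 1) ^ nat \<lfloor>\<tau>\<^sup>2\<rfloor> * exp (18 * \<tau>\<^sup>2)
          * (2 * exp (- (28 * real k / D))) + 2 * exp (18 * real k) * (2 * exp (- (28 * real k))))"
proof -
  define \<eta> where "\<eta> = e / 10"
  have DB: "D / e \<le> real B"
  proof -
    have "1 * (D / e) \<le> (10 * row_const + 1) * (D / e)"
      using row_const_pos D e by (intro mult_right_mono) auto
    then show ?thesis using B by simp
  qed
  have "1 / e \<le> D / e" using D e by (simp add: divide_right_mono)
  then have eB: "1 / e \<le> real B" using DB by linarith
  have B0: "0 < real B" using eB e by (meson less_le_trans zero_less_divide_1_iff)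
  with eB have lnB: "ln (1 / e) \<le> ln (real B)" using e by (subst ln_le_cancel_iff) auto
  then have B1: "1 \<le> ln (real B)" using D by linarith
  \<comment> \<open>With \<open>\<eta> = e / 10\<close> the threshold \<open>\<zeta>\<close> is at
    least \<open>e / 40\<close>, and \<open>B\<close> keeps the variance term below
    \<open>e / 80\<close>. The margin \<open>e / 80\<close> times \<open>D' / 8\<close> explains
    640, and \<open>17920 = 28 * 640\<close>.\<close>
  have exponent: "real s * (D' / 8) * (row_const * (D' / 8) / real B - \<zeta>) \<le> - (28 * real k * D' / D)"
    if D': "1 \<le> D'" "D' \<le> D" and \<zeta>: "\<eta> / 4 \<le> \<zeta>" for D' \<zeta>
  proof -
    have "row_const * (D' / 8) / real B \<le> e / 80"
    proof -
      have "10 * row_const * D / e \<le> (10 * row_const + 1) * D / e"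
        using D e by (intro divide_right_mono mult_right_mono) auto
      then have "10 * row_const * D / e \<le> real B" using B by linarith
      then have "row_const * D * 10 \<le> real B * e" using e by (simp add: field_simps)
      moreover have "row_const * D' \<le> row_const * D"
        using D' row_const_pos by (intro mult_left_mono) auto
      ultimately have "row_const * D' * 10 \<le> real B * e" by linarith
      then show ?thesis using B0 by (simp add: field_simps)
    qed
    then have "row_const * (D' / 8) / real B - \<zeta> \<le> - (e / 80)" using \<zeta> unfolding \<eta>_def by linarith
    then have "real s * (D' / 8) * (row_const * (D' / 8) / real B - \<zeta>) \<le> real s * (D' / 8) * - (e / 80)"
      using D' by (intro mult_left_mono) auto
    also have "\<dots> = - (real s * (D' * e / 640))" by simp
    also have "\<dots> \<le> - (17920 * real k / (e * D) * (D' * e / 640))"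
      using D' e s by (intro le_imp_neg_le mult_right_mono) auto
    also have "\<dots> = - (28 * real k * D' / D)" using e by simp
    finally show ?thesis .
  qed
  have mu: "1 / 32 \<le> D' / 8" "D' / 8 \<le> ln (real B) / 8" "(D' / 8)\<^sup>2 \<le> real B"
    if D': "1 \<le> D'" "D' \<le> D" for D'
  proof -
    show "1 / 32 \<le> D' / 8" using D' by simp
    show "D' / 8 \<le> ln (real B) / 8" using D' D lnB by simp
    have "D' / 8 \<le> D" using D' by simp
    then have "(D' / 8)\<^sup>2 \<le> D\<^sup>2" using D' by (intro power_mono) auto
    \<comment> \<open>One factor \<open>D\<close> is at most \<open>ln (1 / e) \<le> 1 / e\<close>,
      which turns the square into the order of \<open>B\<close>.\<close>
    also have "D\<^sup>2 \<le> D * (1 / e)"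
    proof -
      have "ln (1 / e) \<le> 1 / e" using ln_le_minus_one[of "1 / e"] e by simp
      then show ?thesis using D unfolding power2_eq_square by (intro mult_left_mono) auto
    qed
    also have "\<dots> \<le> real B" using DB by simp
    finally show "(D' / 8)\<^sup>2 \<le> real B" .
  qed
  have small: "D' / 8 * \<bar>x\<bar> \<le> 1" if "\<bar>x\<bar> \<le> 1 / D'" "1 \<le> D'" for D' x :: real
  proof -
    have "D' * \<bar>x\<bar> \<le> D' * (1 / D')" using that by (intro mult_left_mono) auto
    then show ?thesis using that by simp
  qed
  have square: "real (card {\<omega> \<in> sketches s B d. \<eta> < \<bar>off_form s d \<omega> x x\<bar>})
      \<le> real (card (sketches s B d)) * (2 * exp (- (28 * real k * D' / D)))"
    if D': "1 \<le> D'" "D' \<le> D" and x: "(\<Sum>j<d. (x j)\<^sup>2) \<le> 1" "\<And>j. j < d \<Longrightarrow> \<bar>x j\<bar> \<le> 1 / D'" for D' x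
  proof -
    have "real (card {\<omega> \<in> sketches s B d. \<eta> < \<bar>off_form s d \<omega> x x\<bar>})
        \<le> real (card (sketches s B d)) * (2 * exp (real s * (D' / 8) * (row_const * (D' / 8) / real B - \<eta> / 4)))"
      by (rule off_form_square_tail[OF s(2) B1 x(1) mu[OF D'] small[OF x(2) D'(1)]])
    also have "\<dots> \<le> real (card (sketches s B d)) * (2 * exp (- (28 * real k * D' / D)))"
      using exponent[OF D', of "\<eta> / 4"] by (intro mult_left_mono) auto
    finally show ?thesis .
  qed
  have \<tau>D: "1 / \<tau> \<le> 1 / D" using D by (simp add: frac_le)
  have eq: "sketch_fails s d k v e \<omega> \<longleftrightarrow> (\<exists>a. 10 * \<eta> * (\<Sum>i<k. (a i)\<^sup>2)
     < \<bar>off_form s d \<omega> (\<lambda>c. \<Sum>i<k. a i * v i c) (\<lambda>c. \<Sum>i<k. a i * v i c)\<bar>)" for \<omega>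
    unfolding sketch_fails_def \<eta>_def by simp
  show ?thesis
    unfolding eq
  proof (rule sketch_failure_count)
    show "(\<Sum>c<d. v i c * v i' c) = (if i = i' then 1 else 0)" if "i < k" "i' < k" for i i'
      using v that unfolding orthonormal_def by blast
    show "0 < \<tau>" using D by linarith
  next
    fix x :: "nat \<Rightarrow> real" assume x: "(\<Sum>j<d. (x j)\<^sup>2) \<le> 1"
    have "\<bar>x j\<bar> \<le> 1 / 1" if "j < d" for j
    proof -
      have "(x j)\<^sup>2 \<le> 1"
        using x member_le_sum[of j "{..<d}" "\<lambda>j. (x j)\<^sup>2"] that by auto
      then show ?thesis by (simp add: abs_square_le_1)
    qed
    from square[OF _ D(1) x this]
    show "real (card {\<omega> \<in> sketches s B d. \<eta> < \<bar>off_form s d \<omega> x x\<bar>})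
        \<le> real (card (sketches s B d)) * (2 * exp (- (28 * real k / D)))" by simp
  next
    fix x :: "nat \<Rightarrow> real" assume x: "(\<Sum>j<d. (x j)\<^sup>2) \<le> 1" "\<And>j. j < d \<Longrightarrow> \<bar>x j\<bar> \<le> 1 / \<tau>"
    have "\<bar>x j\<bar> \<le> 1 / D" if "j < d" for j using x(2)[OF that] \<tau>D by linarith
    from square[OF D(1) order_refl x(1) this]
    show "real (card {\<omega> \<in> sketches s B d. \<eta> < \<bar>off_form s d \<omega> x x\<bar>})
        \<le> real (card (sketches s B d)) * (2 * exp (- (28 * real k)))" using D by simp
  next
    fix u y :: "nat \<Rightarrow> real"
    assume u: "(\<Sum>j<d. (u j)\<^sup>2) \<le> 1" and y: "(\<Sum>j<d. (y j)\<^sup>2) \<le> 1"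
      and disj: "\<And>j. j < d \<Longrightarrow> u j * y j = 0" and ys: "\<And>j. j < d \<Longrightarrow> \<bar>y j\<bar> \<le> 1 / \<tau>"
    have ys': "D / 8 * \<bar>y j\<bar> \<le> 1" if "j < d" for j
      using ys[OF that] \<tau>D D by (intro small) auto
    have "real (card {\<omega> \<in> sketches s B d. \<eta> < \<bar>off_form s d \<omega> u y\<bar>})
        \<le> real (card (sketches s B d)) * (2 * exp (real s * (D / 8) * (row_const * (D / 8) / real B - \<eta>)))"
      by (rule off_form_tail[OF s(2) B1 u y disj mu[OF D(1) order_refl] ys'])
    also have "\<dots> \<le> real (card (sketches s B d)) * (2 * exp (- (28 * real k * D / D)))"
      using exponent[OF D(1) order_refl, of \<eta>] e by (intro mult_left_mono) (auto simp: \<eta>_def)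
    finally show "real (card {\<omega> \<in> sketches s B d. \<eta> < \<bar>off_form s d \<omega> u y\<bar>})
        \<le> real (card (sketches s B d)) * (2 * exp (- (28 * real k)))" using D by simp
  qed auto
qed

text \<open>With \<open>w = k / \<tau> = \<tau>\<^sup>2 * \<kappa>\<close>, the supports number at
  most \<open>exp (3 * w)\<close> because \<open>k * \<tau>\<^sup>2 + 1 \<le> k ^ 3\<close>, their
  nets cost at most \<open>exp (18 * w)\<close>, and a single failure has exponent at most
  \<open>- 28 * w\<close>; this leaves \<open>exp (- 7 * w)\<close>. The tail part leaves
  \<open>exp (- 10 * k)\<close>, which is smaller as \<open>w \<le> k\<close>. The prefactors add up
  to \<open>6 \<le> exp (6 * w)\<close>, and the remaining \<open>exp (- w)\<close> suffices because
  \<open>k powr (2/3) \<le> w\<close>.\<close>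

lemma failure_bound_numeric:
  fixes k :: nat and \<tau> D \<kappa> :: real
  assumes k: "2 \<le> k" and \<kappa>: "\<kappa> = log 2 (real k)" and \<tau>: "\<tau> = (real k / \<kappa>) powr (1/3)"
    and D: "1 \<le> D" "D \<le> \<tau>"
  shows "(real k * \<tau>\<^sup>2 + 1) ^ nat \<lfloor>\<tau>\<^sup>2\<rfloor> * exp (18 * \<tau>\<^sup>2) * (2 * exp (- (28 * real k / D)))
      + 2 * exp (18 * real k) * (2 * exp (- (28 * real k))) \<le> 2 powr (- (real k powr (2/3)))"
    and "real k / \<tau> = real k powr (2/3) * \<kappa> powr (1/3)"
proof -
  have \<kappa>1: "1 \<le> \<kappa>" unfolding \<kappa> using k by (simp add: le_log_iff)
  have \<tau>1: "1 \<le> \<tau>" using D by linarith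
  have k0: "0 < real k" using k by simp
  define w where "w = real k / \<tau>"
  have t3: "\<tau> ^ 3 = real k / \<kappa>"
    unfolding \<tau> using k0 \<kappa>1 by (simp add: powr_powr flip: powr_realpow)
  have w: "w = \<tau>\<^sup>2 * \<kappa>"
    using t3 \<tau>1 \<kappa>1 unfolding w_def by (simp add: field_simps power3_eq_cube power2_eq_square)
  have kt: "w = real k powr (2/3) * \<kappa> powr (1/3)"
  proof -
    have "w = real k powr 1 / (real k powr (1/3) / \<kappa> powr (1/3))"
      unfolding w_def \<tau> using k0 \<kappa>1 by (simp add: powr_divide)
    also have "\<dots> = (real k powr 1 / real k powr (1/3)) * \<kappa> powr (1/3)" by simp
    also have "real k powr 1 / real k powr (1/3) = real k powr (2/3)"
      by (subst powr_diff[symmetric]) simp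
    finally show ?thesis .
  qed
  then show "real k / \<tau> = real k powr (2/3) * \<kappa> powr (1/3)" unfolding w_def .
  have w23: "real k powr (2/3) \<le> w"
    unfolding kt using \<kappa>1 mult_left_mono[of 1 "\<kappa> powr (1/3)" "real k powr (2/3)"]
    by (simp add: ge_one_powr_ge_zero)
  have w1: "1 \<le> w" using w23 k ge_one_powr_ge_zero[of "real k" "2/3"] by linarith
  have wk: "w \<le> real k" unfolding w_def using \<tau>1 k0 by (simp add: field_simps)
  have tw: "\<tau>\<^sup>2 \<le> w" unfolding w using \<kappa>1 mult_left_mono[of 1 \<kappa> "\<tau>\<^sup>2"] by simp
  have wD: "w \<le> real k / D" unfolding w_def using D by (intro divide_left_mono) auto
  have lnk: "ln (real k) \<le> \<kappa>"
  proof -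
    have "ln 2 \<le> (1::real)" using ln_le_minus_one[of 2] by simp
    then have "ln 2 * \<kappa> \<le> 1 * \<kappa>" using \<kappa>1 by (intro mult_right_mono) auto
    then show ?thesis unfolding \<kappa> log_def by simp
  qed
  have "real k * \<tau>\<^sup>2 + 1 \<le> real k ^ 3"
  proof -
    have "real k * \<tau>\<^sup>2 \<le> real k * real k" using tw wk by (intro mult_left_mono) auto
    moreover have "1 \<le> real k * real k" using k by (simp add: mult_ge1_I)
    moreover have "2 * (real k * real k) \<le> real k * (real k * real k)"
      using k by (intro mult_right_mono) auto
    ultimately show ?thesis by (simp add: power3_eq_cube)
  qed
  also have "\<dots> = exp (3 * ln (real k))" using k0 exp_of_nat_mult[of 3 "ln (real k)"] by simp
  also have "\<dots> \<le> exp (3 * \<kappa>)" using lnk by simp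
  finally have base: "real k * \<tau>\<^sup>2 + 1 \<le> exp (3 * \<kappa>)" .
  have "(real k * \<tau>\<^sup>2 + 1) ^ nat \<lfloor>\<tau>\<^sup>2\<rfloor> \<le> exp (3 * \<kappa>) ^ nat \<lfloor>\<tau>\<^sup>2\<rfloor>"
    using base by (intro power_mono) auto
  also have "\<dots> = exp (real (nat \<lfloor>\<tau>\<^sup>2\<rfloor>) * (3 * \<kappa>))" by (rule exp_of_nat_mult[symmetric])
  also have "\<dots> \<le> exp (3 * w)"
  proof -
    have "real (nat \<lfloor>\<tau>\<^sup>2\<rfloor>) * (3 * \<kappa>) \<le> \<tau>\<^sup>2 * (3 * \<kappa>)"
      using \<kappa>1 by (intro mult_right_mono) (auto simp: of_nat_floor)
    then show ?thesis unfolding w by simp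
  qed
  finally have sets: "(real k * \<tau>\<^sup>2 + 1) ^ nat \<lfloor>\<tau>\<^sup>2\<rfloor> \<le> exp (3 * w)" .
  have "(real k * \<tau>\<^sup>2 + 1) ^ nat \<lfloor>\<tau>\<^sup>2\<rfloor> * exp (18 * \<tau>\<^sup>2) * (2 * exp (- (28 * real k / D)))
      \<le> exp (3 * w) * exp (18 * w) * (2 * exp (- (28 * w)))"
    using sets tw wD by (intro mult_mono) auto
  also have "\<dots> = 2 * exp (- 7 * w)" by (simp add: mult_exp_exp)
  finally have t1: "(real k * \<tau>\<^sup>2 + 1) ^ nat \<lfloor>\<tau>\<^sup>2\<rfloor> * exp (18 * \<tau>\<^sup>2) * (2 * exp (- (28 * real k / D)))
      \<le> 2 * exp (- 7 * w)" .
  have "2 * exp (18 * real k) * (2 * exp (- (28 * real k))) = 4 * exp (- 10 * real k)"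
    by (simp add: mult_exp_exp)
  also have "\<dots> \<le> 4 * exp (- 7 * w)" using wk w1 by simp
  finally have t2: "2 * exp (18 * real k) * (2 * exp (- (28 * real k))) \<le> 4 * exp (- 7 * w)" .
  have "6 \<le> exp (6 * w)" using exp_ge_add_one_self[of "6 * w"] w1 by linarith
  then have "6 * exp (- 7 * w) \<le> exp (6 * w) * exp (- 7 * w)" by (intro mult_right_mono) auto
  also have "\<dots> = exp (- w)" by (simp add: mult_exp_exp)
  also have "\<dots> \<le> 2 powr (- (real k powr (2/3)))"
  proof -
    have "ln 2 * real k powr (2/3) \<le> 1 * w"
      using w23 ln_le_minus_one[of "2::real"] by (intro mult_mono) auto
    then show ?thesis unfolding powr_def by (simp add: mult.commute)
  qed
  finally show "(real k * \<tau>\<^sup>2 + 1) ^ nat \<lfloor>\<tau>\<^sup>2\<rfloor> * exp (18 * \<tau>\<^sup>2) * (2 * exp (- (28 * real k / D)))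
      + 2 * exp (18 * real k) * (2 * exp (- (28 * real k))) \<le> 2 powr (- (real k powr (2/3)))"
    using t1 t2 by linarith
qed

text \<open>The constants follow from \<open>s\<close> and \<open>B\<close>: rounding up doubles
  each, giving \<open>71680 = 4 * 17920\<close> for the product and \<open>35840 = 2 * 17920\<close>
  for \<open>s\<close>. Replacing \<open>1 / e\<close> by \<open>3 / \<epsilon>\<close> contributes
  9 and 3, and the change from \<open>ln\<close> to base 2 another 2 in \<open>s\<close>.\<close>

lemma sketch_exists_large:
  fixes \<epsilon> :: real
  assumes \<epsilon>: "0 < \<epsilon>" "\<epsilon> < 1" and k: "2 \<le> k"
  shows "\<exists>s B. 0 < s \<and> 0 < B \<and>
    real (s * B) \<le> 645120 * (10 * row_const + 1) * (real k / \<epsilon>\<^sup>2) \<and>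
    real s \<le> 215040 * (1 / \<epsilon> * (real k / log 2 (1 / \<epsilon>)
                 + real k powr (2/3) * (log 2 (real k)) powr (1/3))) \<and>
    (\<forall>d v. orthonormal d k v \<longrightarrow> real (card {\<omega> \<in> sketches s B d. sketch_fails s d k v \<epsilon> \<omega>})
       \<le> real (card (sketches s B d)) * 2 powr (- (real k powr (2/3))))"
proof -
  \<comment> \<open>For \<open>\<epsilon>\<close> near 1 the logarithm
    \<open>ln (1 / \<epsilon>)\<close> tends to 0 and \<open>D \<ge> 1\<close> would fail. The cap
    1/3 gives \<open>ln (1 / e) \<ge> 1\<close>, since 3 exceeds \<open>exp 1\<close>, and a sketch
    that is good for \<open>e\<close> is good for \<open>\<epsilon>\<close>.\<close>
  define e where "e = min \<epsilon> (1 / 3)"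
  define \<kappa> where "\<kappa> = log 2 (real k)"
  define \<tau> where "\<tau> = (real k / \<kappa>) powr (1/3)"
  define D where "D = min (ln (1 / e)) \<tau>"
  define cB where "cB = 10 * row_const + 1"
  define s where "s = nat \<lceil>17920 * real k / (e * D)\<rceil>"
  define B where "B = nat \<lceil>cB * D / e\<rceil>"
  have cB1: "1 \<le> cB" using row_const_pos unfolding cB_def by simp
  have e: "0 < e" "e \<le> 1 / 3" "e \<le> \<epsilon>" "\<epsilon> / 3 \<le> e" using \<epsilon> unfolding e_def by auto
  have \<kappa>1: "1 \<le> \<kappa>" unfolding \<kappa>_def using k by (simp add: le_log_iff)
  have \<kappa>k: "\<kappa> \<le> real k"
  proof -
    have "real k < 2 ^ k" using of_nat_less_two_power[of k] by simp
    then show ?thesis unfolding \<kappa>_def using k by (simp add: log_le_iff powr_realpow)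
  qed
  have kk: "1 \<le> real k / \<kappa>" using \<kappa>1 \<kappa>k by simp
  have \<tau>1: "1 \<le> \<tau>" unfolding \<tau>_def by (rule ge_one_powr_ge_zero[OF kk]) simp
  have \<tau>k: "\<tau> \<le> real k"
  proof -
    have "\<tau> \<le> (real k / \<kappa>) powr 1" unfolding \<tau>_def using kk by (intro powr_mono) auto
    also have "\<dots> \<le> real k" using \<kappa>1 k divide_left_mono[of 1 \<kappa> "real k"] by simp
    finally show ?thesis .
  qed
  have ln3: "1 \<le> ln (1 / e)"
  proof -
    have "3 \<le> 1 / e" using e by (simp add: le_divide_eq)
    then have "exp 1 \<le> 1 / e" using exp_le by linarith
    then show ?thesis using e by (simp add: ln_ge_iff)
  qed
  have D: "1 \<le> D" "D \<le> \<tau>" "D \<le> ln (1 / e)" using \<tau>1 ln3 unfolding D_def by auto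
  have s_arg: "1 \<le> 17920 * real k / (e * D)"
  proof -
    have "e * D \<le> 1 * real k" using e D \<tau>k by (intro mult_mono) auto
    then have "e * D \<le> 17920 * real k" by linarith
    then show ?thesis using e D by simp
  qed
  have B_arg: "1 \<le> cB * D / e"
  proof -
    have "1 * 1 \<le> cB * D" using cB1 D by (intro mult_mono) auto
    then show ?thesis using e by simp
  qed
  note s = nat_ceiling_le_twice[OF s_arg, folded s_def]
  note B = nat_ceiling_le_twice[OF B_arg, folded B_def]
  have pos: "0 < s" "0 < B" using s s_arg B B_arg by (auto intro: Nat.gr0I)
  have inv_e: "1 / e \<le> 3 * (1 / \<epsilon>)"
    using e \<epsilon> by (simp add: field_simps)
  note num = failure_bound_numeric[OF k \<kappa>_def \<tau>_def D(1,2)]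
  show ?thesis
  proof (rule exI[of _ s], rule exI[of _ B], intro conjI pos allI impI)
    have "real (s * B) \<le> (2 * (17920 * real k / (e * D))) * (2 * (cB * D / e))"
      unfolding of_nat_mult using s B by (intro mult_mono) auto
    also have "\<dots> = 71680 * cB * real k * (1 / e)\<^sup>2"
      using e D by (simp add: field_simps power2_eq_square)
    also have "\<dots> \<le> 71680 * cB * real k * (3 * (1 / \<epsilon>))\<^sup>2"
      using inv_e e cB1 by (intro mult_left_mono power_mono) auto
    also have "\<dots> = 645120 * cB * (real k / \<epsilon>\<^sup>2)"
      by (simp add: power2_eq_square)
    finally show "real (s * B) \<le> 645120 * (10 * row_const + 1) * (real k / \<epsilon>\<^sup>2)"
      unfolding cB_def .
  next
    define T where "T = real k powr (2/3) * \<kappa> powr (1/3)"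
    \<comment> \<open>The minimum in \<open>D\<close> becomes a maximum in \<open>k / D\<close>,
      which is bounded by the sum of the two terms in the claim on \<open>s\<close>.\<close>
    have kD: "real k / D \<le> 2 * (real k / log 2 (1 / \<epsilon>)) + T"
    proof -
      have "1 / \<epsilon> \<le> 1 / e" using e \<epsilon> by (simp add: frac_le)
      then have "ln (1 / \<epsilon>) \<le> ln (1 / e)" using e \<epsilon> by (subst ln_le_cancel_iff) auto
      moreover have "log 2 (1 / \<epsilon>) / 2 \<le> ln (1 / \<epsilon>)"
      proof -
        have "1 / 2 \<le> ln (2::real)" using ln_le_minus_one[of "1 / 2 :: real"] by (simp add: ln_div)
        then have "log 2 (1 / \<epsilon>) * (1 / 2) \<le> log 2 (1 / \<epsilon>) * ln 2"
          using \<epsilon> by (intro mult_left_mono) auto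
        also have "\<dots> = ln (1 / \<epsilon>)" unfolding log_def by simp
        finally show ?thesis by simp
      qed
      ultimately have l: "log 2 (1 / \<epsilon>) / 2 \<le> ln (1 / e)" by linarith
      have l0: "0 < log 2 (1 / \<epsilon>)" using \<epsilon> by simp
      have "real k / ln (1 / e) \<le> real k / (log 2 (1 / \<epsilon>) / 2)"
        using l l0 by (intro divide_left_mono mult_pos_pos) auto
      then have a: "real k / ln (1 / e) \<le> 2 * (real k / log 2 (1 / \<epsilon>))" by (simp add: mult.commute)
      have b: "real k / \<tau> = T" using num(2) unfolding T_def .
      have c: "0 \<le> real k / log 2 (1 / \<epsilon>)" "0 \<le> T" using l0 unfolding T_def by auto
      show ?thesis
      proof (cases "ln (1 / e) \<le> \<tau>")
        case True
        then have "D = ln (1 / e)" unfolding D_def by simp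
        then show ?thesis using a c by simp
      next
        case False
        then have "D = \<tau>" unfolding D_def by simp
        then show ?thesis using b c by simp
      qed
    qed
    have "real s \<le> 35840 * (1 / e * (real k / D))" using s(2) by simp
    also have "\<dots> \<le> 35840 * ((3 * (1 / \<epsilon>)) * (2 * (real k / log 2 (1 / \<epsilon>)) + T))"
      using inv_e kD e D by (intro mult_left_mono mult_mono) auto
    also have "\<dots> \<le> 35840 * ((3 * (1 / \<epsilon>)) * (2 * (real k / log 2 (1 / \<epsilon>) + T)))"
      using \<epsilon> by (intro mult_left_mono) (auto simp: T_def)
    also have "\<dots> = 215040 * (1 / \<epsilon> * (real k / log 2 (1 / \<epsilon>) + T))" by simp
    finally show "real s \<le> 215040 * (1 / \<epsilon> * (real k / log 2 (1 / \<epsilon>)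
                 + real k powr (2/3) * (log 2 (real k)) powr (1/3)))"
      unfolding T_def \<kappa>_def .
  next
    fix d v assume v: "orthonormal d k v"
    have "real (card {\<omega> \<in> sketches s B d. sketch_fails s d k v \<epsilon> \<omega>})
        \<le> real (card {\<omega> \<in> sketches s B d. sketch_fails s d k v e \<omega>})"
      unfolding of_nat_le_iff using sketch_fails_mono[OF _ e(3)]
      by (intro card_mono) (auto simp: finite_sketches)
    also have "\<dots> \<le> real (card (sketches s B d)) * ((real k * \<tau>\<^sup>2 + 1) ^ nat \<lfloor>\<tau>\<^sup>2\<rfloor> * exp (18 * \<tau>\<^sup>2)
          * (2 * exp (- (28 * real k / D))) + 2 * exp (18 * real k) * (2 * exp (- (28 * real k))))"
      using B(1) unfolding cB_def by (rule sketch_failure_general[OF v e(1) D s(1) pos(1)])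
    also have "\<dots> \<le> real (card (sketches s B d)) * 2 powr (- (real k powr (2/3)))"
      using num(1) by (intro mult_left_mono) auto
    finally show "real (card {\<omega> \<in> sketches s B d. sketch_fails s d k v \<epsilon> \<omega>})
        \<le> real (card (sketches s B d)) * 2 powr (- (real k powr (2/3)))" .
  qed
qed

text \<open>For \<open>k = 1\<close> the ratio \<open>k / lg k\<close> defining
  \<open>\<tau>\<close> breaks down, but the required success probability is only 1/2. One count
  sketch with \<open>B\<close> of order \<open>1 / \<epsilon>\<^sup>2\<close> achieves it by the
  second-moment bound, and \<open>s = 1\<close> is admissible because
  \<open>\<epsilon> * log 2 (1 / \<epsilon>) \<le> 2\<close>.\<close>

lemma sketch_exists_one:
  fixes \<epsilon> :: real
  assumes \<epsilon>: "0 < \<epsilon>" "\<epsilon> < 1"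
  shows "\<exists>B. 0 < B \<and> real B \<le> 2 * (192 * row_const + 3) * (1 / \<epsilon>\<^sup>2) \<and>
    1 \<le> 2 * (1 / \<epsilon> * (1 / log 2 (1 / \<epsilon>))) \<and>
    (\<forall>d v. orthonormal d 1 v \<longrightarrow> real (card {\<omega> \<in> sketches 1 B d. sketch_fails 1 d 1 v \<epsilon> \<omega>})
       \<le> real (card (sketches 1 B d)) * (1 / 2))"
proof -
  \<comment> \<open>The summand 3 gives \<open>B \<ge> 3 \<ge> exp 1\<close>, hence
    \<open>ln B \<ge> 1\<close>. The second-moment bound yields the failure ratio
    \<open>96 * row_const / (B * \<epsilon>\<^sup>2)\<close>, and 192 halves it.\<close>
  define c where "c = 192 * row_const + 3"
  define B where "B = nat \<lceil>c / \<epsilon>\<^sup>2\<rceil>"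
  have e2: "0 < \<epsilon>\<^sup>2" "\<epsilon>\<^sup>2 \<le> 1" using \<epsilon> by (auto simp: power_le_one)
  have c: "3 \<le> c" "192 * row_const \<le> c" using row_const_pos unfolding c_def by auto
  have c3: "3 \<le> c / \<epsilon>\<^sup>2"
  proof -
    have "3 * \<epsilon>\<^sup>2 \<le> c * 1" using c e2 by (intro mult_mono) auto
    then show ?thesis using e2 by (simp add: le_divide_eq)
  qed
  then have c1: "1 \<le> c / \<epsilon>\<^sup>2" by simp
  note B = nat_ceiling_le_twice[OF c1, folded B_def]
  have B3: "3 \<le> real B" using c3 B by linarith
  have "exp 1 \<le> real B" using B3 exp_le by linarith
  then have lnB: "1 \<le> ln (real B)" using B3 by (simp add: ln_ge_iff)
  show ?thesis
  proof (intro exI[of _ B] conjI allI impI)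
    show "0 < B" using B3 by (auto intro: Nat.gr0I)
    show "real B \<le> 2 * (192 * row_const + 3) * (1 / \<epsilon>\<^sup>2)" using B(2) unfolding c_def by simp
    have l0: "0 < log 2 (1 / \<epsilon>)" using \<epsilon> by simp
    have "1 / 2 \<le> ln (2::real)" using ln_le_minus_one[of "1 / 2 :: real"] by (simp add: ln_div)
    then have "log 2 (1 / \<epsilon>) * (1 / 2) \<le> log 2 (1 / \<epsilon>) * ln 2"
      using l0 by (intro mult_left_mono) auto
    also have "\<dots> = ln (1 / \<epsilon>)" unfolding log_def by simp
    also have "\<dots> \<le> 1 / \<epsilon>" using ln_le_minus_one[of "1 / \<epsilon>"] \<epsilon> by simp
    finally have "\<epsilon> * log 2 (1 / \<epsilon>) \<le> 2" using \<epsilon> by (simp add: field_simps)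
    then show "1 \<le> 2 * (1 / \<epsilon> * (1 / log 2 (1 / \<epsilon>)))"
      using \<epsilon> l0 by (simp only: times_divide_eq_right times_divide_eq_left divide_divide_eq_left mult_1_right le_divide_eq mult_pos_pos) simp
  next
    fix d v assume v: "orthonormal d 1 v"
    define x where "x = v 0"
    have x: "(\<Sum>j<d. (x j)\<^sup>2) \<le> 1" using v unfolding orthonormal_def x_def power2_eq_square by simp
    let ?\<Omega> = "sketches 1 B d"
    have "real (card {\<omega> \<in> ?\<Omega>. sketch_fails 1 d 1 v \<epsilon> \<omega>}) \<le> real (card {\<omega> \<in> ?\<Omega>. \<epsilon> < \<bar>off_form 1 d \<omega> x x\<bar>})"
      unfolding of_nat_le_iff
    proof (rule card_mono)
      show "finite {\<omega> \<in> ?\<Omega>. \<epsilon> < \<bar>off_form 1 d \<omega> x x\<bar>}" by (simp add: finite_sketches)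
      show "{\<omega> \<in> ?\<Omega>. sketch_fails 1 d 1 v \<epsilon> \<omega>} \<subseteq> {\<omega> \<in> ?\<Omega>. \<epsilon> < \<bar>off_form 1 d \<omega> x x\<bar>}"
      proof clarify
        fix \<omega> assume "sketch_fails 1 d 1 v \<epsilon> \<omega>"
        then obtain a where "\<epsilon> * (a 0)\<^sup>2 < \<bar>off_form 1 d \<omega> (\<lambda>c. a 0 * x c) (\<lambda>c. a 0 * x c)\<bar>"
          unfolding sketch_fails_def x_def by auto
        also have "off_form 1 d \<omega> (\<lambda>c. a 0 * x c) (\<lambda>c. a 0 * x c) = off_form 1 d \<omega> x x * (a 0)\<^sup>2"
          using off_form_sym[of 1 d \<omega> x "\<lambda>c. a 0 * x c"]
          by (simp add: off_form_cmult_left power2_eq_square)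
        finally have "\<epsilon> * (a 0)\<^sup>2 < \<bar>off_form 1 d \<omega> x x\<bar> * (a 0)\<^sup>2" by (simp add: abs_mult)
        then show "\<epsilon> < \<bar>off_form 1 d \<omega> x x\<bar>" by (simp add: mult_less_cancel_right)
      qed
    qed
    also have "\<dots> \<le> real (card ?\<Omega>) * (1 / 2)"
    proof -
      define m where "m = real (card {\<omega> \<in> ?\<Omega>. \<epsilon> < \<bar>off_form 1 d \<omega> x x\<bar>})"
      define M where "M = row_const / (64 * real B)"
      have cB: "c \<le> real B * \<epsilon>\<^sup>2" using B(1) e2 by (simp add: divide_le_eq)
      also have "\<dots> \<le> real B * 1" using e2 by (intro mult_left_mono) auto
      finally have "row_const \<le> 64 * real B" using c row_const_pos by linarith
      then have M: "0 \<le> M" "M \<le> 1" using row_const_pos B3 unfolding M_def by auto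
      have "m * ((1 / 32 * \<epsilon>)\<^sup>2 / 2) \<le> real (card ?\<Omega>) * (exp M - 1)"
        using off_form_square_chebyshev[where s = 1 and B = B and d = d and x = x and \<eta> = \<epsilon>] lnB x \<epsilon> unfolding m_def M_def by simp
      also have "\<dots> \<le> real (card ?\<Omega>) * (3 * M)"
      proof (rule mult_left_mono)
        have "exp M \<le> 1 + M * exp 1" using M by (rule exp_minus_one_le)
        also have "\<dots> \<le> 1 + M * 3" using M exp_le by (intro add_left_mono mult_left_mono) auto
        finally show "exp M - 1 \<le> 3 * M" by simp
      qed auto
      finally have "m * \<epsilon>\<^sup>2 \<le> real (card ?\<Omega>) * (96 * row_const) / real B"
        unfolding M_def by (simp add: power2_eq_square field_simps)
      then have "m * (real B * \<epsilon>\<^sup>2) \<le> real (card ?\<Omega>) * (96 * row_const)"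
        using B3 by (simp add: field_simps)
      also have "\<dots> \<le> real (card ?\<Omega>) * (1 / 2 * (real B * \<epsilon>\<^sup>2))"
        using c cB by (intro mult_left_mono) auto
      finally have "m * (real B * \<epsilon>\<^sup>2) \<le> (real (card ?\<Omega>) * (1 / 2)) * (real B * \<epsilon>\<^sup>2)" by simp
      moreover have "0 < real B * \<epsilon>\<^sup>2" using B3 e2 by simp
      ultimately show ?thesis unfolding m_def by (simp only: mult_le_cancel_right_pos)
    qed
    finally show "real (card {\<omega> \<in> ?\<Omega>. sketch_fails 1 d 1 v \<epsilon> \<omega>}) \<le> real (card ?\<Omega>) * (1 / 2)" .
  qed
qed

text \<open>The order of quantifiers matters: \<open>s\<close> and \<open>B\<close> depend on
  \<open>\<epsilon>\<close> and \<open>k\<close> only, before the dimension and the subspace are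
  chosen.\<close>

lemma sketch_exists:
  "\<exists>C1 > 0. \<exists>C2 > 0. \<forall>(\<epsilon>::real) (k::nat). 0 < \<epsilon> \<longrightarrow> \<epsilon> < 1 \<longrightarrow> 0 < k \<longrightarrow>
    (\<exists>s B. 0 < s \<and> 0 < B \<and> real (s * B) \<le> C1 * (real k / \<epsilon>\<^sup>2) \<and>
       real s \<le> C2 * (1 / \<epsilon> * (real k / log 2 (1 / \<epsilon>)
                 + real k powr (2/3) * (log 2 (real k)) powr (1/3))) \<and>
       (\<forall>d v. orthonormal d k v \<longrightarrow> real (card {\<omega> \<in> sketches s B d. sketch_fails s d k v \<epsilon> \<omega>})
          \<le> real (card (sketches s B d)) * 2 powr (- (real k powr (2/3)))))"
proof -
  let ?C1 = "645120 * (10 * row_const + 1)" and ?C2 = "215040 :: real"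
  have pos: "0 < ?C1" "0 < ?C2" using row_const_pos by auto
  have main: "\<exists>s B. 0 < s \<and> 0 < B \<and> real (s * B) \<le> ?C1 * (real k / \<epsilon>\<^sup>2) \<and>
       real s \<le> ?C2 * (1 / \<epsilon> * (real k / log 2 (1 / \<epsilon>)
                 + real k powr (2/3) * (log 2 (real k)) powr (1/3))) \<and>
       (\<forall>d v. orthonormal d k v \<longrightarrow> real (card {\<omega> \<in> sketches s B d. sketch_fails s d k v \<epsilon> \<omega>})
          \<le> real (card (sketches s B d)) * 2 powr (- (real k powr (2/3))))"
    if \<epsilon>: "0 < \<epsilon>" "\<epsilon> < 1" and k: "0 < k" for \<epsilon> :: real and k :: nat
  proof (cases "k = 1")
    case True
    obtain B where B: "0 < B" "real B \<le> 2 * (192 * row_const + 3) * (1 / \<epsilon>\<^sup>2)"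
      "1 \<le> 2 * (1 / \<epsilon> * (1 / log 2 (1 / \<epsilon>)))"
      and fail: "\<forall>d v. orthonormal d 1 v \<longrightarrow> real (card {\<omega> \<in> sketches 1 B d. sketch_fails 1 d 1 v \<epsilon> \<omega>})
         \<le> real (card (sketches 1 B d)) * (1 / 2)"
      using sketch_exists_one[OF \<epsilon>] by blast
    show ?thesis
    proof (rule exI[of _ 1], rule exI[of _ B], intro conjI)
      have "2 * (192 * row_const + 3) * (1 / \<epsilon>\<^sup>2) \<le> ?C1 * (1 / \<epsilon>\<^sup>2)"
        using row_const_pos by (intro mult_right_mono) auto
      then show "real (1 * B) \<le> ?C1 * (real k / \<epsilon>\<^sup>2)" using B(2) True by simp
      show "real 1 \<le> ?C2 * (1 / \<epsilon> * (real k / log 2 (1 / \<epsilon>)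
                 + real k powr (2/3) * (log 2 (real k)) powr (1/3)))"
        using B(3) True by simp
      show "\<forall>d v. orthonormal d k v \<longrightarrow> real (card {\<omega> \<in> sketches 1 B d. sketch_fails 1 d k v \<epsilon> \<omega>})
          \<le> real (card (sketches 1 B d)) * 2 powr (- (real k powr (2/3)))"
        using fail True by (simp add: powr_minus_divide)
    qed (use B in auto)
  next
    case False
    then have "2 \<le> k" using k by simp
    from sketch_exists_large[OF \<epsilon> this] show ?thesis .
  qed
  show ?thesis
    by (rule exI[of _ ?C1], rule conjI[OF pos(1)], rule exI[of _ ?C2], rule conjI[OF pos(2)],
        intro allI impI, rule main)
qed

section \<open>From sketches to random matrices\<close>

text \<open>Independence and span of subsets of \<open>W\<close> mean the same in \<open>W\<close>
  and in the ambient space, whose dimension bounds the size of independent sets. So a maximal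
  independent subset of \<open>W\<close> exists, and it is a basis.\<close>

lemma (in vec_space) subspace_basis_exists:
  assumes W: "VectorSpace.subspace class_ring W V"
  shows "\<exists>A. finite A \<and> A \<subseteq> W \<and> lin_indpt A \<and> span A = W \<and>
    vectorspace.dim class_ring (V\<lparr>carrier := W\<rparr>) = card A"
proof -
  interpret w: vectorspace class_ring "V\<lparr>carrier := W\<rparr>" by (rule subspace_is_vs[OF W])
  have sub: "submodule class_ring W V" using W unfolding VectorSpace.subspace_def by simp
  then have WV: "W \<subseteq> carrier V" unfolding submodule_def by simp
  have li: "w.lin_dep S = lin_dep S" and sp: "w.span S = span S" if "S \<subseteq> W" for S
    using span_li_not_depend[OF that sub] by auto
  have small: "finite S \<and> card S \<le> dim" if "S \<subseteq> W \<and> w.lin_indpt S" for S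
    using that WV li[of S] li_le_dim[OF fin_dim, of S] by auto
  have "w.lin_indpt {}" unfolding w.lin_dep_def by auto
  then have "\<exists>A. finite A \<and> maximal A (\<lambda>S. S \<subseteq> W \<and> w.lin_indpt S)"
    using small by (intro maximal_exists[where N = dim and B = "{}"]) auto
  then obtain A where A: "finite A" "maximal A (\<lambda>S. S \<subseteq> W \<and> w.lin_indpt S)" by blast
  have basis: "w.basis A"
    using A by (intro w.max_li_is_basis) auto
  then have AW: "A \<subseteq> W" "w.lin_indpt A" "w.span A = W" unfolding w.basis_def by auto
  show ?thesis
    using A(1) AW li[OF AW(1)] sp[OF AW(1)] w.dim_basis[OF A(1) basis] by blast
qed


lemma subspace_orthonormal_basis_exists:
  assumes "is_subspace_of_dim d k V"
  shows "\<exists>v. orthonormal d k v \<and> V = range (\<lambda>a. Matrix.vec d (\<lambda>c. \<Sum>i<k. a i * v i c))"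
proof -
  interpret cof_vec_space d "TYPE(real)" .
  obtain A where A: "finite A" "A \<subseteq> V" "lin_indpt A" "span A = V" "card A = k"
    using subspace_basis_exists[of V] assms unfolding is_subspace_of_dim_def by auto
  have "V \<subseteq> carrier_vec d"
    using assms unfolding is_subspace_of_dim_def VectorSpace.subspace_def submodule_def
    by (auto simp: module_vec_simps)
  with A have Ac: "A \<subseteq> carrier_vec d" by auto
  obtain ws where ws: "set ws = A" "distinct ws" using finite_distinct_list[OF A(1)] by auto
  define us where "us = gram_schmidt d ws"
  have us: "span (set us) = V" "corthogonal us" "set us \<subseteq> carrier_vec d" "length us = k" "distinct us"
    using gram_schmidt_result[of ws us] Ac A ws us_def distinct_card[OF ws(2)] by auto
  have usc: "us ! i \<in> carrier_vec d" if "i < k" for i using us that by auto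
  have cong: "conjugate w = w" for w :: "real Matrix.vec"
    by (intro eq_vecI) auto
  have sp: "us ! i \<bullet> us ! j = (\<Sum>c<d. us ! i $ c * us ! j $ c)" if "i < k" "j < k" for i j
    using usc[OF that(2)] by (simp add: scalar_prod_def lessThan_atLeast0)
  have orth: "us ! i \<bullet> us ! j = 0 \<longleftrightarrow> i \<noteq> j" if "i < k" "j < k" for i j
    using corthogonalD[OF us(2), of i j] that us(4) by (simp add: cong)
  \<comment> \<open>The Gram-Schmidt procedure used here yields orthogonal vectors that are nonzero
    but not normalised.\<close>
  define n where "n i = sqrt (us ! i \<bullet> us ! i)" for i
  have n2: "n i * n i = us ! i \<bullet> us ! i" "n i \<noteq> 0" if "i < k" for i
  proof -
    have "0 \<le> us ! i \<bullet> us ! i" unfolding sp[OF that that] by (intro sum_nonneg) auto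
    then show "n i * n i = us ! i \<bullet> us ! i" unfolding n_def by simp
    show "n i \<noteq> 0" unfolding n_def using orth[OF that that] by simp
  qed
  define v where "v i c = us ! i $ c / n i" for i c
  have "orthonormal d k v"
    unfolding orthonormal_def
  proof (intro allI impI)
    fix i j assume ij: "i < k" "j < k"
    have "(\<Sum>c<d. v i c * v j c) = (us ! i \<bullet> us ! j) / (n i * n j)"
      unfolding sp[OF ij] v_def sum_divide_distrib by simp
    then show "(\<Sum>c<d. v i c * v j c) = (if i = j then 1 else 0)"
      using orth[OF ij] n2[OF ij(1)] by auto
  qed
  moreover have "V = range (\<lambda>a. Matrix.vec d (\<lambda>c. \<Sum>i<k. a i * v i c))"
  proof -
    have bij: "bij_betw ((!) us) {..<k} (set us)" by (rule bij_betw_nth) (use us in auto)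
    have comb: "lincomb b (set us) = Matrix.vec d (\<lambda>c. \<Sum>i<k. b (us ! i) * us ! i $ c)" for b
    proof (rule eq_vecI)
      show "dim_vec (lincomb b (set us)) = dim_vec (Matrix.vec d (\<lambda>c. \<Sum>i<k. b (us ! i) * us ! i $ c))"
        using us(3) lincomb_dim[of "set us"] by simp
      fix c assume "c < dim_vec (Matrix.vec d (\<lambda>c. \<Sum>i<k. b (us ! i) * us ! i $ c))"
      then show "lincomb b (set us) $ c = Matrix.vec d (\<lambda>c. \<Sum>i<k. b (us ! i) * us ! i $ c) $ c"
        using us(3) by (simp add: lincomb_index sum.reindex_bij_betw[OF bij, symmetric])
    qed
    have V: "V = range (\<lambda>b. lincomb b (set us))"
      using finite_span[of "set us"] us(1,3) by auto
    show ?thesis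
    proof (intro equalityI subsetI)
      fix x assume "x \<in> V"
      then obtain b where "x = lincomb b (set us)" using V by auto
      also have "\<dots> = Matrix.vec d (\<lambda>c. \<Sum>i<k. (b (us ! i) * n i) * v i c)"
        unfolding comb using n2 by (intro eq_vecI) (auto simp: v_def intro!: sum.cong)
      finally show "x \<in> range (\<lambda>a. Matrix.vec d (\<lambda>c. \<Sum>i<k. a i * v i c))"
        by (intro image_eqI[where x = "\<lambda>i. b (us ! i) * n i"]) auto
    next
      fix x assume "x \<in> range (\<lambda>a. Matrix.vec d (\<lambda>c. \<Sum>i<k. a i * v i c))"
      then obtain a where x: "x = Matrix.vec d (\<lambda>c. \<Sum>i<k. a i * v i c)" by auto
      \<comment> \<open>Coefficients of \<open>lincomb\<close> are indexed by vectors, not by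
        positions; as \<open>us\<close> is distinct, the position can be recovered from the
        vector.\<close>
      define b where "b u = (let i = the_inv_into {..<k} ((!) us) u in a i / n i)" for u
      have "b (us ! i) = a i / n i" if "i < k" for i
        using that bij unfolding b_def by (simp add: the_inv_into_f_f bij_betw_def)
      then have "x = lincomb b (set us)"
        unfolding x comb by (intro eq_vecI) (auto simp: v_def intro!: sum.cong)
      then show "x \<in> V" using V by blast
    qed
  qed
  ultimately show ?thesis by blast
qed

section \<open>The sketch matrix, its sparsity and its norm\<close>

text \<open>Row \<open>a * B + r\<close> is bucket \<open>r\<close> of block \<open>a\<close>, hence
  the quotient and remainder of \<open>i\<close> by \<open>B\<close>.\<close>

definition sketch_mat :: "nat \<Rightarrow> nat \<Rightarrow> nat \<Rightarrow> (nat \<Rightarrow> nat \<Rightarrow> nat \<times> real) \<Rightarrow> real mat" where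
  "sketch_mat s B d \<omega> = mat (s * B) d (\<lambda>(i, j).
     if fst (\<omega> (i div B) j) = i mod B then snd (\<omega> (i div B) j) / sqrt (real s) else 0)"

lemma sketch_mat_carrier: "sketch_mat s B d \<omega> \<in> carrier_mat (s * B) d"
  unfolding sketch_mat_def by simp

lemma sparse_sketch_mat: "sparse_mat s (sketch_mat s B d \<omega>)"
  unfolding sparse_mat_def
proof (intro allI impI)
  let ?A = "sketch_mat s B d \<omega>"
  fix j assume "j < dim_col ?A"
  then have j: "j < d" by (simp add: sketch_mat_def)
  have "{i. i < dim_row ?A \<and> ?A $$ (i, j) \<noteq> 0} \<subseteq> (\<lambda>a. a * B + fst (\<omega> a j)) ` {..<s}"
  proof
    fix i assume "i \<in> {i. i < dim_row ?A \<and> ?A $$ (i, j) \<noteq> 0}"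
    then have i: "i < s * B" "fst (\<omega> (i div B) j) = i mod B"
      using j by (auto simp: sketch_mat_def split: if_splits)
    have "i div B < s" using i(1) by (simp add: less_mult_imp_div_less)
    then show "i \<in> (\<lambda>a. a * B + fst (\<omega> a j)) ` {..<s}"
      using i(2) by (intro image_eqI[where x = "i div B"]) auto
  qed
  then have "card {i. i < dim_row ?A \<and> ?A $$ (i, j) \<noteq> 0} \<le> card ((\<lambda>a. a * B + fst (\<omega> a j)) ` {..<s})"
    by (intro card_mono) auto
  also have "\<dots> \<le> s" using card_image_le[of "{..<s}"] by simp
  finally show "card {i. i < dim_row ?A \<and> ?A $$ (i, j) \<noteq> 0} \<le> s" .
qed

lemma l2_norm_square: "(l2_norm x)\<^sup>2 = (\<Sum>i<dim_vec x. (x $ i)\<^sup>2)"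
  unfolding l2_norm_def L2_set_def by (simp add: sum_nonneg)

lemma l2_norm_square_mult_mat_vec:
  assumes "A \<in> carrier_mat m d" "x \<in> carrier_vec d"
  shows "(l2_norm (A *\<^sub>v x))\<^sup>2 = (\<Sum>i<m. (\<Sum>j<d. A $$ (i, j) * x $ j)\<^sup>2)"
  using assms unfolding l2_norm_square
  by (intro sum.cong) (auto simp: scalar_prod_def lessThan_atLeast0)

text \<open>Signs square to 1, so each of the \<open>s\<close> blocks contributes the full
  \<open>\<Sum>j<d. (x j)\<^sup>2\<close> on the diagonal, and the scaling \<open>1 / sqrt s\<close>
  averages these. The norm is therefore exact up to the off-diagonal form.\<close>

lemma sketch_mat_norm:
  assumes \<omega>: "\<omega> \<in> sketches s B d" and "0 < s" "0 < B"
  shows "(l2_norm (sketch_mat s B d \<omega> *\<^sub>v Matrix.vec d x))\<^sup>2 = (\<Sum>j<d. (x j)\<^sup>2) + off_form s d \<omega> x x"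
proof -
  have \<theta>: "\<omega> a \<in> hashes B d" if "a < s" for a using \<omega> that unfolding sketches_def by auto
  have "(l2_norm (sketch_mat s B d \<omega> *\<^sub>v Matrix.vec d x))\<^sup>2
      = (\<Sum>i<s * B. (\<Sum>j<d. sketch_mat s B d \<omega> $$ (i, j) * x j)\<^sup>2)"
    by (subst l2_norm_square_mult_mat_vec[OF sketch_mat_carrier]) auto
  also have "\<dots> = (\<Sum>i<s * B. (bucket (\<omega> (i div B)) x d (i mod B) / sqrt (real s))\<^sup>2)"
    unfolding bucket_def sum_divide_distrib
    by (intro sum.cong refl arg_cong[where f = "\<lambda>t. t\<^sup>2"]) (auto simp: sketch_mat_def)
  also have "\<dots> = (\<Sum>i<s * B. (bucket (\<omega> (i div B)) x d (i mod B))\<^sup>2 / real s)"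
    by (simp add: power_divide)
  also have "\<dots> = (\<Sum>(a, r)\<in>{..<s} \<times> {..<B}. (bucket (\<omega> a) x d r)\<^sup>2 / real s)"
  proof (rule sum.reindex_bij_witness[where i = "\<lambda>(a, r). a * B + r" and j = "\<lambda>i. (i div B, i mod B)"])
    fix p assume "p \<in> {..<s} \<times> {..<B}"
    then obtain a r where p: "p = (a, r)" "a < s" "r < B" by auto
    have "a * B + r < Suc a * B" using p by simp
    also have "\<dots> \<le> s * B" using p by (intro mult_right_mono) auto
    finally show "(case p of (a, r) \<Rightarrow> a * B + r) \<in> {..<s * B}" using p by simp
    show "((case p of (a, r) \<Rightarrow> a * B + r) div B, (case p of (a, r) \<Rightarrow> a * B + r) mod B) = p"
      using p by simp
  qed (use \<open>0 < B\<close> in \<open>auto simp: less_mult_imp_div_less\<close>)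
  also have "\<dots> = (\<Sum>a<s. \<Sum>r<B. bucket (\<omega> a) x d r * bucket (\<omega> a) x d r) / real s"
    by (simp add: sum.cartesian_product[symmetric] sum_divide_distrib power2_eq_square)
  also have "(\<Sum>a<s. \<Sum>r<B. bucket (\<omega> a) x d r * bucket (\<omega> a) x d r)
      = (\<Sum>a<s. (\<Sum>j<d. (x j)\<^sup>2) + (\<Sum>j<d. \<Sum>l<d. if j = l then 0 else collide (\<omega> a) j l * x j * x l))"
  proof (rule sum.cong)
    fix a assume "a \<in> {..<s}"
    then have t: "\<omega> a \<in> hashes B d" using \<theta> by simp
    have "(\<Sum>j<d. \<Sum>l<d. collide (\<omega> a) j l * x j * x l)
        = (\<Sum>j<d. \<Sum>l<d. (if j = l then (x j)\<^sup>2 else 0) + (if j = l then 0 else collide (\<omega> a) j l * x j * x l))"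
    proof (intro sum.cong refl)
      fix j l assume "j \<in> {..<d}" "l \<in> {..<d}"
      then have "snd (\<omega> a j) = 1 \<or> snd (\<omega> a j) = - 1" using hashes_sign[OF t] by simp
      then show "collide (\<omega> a) j l * x j * x l
          = (if j = l then (x j)\<^sup>2 else 0) + (if j = l then 0 else collide (\<omega> a) j l * x j * x l)"
        by (auto simp: collide_def power2_eq_square)
    qed
    also have "\<dots> = (\<Sum>j<d. (x j)\<^sup>2) + (\<Sum>j<d. \<Sum>l<d. if j = l then 0 else collide (\<omega> a) j l * x j * x l)"
      by (simp add: sum.distrib)
    finally show "(\<Sum>r<B. bucket (\<omega> a) x d r * bucket (\<omega> a) x d r)
        = (\<Sum>j<d. (x j)\<^sup>2) + (\<Sum>j<d. \<Sum>l<d. if j = l then 0 else collide (\<omega> a) j l * x j * x l)"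
      unfolding sum_bucket_mult[OF t] .
  qed simp
  also have "\<dots> / real s = (\<Sum>j<d. (x j)\<^sup>2) + off_form s d \<omega> x x"
    using \<open>0 < s\<close> by (simp add: off_form_def sum.distrib add_divide_distrib)
  finally show ?thesis .
qed

lemma sketch_mat_JL:
  assumes v: "orthonormal d k v" and V: "V = range (\<lambda>a. Matrix.vec d (\<lambda>c. \<Sum>i<k. a i * v i c))"
    and \<omega>: "\<omega> \<in> sketches s B d" "0 < s" "0 < B" and ok: "\<not> sketch_fails s d k v \<epsilon> \<omega>"
  shows "JL_matrix \<epsilon> V (sketch_mat s B d \<omega>)"
  unfolding JL_matrix_def V
proof (intro ballI)
  fix x assume "x \<in> range (\<lambda>a. Matrix.vec d (\<lambda>c. \<Sum>i<k. a i * v i c))"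
  then obtain a where x: "x = Matrix.vec d (\<lambda>c. \<Sum>i<k. a i * v i c)" by auto
  have n: "(\<Sum>c<d. (\<Sum>i<k. a i * v i c)\<^sup>2) = (\<Sum>i<k. (a i)\<^sup>2)"
    by (rule orthonormal_combination_norm) (use v in \<open>auto simp: orthonormal_def\<close>)
  then have xn: "(l2_norm x)\<^sup>2 = (\<Sum>i<k. (a i)\<^sup>2)" unfolding l2_norm_square x by simp
  have "\<bar>off_form s d \<omega> (\<lambda>c. \<Sum>i<k. a i * v i c) (\<lambda>c. \<Sum>i<k. a i * v i c)\<bar> \<le> \<epsilon> * (\<Sum>i<k. (a i)\<^sup>2)"
    using ok unfolding sketch_fails_def by (auto simp: not_less)
  moreover have "(l2_norm (sketch_mat s B d \<omega> *\<^sub>v x))\<^sup>2 = (\<Sum>i<k. (a i)\<^sup>2)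
      + off_form s d \<omega> (\<lambda>c. \<Sum>i<k. a i * v i c) (\<lambda>c. \<Sum>i<k. a i * v i c)"
    unfolding x sketch_mat_norm[OF \<omega>] n ..
  ultimately show "(l2_norm (sketch_mat s B d \<omega> *\<^sub>v x))\<^sup>2
      \<in> {(1 - \<epsilon>) * (l2_norm x)\<^sup>2..(1 + \<epsilon>) * (l2_norm x)\<^sup>2}"
    unfolding xn by (auto simp: algebra_simps)
qed

section \<open>Measurability of the JL event\<close>

lemma measurable_mat_entry:
  assumes "i < m" "j < d"
  shows "(\<lambda>A. A $$ (i, j)) \<in> borel_measurable (borel_mat m d)"
proof -
  let ?f = "\<lambda>A. \<lambda>ij \<in> {..<m} \<times> {..<d}. A $$ ij"
  have "?f \<in> borel_mat m d \<rightarrow>\<^sub>M Pi\<^sub>M ({..<m} \<times> {..<d}) (\<lambda>_. borel)"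
    unfolding borel_mat_def by (rule measurable_vimage_algebra1) (auto simp: space_PiM)
  then have "(\<lambda>A. ?f A (i, j)) \<in> borel_measurable (borel_mat m d)"
    by (rule measurable_compose) (use assms in \<open>auto intro!: measurable_component_singleton\<close>)
  then show ?thesis using assms by simp
qed

lemma space_borel_mat: "space (borel_mat m d) = carrier_mat m d"
  unfolding borel_mat_def by simp

text \<open>An explicit rational sequence, needed to replace real coefficients by a countable dense
  set.\<close>

lemma rational_approximation:
  fixes a :: real
  shows "(\<lambda>n. real_of_int \<lfloor>a * real (Suc n)\<rfloor> / real (Suc n)) \<longlonglongrightarrow> a"
proof (rule tendsto_sandwich)
  have "(\<lambda>n. a - inverse (real (Suc n))) \<longlonglongrightarrow> a - 0"
    by (intro tendsto_diff tendsto_const LIMSEQ_inverse_real_of_nat)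
  then show "(\<lambda>n. a - inverse (real (Suc n))) \<longlonglongrightarrow> a" by simp
  show "\<forall>\<^sub>F n in sequentially. a - inverse (real (Suc n)) \<le> real_of_int \<lfloor>a * real (Suc n)\<rfloor> / real (Suc n)"
  proof (intro always_eventually allI)
    fix n
    have "a * real (Suc n) - 1 \<le> real_of_int \<lfloor>a * real (Suc n)\<rfloor>" by linarith
    then have "(a * real (Suc n) - 1) / real (Suc n) \<le> real_of_int \<lfloor>a * real (Suc n)\<rfloor> / real (Suc n)"
      by (rule divide_right_mono) simp
    moreover have "(a * real (Suc n) - 1) / real (Suc n) = a - inverse (real (Suc n))"
      by (simp add: diff_divide_distrib inverse_eq_divide del: of_nat_Suc)
    ultimately show "a - inverse (real (Suc n)) \<le> real_of_int \<lfloor>a * real (Suc n)\<rfloor> / real (Suc n)"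
      by simp
  qed
  show "\<forall>\<^sub>F n in sequentially. real_of_int \<lfloor>a * real (Suc n)\<rfloor> / real (Suc n) \<le> a"
  proof (intro always_eventually allI)
    fix n
    show "real_of_int \<lfloor>a * real (Suc n)\<rfloor> / real (Suc n) \<le> a"
      using of_int_floor_le[of "a * real (Suc n)"] by (simp add: divide_le_eq del: of_nat_Suc)
  qed
qed simp

text \<open>The event is an uncountable intersection over \<open>V\<close>. For a fixed matrix both
  inequalities are closed conditions on the coefficients, so testing rational coefficients suffices,
  and the intersection becomes countable.\<close>

lemma JL_event_measurable:
  fixes v :: "nat \<Rightarrow> nat \<Rightarrow> real"
  assumes V: "V = range (\<lambda>a. Matrix.vec d (\<lambda>c. \<Sum>l<k. a l * v l c))"
  shows "{A \<in> space (restrict_space (borel_mat m d) S). JL_matrix \<epsilon> V A}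
     \<in> sets (restrict_space (borel_mat m d) S)" (is "_ \<in> sets ?N")
proof -
  define G where "G a = (\<Sum>j<d. (\<Sum>l<k. a l * v l j)\<^sup>2)" for a :: "nat \<Rightarrow> real"
  define F where "F a A = (\<Sum>i<m. (\<Sum>j<d. A $$ (i, j) * (\<Sum>l<k. a l * v l j))\<^sup>2)"
    for a and A :: "real mat"
  define P where "P a A \<longleftrightarrow> (1 - \<epsilon>) * G a \<le> F a A \<and> F a A \<le> (1 + \<epsilon>) * G a" for a A
  \<comment> \<open>The values outside \<open>{..<k}\<close> are fixed by extensionality, which
    makes \<open>Q\<close> countable.\<close>
  define Q where "Q = PiE {..<k} (\<lambda>_. \<rat> :: real set)"
  have JL: "JL_matrix \<epsilon> V A \<longleftrightarrow> (\<forall>a. P a A)" if "A \<in> carrier_mat m d" for A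
    unfolding JL_matrix_def V P_def F_def G_def
    using l2_norm_square_mult_mat_vec[OF that] by (simp add: l2_norm_square)
  have dense: "P a A" if PQ: "\<forall>b\<in>Q. P b A" for a A
  proof -
    define b where "b n = (\<lambda>l\<in>{..<k}. real_of_int \<lfloor>a l * real (Suc n)\<rfloor> / real (Suc n))" for n
    have lim: "(\<lambda>n. b n l) \<longlonglongrightarrow> a l" if "l \<in> {..<k}" for l
      unfolding b_def using rational_approximation[of "a l"] that by simp
    have "b n \<in> Q" for n unfolding b_def Q_def by auto
    with PQ have Pb: "P (b n) A" for n by blast
    have F: "(\<lambda>n. F (b n) A) \<longlonglongrightarrow> F a A" unfolding F_def by (intro tendsto_intros lim)
    have G: "(\<lambda>n. G (b n)) \<longlonglongrightarrow> G a" unfolding G_def by (intro tendsto_intros lim)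
    show ?thesis
      unfolding P_def
    proof
      show "(1 - \<epsilon>) * G a \<le> F a A"
        by (rule LIMSEQ_le[OF tendsto_mult_left[OF G] F]) (use Pb in \<open>auto simp: P_def\<close>)
      show "F a A \<le> (1 + \<epsilon>) * G a"
        by (rule LIMSEQ_le[OF F tendsto_mult_left[OF G]]) (use Pb in \<open>auto simp: P_def\<close>)
    qed
  qed
  have [measurable]: "(\<lambda>A. A $$ (i, j)) \<in> borel_measurable ?N" if "i \<in> {..<m}" "j \<in> {..<d}" for i j
    using measurable_mat_entry[of i m j d] that by (intro measurable_restrict_space1) auto
  have "(\<lambda>A. F a A) \<in> borel_measurable ?N" for a
    unfolding F_def by measurable
  then have "Measurable.pred ?N (P a)" for a
    unfolding P_def by measurable
  then have PN: "{A \<in> space ?N. P a A} \<in> sets ?N" for a by (rule predE)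
  have Q: "countable Q" "(\<lambda>l\<in>{..<k}. 0) \<in> Q"
    unfolding Q_def by (auto intro!: countable_PiE countable_rat)
  have "(\<Inter>a\<in>Q. {A \<in> space ?N. P a A}) \<in> sets ?N"
    using Q PN by (intro sets.countable_INT') auto
  moreover have "(\<Inter>a\<in>Q. {A \<in> space ?N. P a A}) = {A \<in> space ?N. \<forall>a\<in>Q. P a A}"
    using Q(2) by blast
  ultimately have "{A \<in> space ?N. \<forall>a\<in>Q. P a A} \<in> sets ?N" by simp
  moreover have "{A \<in> space ?N. \<forall>a\<in>Q. P a A} = {A \<in> space ?N. JL_matrix \<epsilon> V A}"
    using JL dense by (auto simp: space_restrict_space space_borel_mat)
  ultimately show ?thesis by simp
qed

text \<open>The target is the restricted space of sparse matrices because
  \<open>sparse_mat_distribution\<close> prescribes exactly its sigma-algebra.\<close>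

definition sketch_distribution :: "nat \<Rightarrow> nat \<Rightarrow> nat \<Rightarrow> real mat measure" where
  "sketch_distribution s B d = distr (measure_pmf (pmf_of_set (sketches s B d)))
     (restrict_space (borel_mat (s * B) d) {A \<in> carrier_mat (s * B) d. sparse_mat s A}) (sketch_mat s B d)"

lemma sketch_mat_measurable:
  "sketch_mat s B d \<in> measure_pmf p \<rightarrow>\<^sub>M
     restrict_space (borel_mat (s * B) d) {A \<in> carrier_mat (s * B) d. sparse_mat s A}"
  using sketch_mat_carrier[of s B d] sparse_sketch_mat[of s B d]
  by (auto simp: space_restrict_space space_borel_mat)

lemma sparse_sketch_distribution: "sparse_mat_distribution (s * B) d s (sketch_distribution s B d)"
  unfolding sparse_mat_distribution_def sketch_distribution_def
  by (simp add: prob_space.prob_space_distr[OF measure_pmf.prob_space_axioms sketch_mat_measurable])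

lemma sketch_distribution_JL:
  assumes v: "orthonormal d k v" and V: "V = range (\<lambda>a. Matrix.vec d (\<lambda>c. \<Sum>l<k. a l * v l c))"
    and sB: "0 < s" "0 < B"
    and fail: "real (card {\<omega> \<in> sketches s B d. sketch_fails s d k v \<epsilon> \<omega>}) \<le> real (card (sketches s B d)) * p"
  shows "1 - p \<le> measure (sketch_distribution s B d)
     {A \<in> space (sketch_distribution s B d). JL_matrix \<epsilon> V A}"
proof -
  define \<Omega> where "\<Omega> = sketches s B d"
  define S where "S = {A \<in> carrier_mat (s * B) d. sparse_mat s A}"
  define E where "E = {A \<in> space (restrict_space (borel_mat (s * B) d) S). JL_matrix \<epsilon> V A}"
  have \<Omega>: "finite \<Omega>" "0 < real (card \<Omega>)"
    using sB unfolding \<Omega>_def by (auto simp: finite_sketches card_sketches)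
  have "measure (sketch_distribution s B d) {A \<in> space (sketch_distribution s B d). JL_matrix \<epsilon> V A}
      = measure (sketch_distribution s B d) E"
    unfolding sketch_distribution_def E_def S_def by simp
  also have "\<dots> = measure (measure_pmf (pmf_of_set \<Omega>)) (sketch_mat s B d -` E)"
    unfolding sketch_distribution_def \<Omega>_def
    by (subst measure_distr[OF sketch_mat_measurable])
      (use JL_event_measurable[OF V, of "s * B" S \<epsilon>] in \<open>auto simp: E_def S_def\<close>)
  also have "\<dots> = real (card (\<Omega> \<inter> sketch_mat s B d -` E)) / real (card \<Omega>)"
    using \<Omega> by (intro measure_pmf_of_set) auto
  finally have eq: "measure (sketch_distribution s B d)
      {A \<in> space (sketch_distribution s B d). JL_matrix \<epsilon> V A}
      = real (card (\<Omega> \<inter> sketch_mat s B d -` E)) / real (card \<Omega>)" .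
  have "\<Omega> - {\<omega> \<in> \<Omega>. sketch_fails s d k v \<epsilon> \<omega>} \<subseteq> \<Omega> \<inter> sketch_mat s B d -` E"
    using sketch_mat_JL[OF v V _ sB] sketch_mat_carrier[of s B d] sparse_sketch_mat[of s B d]
    by (auto simp: E_def S_def \<Omega>_def space_restrict_space space_borel_mat)
  then have "card (\<Omega> - {\<omega> \<in> \<Omega>. sketch_fails s d k v \<epsilon> \<omega>}) \<le> card (\<Omega> \<inter> sketch_mat s B d -` E)"
    using \<Omega>(1) by (intro card_mono) auto
  moreover have "card \<Omega> - card {\<omega> \<in> \<Omega>. sketch_fails s d k v \<epsilon> \<omega>}
      \<le> card (\<Omega> - {\<omega> \<in> \<Omega>. sketch_fails s d k v \<epsilon> \<omega>})"
    using \<Omega>(1) by (intro diff_card_le_card_Diff) auto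
  ultimately have "real (card \<Omega>) - real (card \<Omega>) * p \<le> real (card (\<Omega> \<inter> sketch_mat s B d -` E))"
    using fail unfolding \<Omega>_def by linarith
  then have "(1 - p) * real (card \<Omega>) \<le> real (card (\<Omega> \<inter> sketch_mat s B d -` E))"
    by (simp add: left_diff_distrib mult.commute)
  then show ?thesis unfolding eq using \<Omega>(2) by (simp add: le_divide_eq)
qed

theorem theorem1p3:
  shows "\<exists>C1 > 0. \<exists>C2 > 0. \<forall>(\<epsilon>::real) (k::nat) (d::nat).
    0 < \<epsilon> \<longrightarrow> \<epsilon> < 1 \<longrightarrow> 0 < k \<longrightarrow> k \<le> d \<longrightarrow>
    (\<exists>(m::nat) (s::nat) (M :: real mat measure).
       real m \<le> C1 * (real k / \<epsilon>\<^sup>2) \<and>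
       real s \<le> C2 * (1 / \<epsilon> * (real k / log 2 (1 / \<epsilon>)
                 + real k powr (2/3) * (log 2 (real k)) powr (1/3))) \<and>
       sparse_mat_distribution m d s M \<and>
       (\<forall>V. is_subspace_of_dim d k V \<longrightarrow>
          measure M {A \<in> space M. JL_matrix \<epsilon> V A} \<ge> 1 - 2 powr (- (real k powr (2/3)))))"
proof -
  obtain C1 C2 :: real where C: "0 < C1" "0 < C2" and
    main: "\<forall>(\<epsilon>::real) (k::nat). 0 < \<epsilon> \<longrightarrow> \<epsilon> < 1 \<longrightarrow> 0 < k \<longrightarrow>
    (\<exists>s B. 0 < s \<and> 0 < B \<and> real (s * B) \<le> C1 * (real k / \<epsilon>\<^sup>2) \<and>
       real s \<le> C2 * (1 / \<epsilon> * (real k / log 2 (1 / \<epsilon>)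
                 + real k powr (2/3) * (log 2 (real k)) powr (1/3))) \<and>
       (\<forall>d v. orthonormal d k v \<longrightarrow> real (card {\<omega> \<in> sketches s B d. sketch_fails s d k v \<epsilon> \<omega>})
          \<le> real (card (sketches s B d)) * 2 powr (- (real k powr (2/3)))))"
    using sketch_exists by (elim exE conjE) (rule that)
  show ?thesis
  proof (rule exI[of _ C1], rule conjI[OF C(1)], rule exI[of _ C2], rule conjI[OF C(2)],
      intro allI impI)
    fix \<epsilon> :: real and k d :: nat
    assume \<epsilon>: "0 < \<epsilon>" "\<epsilon> < 1" and k: "0 < k"
    from main[rule_format, OF \<epsilon> k] obtain s B where sB: "0 < s" "0 < B" "real (s * B) \<le> C1 * (real k / \<epsilon>\<^sup>2)"
       "real s \<le> C2 * (1 / \<epsilon> * (real k / log 2 (1 / \<epsilon>)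
                 + real k powr (2/3) * (log 2 (real k)) powr (1/3)))"
       and fail: "\<forall>d v. orthonormal d k v \<longrightarrow> real (card {\<omega> \<in> sketches s B d. sketch_fails s d k v \<epsilon> \<omega>})
          \<le> real (card (sketches s B d)) * 2 powr (- (real k powr (2/3)))"
      by (elim exE conjE) (rule that)
    have JL: "1 - 2 powr (- (real k powr (2/3)))
        \<le> measure (sketch_distribution s B d) {A \<in> space (sketch_distribution s B d). JL_matrix \<epsilon> V A}"
      if "is_subspace_of_dim d k V" for V
    proof -
      obtain v where v: "orthonormal d k v" "V = range (\<lambda>a. Matrix.vec d (\<lambda>c. \<Sum>l<k. a l * v l c))"
        using subspace_orthonormal_basis_exists[OF \<open>is_subspace_of_dim d k V\<close>] by blast
      then show ?thesis using fail sB by (intro sketch_distribution_JL) auto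
    qed
    show "\<exists>(m::nat) (s::nat) (M :: real mat measure).
       real m \<le> C1 * (real k / \<epsilon>\<^sup>2) \<and>
       real s \<le> C2 * (1 / \<epsilon> * (real k / log 2 (1 / \<epsilon>)
                 + real k powr (2/3) * (log 2 (real k)) powr (1/3))) \<and>
       sparse_mat_distribution m d s M \<and>
       (\<forall>V. is_subspace_of_dim d k V \<longrightarrow>
          measure M {A \<in> space M. JL_matrix \<epsilon> V A} \<ge> 1 - 2 powr (- (real k powr (2/3))))"
      by (rule exI[of _ "s * B"], rule exI[of _ s], rule exI[of _ "sketch_distribution s B d"],
          intro conjI allI impI sB sparse_sketch_distribution JL)
  qed
qed

end
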